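(* Let $n\in\mathbb{N}$, $n>3$, and let $\mathcal{A}\in(0,\infty)$. The first eigenvalue $\lambda_{1,L}(\mathcal{A})$ of the Laplace operator (with vanishing Dirichlet traces) on $\Omega_{(n),\mathcal{A}}$ is simple and equals $(\kappa_{1,L}(\mathcal{A}))^2$, where $\kappa_{1,L}(\mathcal{A})$ is the smallest positive solution $\kappa$ of the transcendental equation $$J_{\frac n2-1}\big(\kappa(1+\tfrac{\mathcal{A}}2)\big)\,Y_{\frac n2-1}\big(\kappa\tfrac{\mathcal{A}}2\big)-J_{\frac n2-1}\big(\kappa\tfrac{\mathcal{A}}2\big)\,Y_{\frac n2-1}\big(\kappa(1+\tfrac{\mathcal{A}}2)\big)=0\quad\text{if } n \text{ is even},$$ $$J_{\frac n2-1}\big(\kappa(1+\tfrac{\mathcal{A}}2)\big)\,J_{-\frac n2+1}\big(\kappa\tfrac{\mathcal{A}}2\big)-J_{\frac n2-1}\big(\kappa\tfrac{\mathcal{A}}2\big)\,J_{-\frac n2+1}\big(\kappa(1+\tfrac{\mathcal{A}}2)\big)=0\quad\text{if } n \text{ is odd}.$$ Writing $\kappa_1:=\kappa_{1,L}(\mathcal{A})$ and $r=\|x\|\in(\tfrac{\mathcal{A}}2,1+\tfrac{\mathcal{A}}2)$, the corresponding first eigenfunction depends only on $r$ and is $$w_{1,L,\mathcal{A}}(x)=\frac{\tilde c_{1,L,\mathcal{A}}}{r^{\frac n2-1}}\Big(J_{\frac n2-1}(\kappa_1 r)-\frac{J_{\frac n2-1}(\kappa_1\mathcal{A}/2)}{Y_{\frac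 n2-1}(\kappa_1\mathcal{A}/2)}\,Y_{\frac n2-1}(\kappa_1 r)\Big)\quad\text{if } n\text{ is even},$$ $$w_{1,L,\mathcal{A}}(x)=\frac{\tilde c_{1,L,\mathcal{A}}}{r^{\frac n2-1}}\Big(J_{\frac n2-1}(\kappa_1 r)-\frac{J_{\frac n2-1}(\kappa_1\mathcal{A}/2)}{J_{-\frac n2+1}(\kappa_1\mathcal{A}/2)}\,J_{-\frac n2+1}(\kappa_1 r)\Big)\quad\text{if } n\text{ is odd},$$ where $\tilde c_{1,L,\mathcal{A}}$ is a scaling constant.
   Context: $\|\cdot\|$ is the Euclidean norm on $\mathbb{R}^n$. For $\mathcal{A}\in(0,\infty)$, $\Omega_{(n),\mathcal{A}}:=\{x\in\mathbb{R}^n:\ \mathcal{A}/2<\|x\|<1+\mathcal{A}/2\}$. The Laplace operator on a domain $\Omega$ is the Friedrichs extension in $L_2(\Omega)$ of $v\mapsto-\Delta v$, $v\in C_c^\infty(\Omega)$ (the Dirichlet Laplacian, with sign making it positive); its first eigenvalue is its smallest eigenvalue, and "simple" means of multiplicity one. $J_\nu$ denotes the Bessel function of the first kind of order $\nu$ and $Y_\nu$ the Bessel function of the second kind (Weber/Neumann function) of order $\nu$. The scaling constant is chosen so that the eigenfunction has $L_2$-norm $1$.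
   Formalization: For exceptional 𝒜 the printed denominator Y_{n/2-1}(κ₁𝒜/2) (resp. J_{-n/2+1}(κ₁𝒜/2)) is zero; there the eigenfunction is instead c r^{1-n/2} Y_{n/2-1}(κ₁r) (resp. c r^{1-n/2} J_{-n/2+1}(κ₁r)); otherwise the formula is as printed. *)

theory Defs
  imports "HOL-Analysis.Analysis"
begin

section \<open>Bessel functions of a positive real argument\<close>

text \<open>The reciprocal Gamma function \<open>rGamma\<close> vanishes at the poles of \<open>Gamma\<close>, so the series is
  the usual one for every real order.  The real power makes it meaningful for \<open>x > 0\<close> only.\<close>

definition bessel_J :: "real \<Rightarrow> real \<Rightarrow> real" where
  "bessel_J \<nu> x =
     (\<Sum>k. (-1) ^ k / fact k * rGamma (\<nu> + real k + 1) * (x / 2) powr (2 * real k + \<nu>))"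

definition bessel_Y :: "real \<Rightarrow> real \<Rightarrow> real" where
  "bessel_Y \<nu> x =
     (let q = (\<lambda>\<mu>. (bessel_J \<mu> x * cos (\<mu> * pi) - bessel_J (- \<mu>) x) / sin (\<mu> * pi))
      in if \<nu> \<in> \<int> then Lim (at \<nu>) q else q \<nu>)"


section \<open>Smooth functions with compact support\<close>

definition partial :: "'n::finite \<Rightarrow> (real ^ 'n \<Rightarrow> real) \<Rightarrow> real ^ 'n \<Rightarrow> real" where
  "partial i f x = frechet_derivative f (at x) (axis i 1)"

primrec C_k :: "nat \<Rightarrow> (real ^ 'n::finite \<Rightarrow> real) \<Rightarrow> bool" where
  "C_k 0 f \<longleftrightarrow> continuous_on UNIV f"
| "C_k (Suc k) f \<longleftrightarrow> (\<forall>x. f differentiable (at x)) \<and> (\<forall>i. C_k k (partial i f))"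

text \<open>Test functions on \<open>\<Omega>\<close> are taken to be extended by zero to the whole space.\<close>

definition test_functions :: "(real ^ 'n::finite) set \<Rightarrow> (real ^ 'n \<Rightarrow> real) set" where
  "test_functions \<Omega> =
     {v. (\<forall>k. C_k k v) \<and> compact (closure {x. v x \<noteq> 0}) \<and> closure {x. v x \<noteq> 0} \<subseteq> \<Omega>}"

definition laplacian :: "(real ^ 'n::finite \<Rightarrow> real) \<Rightarrow> real ^ 'n \<Rightarrow> real" where
  "laplacian v x = (\<Sum>i\<in>UNIV. partial i (partial i v) x)"


section \<open>Square-integrable functions and the Friedrichs extension\<close>

text \<open>Elements of \<open>L2 \<Omega>\<close> are functions rather than classes; equality in the Hilbert space is
  equality almost everywhere on \<open>\<Omega>\<close>.\<close>

definition L2 :: "(real ^ 'n::finite) set \<Rightarrow> (real ^ 'n \<Rightarrow> real) set" where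
  "L2 \<Omega> = {u \<in> borel_measurable (lebesgue_on \<Omega>). integrable (lebesgue_on \<Omega>) (\<lambda>x. (u x)\<^sup>2)}"

definition L2_inner ::
  "(real ^ 'n::finite) set \<Rightarrow> (real ^ 'n \<Rightarrow> real) \<Rightarrow> (real ^ 'n \<Rightarrow> real) \<Rightarrow> real" where
  "L2_inner \<Omega> u v = (\<integral>x. u x * v x \<partial>lebesgue_on \<Omega>)"

definition L2_norm :: "(real ^ 'n::finite) set \<Rightarrow> (real ^ 'n \<Rightarrow> real) \<Rightarrow> real" where
  "L2_norm \<Omega> u = sqrt (L2_inner \<Omega> u u)"

text \<open>Let \<open>S\<close> be a symmetric operator in \<open>L2 \<Omega>\<close> with dense domain \<open>D\<close>, bounded from below.  The
  energy space is the domain of the closure of the quadratic form \<open>\<langle>S v, v\<rangle>\<close>.  The Friedrichs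
  extension, given here as a graph, is the restriction of the adjoint of \<open>S\<close> to those elements of
  its domain which lie in the energy space.\<close>

definition energy_space ::
  "(real ^ 'n::finite) set \<Rightarrow> (real ^ 'n \<Rightarrow> real) set \<Rightarrow>
   ((real ^ 'n \<Rightarrow> real) \<Rightarrow> real ^ 'n \<Rightarrow> real) \<Rightarrow> (real ^ 'n \<Rightarrow> real) set" where
  "energy_space \<Omega> D S =
     {u \<in> L2 \<Omega>. \<exists>\<phi> :: nat \<Rightarrow> real ^ 'n \<Rightarrow> real.
        (\<forall>k. \<phi> k \<in> D) \<and>
        (\<lambda>k. L2_norm \<Omega> (\<lambda>x. \<phi> k x - u x)) \<longlonglongrightarrow> 0 \<and>
        (\<forall>e>0. \<exists>N. \<forall>j\<ge>N. \<forall>k\<ge>N.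
           L2_inner \<Omega> (S (\<lambda>x. \<phi> j x - \<phi> k x)) (\<lambda>x. \<phi> j x - \<phi> k x) < e)}"

definition friedrichs_extension ::
  "(real ^ 'n::finite) set \<Rightarrow> (real ^ 'n \<Rightarrow> real) set \<Rightarrow>
   ((real ^ 'n \<Rightarrow> real) \<Rightarrow> real ^ 'n \<Rightarrow> real) \<Rightarrow>
   ((real ^ 'n \<Rightarrow> real) \<times> (real ^ 'n \<Rightarrow> real)) set" where
  "friedrichs_extension \<Omega> D S =
     {(u, f). u \<in> energy_space \<Omega> D S \<and> f \<in> L2 \<Omega> \<and>
              (\<forall>v\<in>D. L2_inner \<Omega> u (S v) = L2_inner \<Omega> f v)}"

definition dirichlet_laplacian ::
  "(real ^ 'n::finite) set \<Rightarrow> ((real ^ 'n \<Rightarrow> real) \<times> (real ^ 'n \<Rightarrow> real)) set" where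
  "dirichlet_laplacian \<Omega> =
     friedrichs_extension \<Omega> (test_functions \<Omega>) (\<lambda>v x. - laplacian v x)"


section \<open>Eigenvalues of the Dirichlet Laplacian\<close>

definition eigenfunction :: "(real ^ 'n::finite) set \<Rightarrow> real \<Rightarrow> (real ^ 'n \<Rightarrow> real) \<Rightarrow> bool" where
  "eigenfunction \<Omega> \<mu> u \<longleftrightarrow>
     (u, \<lambda>x. \<mu> * u x) \<in> dirichlet_laplacian \<Omega> \<and> \<not> (AE x in lebesgue_on \<Omega>. u x = 0)"

definition eigenvalue :: "(real ^ 'n::finite) set \<Rightarrow> real \<Rightarrow> bool" where
  "eigenvalue \<Omega> \<mu> \<longleftrightarrow> (\<exists>u. eigenfunction \<Omega> \<mu> u)"

definition first_eigenvalue :: "(real ^ 'n::finite) set \<Rightarrow> real \<Rightarrow> bool" where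
  "first_eigenvalue \<Omega> \<mu> \<longleftrightarrow> eigenvalue \<Omega> \<mu> \<and> (\<forall>\<mu>'. eigenvalue \<Omega> \<mu>' \<longrightarrow> \<mu> \<le> \<mu>')"

definition simple_eigenvalue :: "(real ^ 'n::finite) set \<Rightarrow> real \<Rightarrow> bool" where
  "simple_eigenvalue \<Omega> \<mu> \<longleftrightarrow>
     (\<exists>w. eigenfunction \<Omega> \<mu> w \<and>
          (\<forall>u. eigenfunction \<Omega> \<mu> u \<longrightarrow> (\<exists>c. AE x in lebesgue_on \<Omega>. u x = c * w x)))"


section \<open>The annulus\<close>

definition annulus :: "real \<Rightarrow> (real ^ 'n::finite) set" where
  "annulus A = {x. A / 2 < norm x \<and> norm x < 1 + A / 2}"

definition transcendental :: "nat \<Rightarrow> real \<Rightarrow> real \<Rightarrow> real" where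
  "transcendental n A \<kappa> =
     (if even n then
        bessel_J (real n / 2 - 1) (\<kappa> * (1 + A / 2)) * bessel_Y (real n / 2 - 1) (\<kappa> * (A / 2))
        - bessel_J (real n / 2 - 1) (\<kappa> * (A / 2)) * bessel_Y (real n / 2 - 1) (\<kappa> * (1 + A / 2))
      else
        bessel_J (real n / 2 - 1) (\<kappa> * (1 + A / 2)) * bessel_J (- real n / 2 + 1) (\<kappa> * (A / 2))
        - bessel_J (real n / 2 - 1) (\<kappa> * (A / 2)) * bessel_J (- real n / 2 + 1) (\<kappa> * (1 + A / 2)))"

definition smallest_positive_root :: "(real \<Rightarrow> real) \<Rightarrow> real \<Rightarrow> bool" where
  "smallest_positive_root F \<kappa> \<longleftrightarrow> 0 < \<kappa> \<and> F \<kappa> = 0 \<and> (\<forall>\<kappa>'. 0 < \<kappa>' \<and> F \<kappa>' = 0 \<longrightarrow> \<kappa> \<le> \<kappa>')"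

text \<open>The combination of \<open>F\<close> and \<open>G\<close> that vanishes at \<open>z0\<close>, unique up to scaling when \<open>F\<close> and \<open>G\<close>
  have no common zero.  For exceptional values of the annulus parameter the denominator \<open>G z0\<close> is
  zero (then the smallest root \<open>\<kappa>\<close> makes both \<open>\<kappa> * (A / 2)\<close> and \<open>\<kappa> * (1 + A / 2)\<close> zeros of \<open>G\<close>);
  the quotient is then read as infinite, that is, as the limit after rescaling, which is a multiple
  of \<open>G\<close>.  Without this case distinction, \<open>x / 0 = 0\<close> would wrongly produce \<open>F\<close>.\<close>

definition vanishing_combination ::
  "(real \<Rightarrow> real) \<Rightarrow> (real \<Rightarrow> real) \<Rightarrow> real \<Rightarrow> real \<Rightarrow> real" where
  "vanishing_combination F G z0 z = (if G z0 \<noteq> 0 then F z - F z0 / G z0 * G z else G z)"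

definition radial_profile :: "nat \<Rightarrow> real \<Rightarrow> real \<Rightarrow> real \<Rightarrow> real" where
  "radial_profile n A \<kappa> r =
     (if even n then
        vanishing_combination (bessel_J (real n / 2 - 1)) (bessel_Y (real n / 2 - 1))
          (\<kappa> * (A / 2)) (\<kappa> * r)
      else
        vanishing_combination (bessel_J (real n / 2 - 1)) (bessel_J (- real n / 2 + 1))
          (\<kappa> * (A / 2)) (\<kappa> * r))"

end

(*
With s = |x|^2 and nu = n/2 - 1, a function h(|x|^2) satisfies -Laplace u = q u iff
s h'' + (nu + 1) h' + q h / 4 = 0.  The functions r^(-nu) J_nu and r^(-nu) Y_nu (or r^(-nu) J_(-nu))
are, in the variable s, independent solutions for q = 1, so the transcendental equation says that
the solution D_q vanishing at the inner radius also vanishes at the outer one.  For small q it has no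
zero on the annulus, for large q it has one by Sturm comparison, and since zeros are simple the first
zero to appear does so at the outer radius.  Hence at the smallest root D_q is positive inside and
gives a positive solution w of -Laplace w = q w with zero boundary values.

By Jacobi's identity, |grad phi|^2 - q phi^2 integrates to w^2 |grad (phi / w)|^2 for every test
function phi.  So no eigenvalue is smaller than q, and for an eigenfunction u belonging to q with test
functions phi_k -> u in energy norm, the gradients of phi_k / w tend to zero in L2 locally.  Then u / w
is almost everywhere invariant under small translations, hence constant.
*)
theory Submission
  imports Defs "HOL-Real_Asymp.Real_Asymp"
begin


section \<open>Bessel functions as power series\<close>

text \<open>For even n the second solution is defined by a limit in the order, so the series has to
  be differentiated in its order as well as in its argument. Independence of the two solutions is
  read off at s = 0, where one is bounded and the other grows like s^(-\<nu>); the Wronskian itself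
  is not evaluated. Its sign is therefore unknown, which is why a factor \<open>\<sigma>\<close>
  accompanies the ground state.

  The Friedrichs extension is reached through approximating test functions alone. For an arbitrary
  eigenfunction they come with the definition, and its regularity never enters: simplicity is proved
  with a Borel representative and translations. For the explicit solution they have to be
  constructed, smooth and supported strictly inside. Cutting off in the values of \<open>h\<close>
  instead of the radius multiplies \<open>h\<close> and, in the gradient, \<open>h1\<close> by
  bounded factors that tend to 1, so dominated convergence suffices.\<close>

lemma summable_pow_div_fact: "summable (\<lambda>k. real (k + 1) * y ^ k / fact k)" for y :: real
proof (rule summable_comparison_test_ev)
  show "summable (\<lambda>k. (2 * \<bar>y\<bar>) ^ k / fact k)"
    using summable_exp[of "2 * \<bar>y\<bar>"] by (simp add: field_simps)
  have "real (k + 1) \<le> 2 ^ k" for k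
    by (induction k) (auto simp: algebra_simps)
  then have "norm (real (k + 1) * y ^ k / fact k) \<le> (2 * \<bar>y\<bar>) ^ k / fact k" for k
    using mult_right_mono[of "real (k + 1)" "2 ^ k" "\<bar>y\<bar> ^ k / fact k"]
    by (simp add: abs_mult power_mult_distrib power_abs abs_of_nat del: of_nat_add of_nat_Suc)
  then show "\<forall>\<^sub>F k in sequentially. norm (real (k + 1) * y ^ k / fact k) \<le> (2 * \<bar>y\<bar>) ^ k / fact k"
    by simp
qed

text \<open>The formula \<open>- rGamma z * Digamma z\<close> would be wrong at the nonpositive
  integers, where \<open>rGamma\<close> has zeros with nonzero slope; the orders -m of the even case
  lead exactly there.\<close>

definition rGamma_deriv :: "real \<Rightarrow> real" where
  "rGamma_deriv = deriv rGamma"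

lemma DERIV_rGamma: "(rGamma has_field_derivative rGamma_deriv z) (at z)" for z :: real
  unfolding rGamma_deriv_def by (rule DERIV_imp_deriv[THEN ssubst], rule has_field_derivative_rGamma)
    (rule has_field_derivative_rGamma)

text \<open>Differentiating z * rGamma (z + 1) = rGamma z gives a recursion that, unlike the one for
  \<open>Digamma\<close>, remains valid at the poles of \<open>Gamma\<close>.\<close>

lemma rGamma_deriv_plus1: "z * rGamma_deriv (z + 1) + rGamma (z + 1) = rGamma_deriv z"
proof -
  have "((\<lambda>z. rGamma (z + 1)) has_field_derivative rGamma_deriv (z + 1)) (at z)"
    using DERIV_shift DERIV_rGamma by blast
  then have "((\<lambda>z. z * rGamma (z + 1)) has_field_derivative
      z * rGamma_deriv (z + 1) + rGamma (z + 1)) (at z)"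
    by (rule DERIV_cong[OF DERIV_mult[OF DERIV_ident]]) simp
  then have "(rGamma has_field_derivative z * rGamma_deriv (z + 1) + rGamma (z + 1)) (at z)"
    by (simp add: rGamma_plus1)
  then show ?thesis
    using DERIV_rGamma DERIV_unique by blast
qed

text \<open>Shifting by \<open>N\<close> moves the interval into [1, infinity). There each step of
  the functional equation divides by z + k \<ge> 1, so \<open>rGamma\<close> does not grow, while
  its derivative gains at most \<open>M\<close> per step.\<close>

lemma rGamma_bounds:
  fixes l u :: real
  shows "\<exists>N M. \<forall>k\<ge>N. \<forall>z\<in>{l..u}. \<bar>rGamma (z + real k)\<bar> \<le> M \<and>
    \<bar>rGamma_deriv (z + real k)\<bar> \<le> M * real (k + 1)"
proof -
  obtain N :: nat where N: "1 - l \<le> real N" using real_arch_simple by blast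
  have pos: "z > 0" if "z \<in> {l + N..u + N}" for z using that N by auto
  have eq: "rGamma_deriv z = - rGamma z * Digamma z" if "z \<in> {l + N..u + N}" for z
    using pos[OF that] by (intro DERIV_unique[OF DERIV_rGamma has_field_derivative_rGamma_no_nonpos_int])
      (auto elim!: nonpos_Ints_cases)
  have "{l + N..u + N} \<inter> \<int>\<^sub>\<le>\<^sub>0 = {}"
    using pos by (fastforce elim!: nonpos_Ints_cases)
  then have c2: "continuous_on {l + N..u + N} (\<lambda>z. - rGamma z * Digamma z)"
    by (intro continuous_intros continuous_on_Polygamma) auto
  have c1: "continuous_on {l + N..u + N} (rGamma :: real \<Rightarrow> real)"
    by (intro continuous_intros)
  from compact_continuous_image[OF c1 compact_Icc] obtain M1 where
    M1: "\<And>z. z \<in> {l + N..u + N} \<Longrightarrow> \<bar>rGamma z\<bar> \<le> M1"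
    by (force dest!: compact_imp_bounded simp: bounded_iff)
  from compact_continuous_image[OF c2 compact_Icc] obtain M2 where
    M2: "\<And>z. z \<in> {l + N..u + N} \<Longrightarrow> \<bar>- rGamma z * Digamma z\<bar> \<le> M2"
    by (force dest!: compact_imp_bounded simp: bounded_iff)
  define M where "M = max M1 M2"
  have *: "\<bar>rGamma (z + k)\<bar> \<le> M \<and> \<bar>rGamma_deriv (z + k)\<bar> \<le> M * real (k + 1)"
    if "z \<in> {l + N..u + N}" for z and k :: nat
  proof (induction k)
    case 0
    then show ?case using M1[OF that] M2[OF that] eq[OF that] by (auto simp: M_def)
  next
    case (Suc k)
    have z: "z + k \<ge> 1" using that N by auto
    have e1: "rGamma (z + Suc k) = rGamma (z + k) / (z + k)"
      using rGamma_plus1[of "z + k"] z by (simp add: field_simps)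
    have e2: "rGamma_deriv (z + Suc k) = (rGamma_deriv (z + k) - rGamma (z + Suc k)) / (z + k)"
      using rGamma_deriv_plus1[of "z + k"] z by (simp add: field_simps)
    have le: "\<bar>a / (z + k)\<bar> \<le> \<bar>a\<bar>" for a
      using z by (simp add: divide_le_eq mult_le_cancel_left1)
    have b1: "\<bar>rGamma (z + Suc k)\<bar> \<le> M"
      using le[of "rGamma (z + k)"] Suc.IH e1 by simp
    have "\<bar>rGamma_deriv (z + Suc k)\<bar> \<le> \<bar>rGamma_deriv (z + k) - rGamma (z + Suc k)\<bar>"
      unfolding e2 by (rule le)
    also have "\<dots> \<le> M * real (k + 1) + M"
      using b1 Suc.IH by linarith
    finally show ?case using b1 by (simp add: algebra_simps)
  qed
  have M0: "0 \<le> M" if "z \<in> {l..u}" for z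
    using *[of "z + N" 0] that by auto
  show ?thesis
  proof (intro exI[of _ N] exI[of _ M] allI impI ballI conjI)
    fix k :: nat and z assume kz: "N \<le> k" "z \<in> {l..u}"
    then have eq: "z + k = (z + N) + real (k - N)" by (simp add: of_nat_diff)
    have "z + N \<in> {l + N..u + N}" using kz by auto
    note b = *[OF this, of "k - N", folded eq]
    show "\<bar>rGamma (z + k)\<bar> \<le> M" using b by simp
    have "M * real (k - N + 1) \<le> M * real (k + 1)"
      using M0[OF kz(2)] by (intro mult_left_mono) auto
    then show "\<bar>rGamma_deriv (z + k)\<bar> \<le> M * real (k + 1)" using b by linarith
  qed
qed

text \<open>Coefficients in the variable s = x^2: once (x / 2) powr \<nu> is split off, (x / 2)^(2
  k) becomes (s / 4)^k, and an entire function of s remains for every real order.\<close>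

definition bessel_coeff :: "real \<Rightarrow> nat \<Rightarrow> real" where
  "bessel_coeff \<nu> k = (-1/4) ^ k / fact k * rGamma (\<nu> + real k + 1)"

definition bessel_coeff_deriv :: "real \<Rightarrow> nat \<Rightarrow> real" where
  "bessel_coeff_deriv \<nu> k = (-1/4) ^ k / fact k * rGamma_deriv (\<nu> + real k + 1)"

text \<open>One majorant for a whole interval of orders is what the M-test needs to differentiate
  the series termwise in \<nu>. The estimates start late, when the argument of \<open>rGamma\<close>
  has passed the nonpositive integers.\<close>

lemma bessel_coeff_bounds:
  fixes l u s :: real
  obtains B where "summable B"
    "\<forall>\<^sub>F k in sequentially. \<forall>\<nu>\<in>{l..u}. \<bar>bessel_coeff \<nu> k * s ^ k\<bar> \<le> B k"
    "\<forall>\<^sub>F k in sequentially. \<forall>\<nu>\<in>{l..u}. \<bar>bessel_coeff_deriv \<nu> k * s ^ k\<bar> \<le> B k"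
proof -
  obtain N M where M: "\<forall>k\<ge>N. \<forall>z\<in>{l+1..u+1}. \<bar>rGamma (z + real k)\<bar> \<le> M \<and>
      \<bar>rGamma_deriv (z + real k)\<bar> \<le> M * real (k + 1)"
    using rGamma_bounds[of "l+1" "u+1"] by blast
  have abs: "\<bar>(-1/4) ^ k / fact k * y * s ^ k\<bar> = (\<bar>s\<bar> / 4) ^ k / fact k * \<bar>y\<bar>" for k y
    by (simp add: abs_mult power_abs power_divide)
  \<comment> \<open>The factor \<open>k + 1\<close> is the price of the derivative of
    \<open>rGamma\<close>; with it one majorant serves both families.\<close>
  define B where "B k = M * (real (k + 1) * (\<bar>s\<bar> / 4) ^ k / fact k)" for k
  have aux: "\<bar>bessel_coeff \<nu> k * s ^ k\<bar> \<le> B k \<and> \<bar>bessel_coeff_deriv \<nu> k * s ^ k\<bar> \<le> B k"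
    if "N \<le> k" "\<nu> \<in> {l..u}" for k \<nu>
  proof -
    have e: "\<nu> + real k + 1 = \<nu> + 1 + real k" by simp
    have z: "\<nu> + 1 \<in> {l+1..u+1}" using that by auto
    have b1: "\<bar>rGamma (\<nu> + real k + 1)\<bar> \<le> M" unfolding e using M that(1) z by blast
    have b2: "\<bar>rGamma_deriv (\<nu> + real k + 1)\<bar> \<le> M * real (k + 1)"
      unfolding e using M that(1) z by blast
    have "M \<ge> 0" using b1 by linarith
    then have b3: "\<bar>rGamma (\<nu> + real k + 1)\<bar> \<le> M * real (k + 1)"
    proof -
      have "M * 1 \<le> M * real (k + 1)"
        by (rule mult_left_mono) (use \<open>M \<ge> 0\<close> in auto)
      then show ?thesis using b1 by linarith
    qed
    have "(\<bar>s\<bar> / 4) ^ k / fact k * \<bar>y\<bar> \<le> B k" if "\<bar>y\<bar> \<le> M * real (k + 1)" for y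
      using mult_left_mono[OF that, of "(\<bar>s\<bar> / 4) ^ k / fact k"] by (simp add: B_def mult_ac)
    then show ?thesis
      unfolding bessel_coeff_def bessel_coeff_deriv_def abs using b2 b3 by blast
  qed
  show ?thesis
  proof (rule that[of B])
    show "summable B" unfolding B_def by (rule summable_mult[OF summable_pow_div_fact])
    show "\<forall>\<^sub>F k in sequentially. \<forall>\<nu>\<in>{l..u}. \<bar>bessel_coeff \<nu> k * s ^ k\<bar> \<le> B k"
      "\<forall>\<^sub>F k in sequentially. \<forall>\<nu>\<in>{l..u}. \<bar>bessel_coeff_deriv \<nu> k * s ^ k\<bar> \<le> B k"
      using aux unfolding eventually_sequentially by blast+
  qed
qed

lemma summable_bessel_coeff: "summable (\<lambda>k. bessel_coeff \<nu> k * s ^ k)"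
  and summable_bessel_coeff_deriv: "summable (\<lambda>k. bessel_coeff_deriv \<nu> k * s ^ k)"
proof -
  obtain B where "summable B"
    "\<forall>\<^sub>F k in sequentially. \<forall>\<nu>\<in>{\<nu>..\<nu>}. \<bar>bessel_coeff \<nu> k * s ^ k\<bar> \<le> B k"
    "\<forall>\<^sub>F k in sequentially. \<forall>\<nu>\<in>{\<nu>..\<nu>}. \<bar>bessel_coeff_deriv \<nu> k * s ^ k\<bar> \<le> B k"
    by (rule bessel_coeff_bounds[of \<nu> \<nu> s])
  then show "summable (\<lambda>k. bessel_coeff \<nu> k * s ^ k)"
    "summable (\<lambda>k. bessel_coeff_deriv \<nu> k * s ^ k)"
    by (simp_all add: summable_comparison_test_ev[where g = B])
qed

definition bessel_series :: "real \<Rightarrow> real \<Rightarrow> real" where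
  "bessel_series \<nu> s = (\<Sum>k. bessel_coeff \<nu> k * s ^ k)"

text \<open>The derivative is taken in the order \<nu>, not in \<open>s\<close>.\<close>

definition bessel_series_deriv :: "real \<Rightarrow> real \<Rightarrow> real" where
  "bessel_series_deriv \<nu> s = (\<Sum>k. bessel_coeff_deriv \<nu> k * s ^ k)"

lemma bessel_J_eq_series:
  assumes "x > 0"
  shows "bessel_J \<nu> x = (x / 2) powr \<nu> * bessel_series \<nu> (x\<^sup>2)"
proof -
  have "(-1) ^ k / fact k * rGamma (\<nu> + real k + 1) * (x / 2) powr (2 * real k + \<nu>) =
      (x / 2) powr \<nu> * (bessel_coeff \<nu> k * (x\<^sup>2) ^ k)" for k
  proof -
    have "(x / 2) powr (2 * real k) = (x / 2) ^ (2 * k)"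
      using assms powr_realpow[of "x/2" "2 * k"] by simp
    also have "\<dots> = (x\<^sup>2) ^ k / 4 ^ k" by (simp add: power_mult power_divide)
    finally have "(x / 2) powr (2 * real k + \<nu>) = (x\<^sup>2) ^ k / 4 ^ k * (x / 2) powr \<nu>"
      by (simp add: powr_add)
    moreover have "(-1/4 :: real) ^ k = (-1) ^ k / 4 ^ k" by (simp only: power_divide)
    ultimately show ?thesis by (simp only: bessel_coeff_def) (simp add: mult_ac)
  qed
  then show ?thesis
    unfolding bessel_J_def bessel_series_def by (simp add: suminf_mult[OF summable_bessel_coeff])
qed

lemma DERIV_bessel_series_order:
  "((\<lambda>\<nu>. bessel_series \<nu> s) has_field_derivative bessel_series_deriv \<nu> s) (at \<nu>)"
proof -
  obtain B where B: "summable B"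
    "\<forall>\<^sub>F k in sequentially. \<forall>\<nu>'\<in>{\<nu> - 1..\<nu> + 1}. \<bar>bessel_coeff_deriv \<nu>' k * s ^ k\<bar> \<le> B k"
    by (rule bessel_coeff_bounds[of "\<nu> - 1" "\<nu> + 1" s])
  have d: "((\<lambda>\<nu>. bessel_coeff \<nu> k * s ^ k) has_field_derivative bessel_coeff_deriv x k * s ^ k)
      (at x within {\<nu> - 1..\<nu> + 1})" for k x
    unfolding bessel_coeff_def bessel_coeff_deriv_def
  proof -
    have "((\<lambda>\<nu>. rGamma (\<nu> + (real k + 1))) has_field_derivative rGamma_deriv (x + (real k + 1)))
        (at x within {\<nu> - 1..\<nu> + 1})"
      using DERIV_shift DERIV_rGamma has_field_derivative_at_within by blast
    then show "((\<lambda>\<nu>. (-1/4) ^ k / fact k * rGamma (\<nu> + real k + 1) * s ^ k) has_field_derivative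
        (-1/4) ^ k / fact k * rGamma_deriv (x + real k + 1) * s ^ k) (at x within {\<nu> - 1..\<nu> + 1})"
      by (intro DERIV_cmult DERIV_cmult_right) (simp add: add.assoc)
  qed
  have "uniformly_convergent_on {\<nu> - 1..\<nu> + 1} (\<lambda>n x. \<Sum>i<n. bessel_coeff_deriv x i * s ^ i)"
    unfolding uniformly_convergent_on_def
    by (rule exI, rule Weierstrass_m_test_ev[OF _ B(1)]) (use B(2) in simp)
  from has_field_derivative_series'(2)[OF _ d this, of \<nu> \<nu>] show ?thesis
    unfolding bessel_series_def bessel_series_deriv_def
    by (simp add: summable_bessel_coeff)
qed

text \<open>The source \<open>e\<close> vanishes for the Bessel coefficients; for their derivatives
  in the order it records the term produced by differentiating the factor \<nu> + k + 1 of the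
  recurrence.\<close>

lemma power_series_bessel_ode:
  fixes c e :: "nat \<Rightarrow> real"
  assumes sm: "\<And>y. summable (\<lambda>k. c k * y ^ k)"
    and rec: "\<And>k. real (Suc k) * (\<nu> + real (Suc k)) * c (Suc k) = - c k / 4 + e k"
  shows "s * (\<Sum>k. diffs (diffs c) k * s ^ k) + (\<nu> + 1) * (\<Sum>k. diffs c k * s ^ k)
      + (\<Sum>k. c k * s ^ k) / 4 = (\<Sum>k. e k * s ^ k)"
proof -
  have sm1: "summable (\<lambda>k. diffs c k * y ^ k)" for y
    by (rule termdiff_converges_all[OF sm])
  have sm2: "summable (\<lambda>k. diffs (diffs c) k * y ^ k)" for y
    by (rule termdiff_converges_all[OF sm1])
  have "(\<lambda>k. s * (diffs (diffs c) k * s ^ k)) sums (s * (\<Sum>k. diffs (diffs c) k * s ^ k))"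
    by (intro sums_mult summable_sums sm2)
  also have "(\<lambda>k. s * (diffs (diffs c) k * s ^ k)) = (\<lambda>k. real (Suc k) * diffs c (Suc k) * s ^ Suc k)"
    by (auto simp: diffs_def)
  \<comment> \<open>The shift of the index adds only the term k = 0, which is zero because of the
    factor \<open>real k\<close>.\<close>
  finally have "(\<lambda>k. real k * diffs c k * s ^ k) sums (s * (\<Sum>k. diffs (diffs c) k * s ^ k))"
    by (subst (asm) sums_Suc_iff) simp
  then have "(\<lambda>k. real k * diffs c k * s ^ k + (\<nu> + 1) * (diffs c k * s ^ k) + (c k * s ^ k) / 4) sums
     (s * (\<Sum>k. diffs (diffs c) k * s ^ k) + (\<nu> + 1) * (\<Sum>k. diffs c k * s ^ k)
      + (\<Sum>k. c k * s ^ k) / 4)"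
    by (intro sums_add sums_mult sums_divide summable_sums sm sm1)
  also have "(\<lambda>k. real k * diffs c k * s ^ k + (\<nu> + 1) * (diffs c k * s ^ k) + (c k * s ^ k) / 4) =
     (\<lambda>k. e k * s ^ k)"
  proof
    fix k
    have "real k * diffs c k + (\<nu> + 1) * diffs c k + c k / 4 = e k"
      using rec[of k] by (simp add: diffs_def algebra_simps)
    then show "real k * diffs c k * s ^ k + (\<nu> + 1) * (diffs c k * s ^ k) + (c k * s ^ k) / 4 = e k * s ^ k"
      by (metis (no_types, lifting) distrib_right mult.assoc times_divide_eq_left)
  qed
  finally show ?thesis by (simp add: sums_iff)
qed

section \<open>Recurrences for the coefficients and for their derivatives in the order\<close>

lemma bessel_prefactor_rec:
  "(-1/4 :: real) ^ Suc k / fact (Suc k) * real (Suc k) = - ((-1/4) ^ k / fact k) / 4"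
  by (simp add: fact_Suc divide_simps del: of_nat_Suc)

lemma bessel_coeff_rec:
  "real (Suc k) * (\<nu> + real (Suc k)) * bessel_coeff \<nu> (Suc k) = - bessel_coeff \<nu> k / 4"
proof -
  have "real (Suc k) * (\<nu> + real (Suc k)) * bessel_coeff \<nu> (Suc k) =
      ((-1/4 :: real) ^ Suc k / fact (Suc k) * real (Suc k)) *
      ((\<nu> + real (Suc k)) * rGamma (\<nu> + real (Suc k) + 1))"
    by (simp add: bessel_coeff_def mult_ac del: power_Suc fact_Suc of_nat_Suc)
  also have "(\<nu> + real (Suc k)) * rGamma (\<nu> + real (Suc k) + 1) = rGamma (\<nu> + real k + 1)"
    using rGamma_plus1[of "\<nu> + real k + 1"] by (simp add: add_ac)
  finally show ?thesis
    unfolding bessel_prefactor_rec by (simp add: bessel_coeff_def)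
qed

text \<open>This is \<open>bessel_coeff_rec\<close> differentiated in \<nu>: the factor \<nu> + k +
  1 contributes (k + 1) c(k + 1), which is \<open>diffs (bessel_coeff \<nu>) k\<close>.\<close>

lemma bessel_coeff_deriv_rec:
  "real (Suc k) * (\<nu> + real (Suc k)) * bessel_coeff_deriv \<nu> (Suc k) =
    - bessel_coeff_deriv \<nu> k / 4 + (- diffs (bessel_coeff \<nu>) k)"
proof -
  define p :: real where "p = (-1/4 :: real) ^ Suc k / fact (Suc k)"
  have "(\<nu> + real (Suc k)) * rGamma_deriv (\<nu> + real (Suc k) + 1) + rGamma (\<nu> + real (Suc k) + 1)
      = rGamma_deriv (\<nu> + real k + 1)"
    using rGamma_deriv_plus1[of "\<nu> + real k + 1"] by (simp add: add_ac)
  then have e: "(\<nu> + real (Suc k)) * rGamma_deriv (\<nu> + real (Suc k) + 1) =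
      rGamma_deriv (\<nu> + real k + 1) - rGamma (\<nu> + real (Suc k) + 1)"
    by linarith
  have "real (Suc k) * (\<nu> + real (Suc k)) * bessel_coeff_deriv \<nu> (Suc k) =
      (p * real (Suc k)) * ((\<nu> + real (Suc k)) * rGamma_deriv (\<nu> + real (Suc k) + 1))"
    unfolding bessel_coeff_deriv_def p_def[symmetric] by (simp only: mult_ac)
  also have "\<dots> = p * real (Suc k) * rGamma_deriv (\<nu> + real k + 1) - diffs (bessel_coeff \<nu>) k"
    unfolding e diffs_def bessel_coeff_def p_def[symmetric] by (simp only: right_diff_distrib mult_ac)
  finally show ?thesis
    unfolding p_def bessel_prefactor_rec by (simp add: bessel_coeff_deriv_def)
qed


definition bessel_ode ::
  "real \<Rightarrow> (real \<Rightarrow> real) \<Rightarrow> (real \<Rightarrow> real) \<Rightarrow> (real \<Rightarrow> real) \<Rightarrow> (real \<Rightarrow> real) \<Rightarrow> bool" where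
  "bessel_ode \<nu> e y y1 y2 \<longleftrightarrow> (\<forall>s>0. (y has_real_derivative y1 s) (at s) \<and>
     (y1 has_real_derivative y2 s) (at s) \<and> s * y2 s + (\<nu> + 1) * y1 s + y s / 4 = e s)"

lemma bessel_odeD:
  assumes "bessel_ode \<nu> e y y1 y2" "s > 0"
  shows "(y has_real_derivative y1 s) (at s)" "(y1 has_real_derivative y2 s) (at s)"
    "s * y2 s + (\<nu> + 1) * y1 s + y s / 4 = e s"
  using assms by (auto simp: bessel_ode_def)

lemma bessel_ode_add:
  assumes "bessel_ode \<nu> e y y1 y2" "bessel_ode \<nu> f z z1 z2"
  shows "bessel_ode \<nu> (\<lambda>s. e s + f s) (\<lambda>s. y s + z s) (\<lambda>s. y1 s + z1 s) (\<lambda>s. y2 s + z2 s)"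
  unfolding bessel_ode_def
proof (intro allI impI conjI)
  fix s :: real assume s: "s > 0"
  note d = bessel_odeD[OF assms(1) s] bessel_odeD[OF assms(2) s]
  show "((\<lambda>s. y s + z s) has_real_derivative y1 s + z1 s) (at s)"
    "((\<lambda>s. y1 s + z1 s) has_real_derivative y2 s + z2 s) (at s)"
    by (intro DERIV_add d)+
  show "s * (y2 s + z2 s) + (\<nu> + 1) * (y1 s + z1 s) + (y s + z s) / 4 = e s + f s"
    unfolding d(3,6)[symmetric] by (simp add: algebra_simps add_divide_distrib)
qed

lemma bessel_ode_rhs:
  assumes "bessel_ode \<nu> e y y1 y2" "\<And>s. s > 0 \<Longrightarrow> e s = f s"
  shows "bessel_ode \<nu> f y y1 y2"
  using assms by (simp add: bessel_ode_def)

lemma bessel_ode_cmult: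
  assumes "bessel_ode \<nu> e y y1 y2"
  shows "bessel_ode \<nu> (\<lambda>s. c * e s) (\<lambda>s. c * y s) (\<lambda>s. c * y1 s) (\<lambda>s. c * y2 s)"
  unfolding bessel_ode_def
proof (intro allI impI conjI)
  fix s :: real assume s: "s > 0"
  note d = bessel_odeD[OF assms s]
  show "((\<lambda>s. c * y s) has_real_derivative c * y1 s) (at s)"
    "((\<lambda>s. c * y1 s) has_real_derivative c * y2 s) (at s)"
    by (intro DERIV_cmult d)+
  show "s * (c * y2 s) + (\<nu> + 1) * (c * y1 s) + c * y s / 4 = c * e s"
    unfolding d(3)[symmetric] by (simp add: algebra_simps)
qed

text \<open>Differentiating the equation in \<nu> hits its coefficient \<nu> + 1 and leaves the
  source - g1; that is why the second statement shares the witness \<open>g1\<close> of the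
  first.\<close>

lemma bessel_ode_series:
  "\<exists>g1 g2. bessel_ode \<nu> (\<lambda>s. 0) (bessel_series \<nu>) g1 g2 \<and>
     (\<exists>h1 h2. bessel_ode \<nu> (\<lambda>s. - g1 s) (bessel_series_deriv \<nu>) h1 h2)"
proof -
  let ?c = "bessel_coeff \<nu>" and ?d = "bessel_coeff_deriv \<nu>"
  have sm1: "summable (\<lambda>k. diffs ?c k * y ^ k)" "summable (\<lambda>k. diffs ?d k * y ^ k)" for y
    by (rule termdiff_converges_all[OF summable_bessel_coeff] termdiff_converges_all[OF summable_bessel_coeff_deriv])+
  have "bessel_ode \<nu> (\<lambda>s. \<Sum>k. 0 * s ^ k) (\<lambda>s. \<Sum>k. ?c k * s ^ k)
      (\<lambda>s. \<Sum>k. diffs ?c k * s ^ k) (\<lambda>s. \<Sum>k. diffs (diffs ?c) k * s ^ k)"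
    unfolding bessel_ode_def
    by (intro allI impI conjI termdiffs_strong_converges_everywhere summable_bessel_coeff sm1
      power_series_bessel_ode, subst bessel_coeff_rec) simp
  moreover have "bessel_ode \<nu> (\<lambda>s. \<Sum>k. - diffs ?c k * s ^ k) (\<lambda>s. \<Sum>k. ?d k * s ^ k)
      (\<lambda>s. \<Sum>k. diffs ?d k * s ^ k) (\<lambda>s. \<Sum>k. diffs (diffs ?d) k * s ^ k)"
    unfolding bessel_ode_def
    by (intro allI impI conjI termdiffs_strong_converges_everywhere summable_bessel_coeff_deriv sm1
      power_series_bessel_ode bessel_coeff_deriv_rec)
  moreover have "(\<lambda>s. \<Sum>k. - diffs ?c k * s ^ k) = (\<lambda>s. - (\<Sum>k. diffs ?c k * s ^ k))"
    by (simp add: suminf_minus sm1)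
  moreover have "bessel_series \<nu> = (\<lambda>s. \<Sum>k. ?c k * s ^ k)"
    "bessel_series_deriv \<nu> = (\<lambda>s. \<Sum>k. ?d k * s ^ k)"
    by (auto simp: bessel_series_def bessel_series_deriv_def)
  ultimately show ?thesis
    by (intro exI[of _ "\<lambda>s. \<Sum>k. diffs ?c k * s ^ k"] exI conjI) simp_all
qed

lemma isCont_bessel_series: "isCont (bessel_series \<nu>) s"
  and isCont_bessel_series_deriv: "isCont (bessel_series_deriv \<nu>) s"
  unfolding bessel_series_def bessel_series_deriv_def
  using DERIV_isCont[OF termdiffs_strong_converges_everywhere] summable_bessel_coeff summable_bessel_coeff_deriv
  by blast+

text \<open>For s = x^2, x powr -\<nu> * z s equals x powr \<nu> * (s powr -\<nu> * z s), so
  solutions of order -\<nu> can be treated as solutions of order \<nu>.\<close>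

lemma bessel_ode_powr:
  assumes "bessel_ode (- \<nu>) e z z1 z2"
  shows "\<exists>w1 w2. bessel_ode \<nu> (\<lambda>s. s powr - \<nu> * e s) (\<lambda>s. s powr - \<nu> * z s) w1 w2"
proof -
  define w1 where "w1 s = s powr - \<nu> * z1 s - \<nu> * (s powr - \<nu> * (z s / s))" for s
  define w2 where "w2 s = s powr - \<nu> * z2 s - \<nu> * (s powr - \<nu> * (z1 s / s))
    - \<nu> * (s powr - \<nu> * ((z1 s * s - z s) / (s * s)) - \<nu> * (s powr - \<nu> * (z s / s / s)))" for s
  have "bessel_ode \<nu> (\<lambda>s. s powr - \<nu> * e s) (\<lambda>s. s powr - \<nu> * z s) w1 w2"
    unfolding bessel_ode_def
  proof (intro allI impI conjI)
    fix s :: real assume s: "s > 0"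
    note d = bessel_odeD[OF assms s]
    have p: "((\<lambda>s. s powr - \<nu> * f s) has_real_derivative
        s powr - \<nu> * f1 - \<nu> * (s powr - \<nu> * (f s / s))) (at s)"
      if "(f has_real_derivative f1) (at s)" for f f1
      by (rule DERIV_cong[OF DERIV_mult[OF DERIV_fun_powr[OF DERIV_ident s] that]])
        (use s in \<open>simp add: powr_diff\<close>)
    show "((\<lambda>s. s powr - \<nu> * z s) has_real_derivative w1 s) (at s)"
      unfolding w1_def by (rule p[OF d(1)])
    have dq: "((\<lambda>s. z s / s) has_real_derivative (z1 s * s - z s) / (s * s)) (at s)"
      using DERIV_divide[OF d(1) DERIV_ident] s by simp
    show "(w1 has_real_derivative w2 s) (at s)"
      unfolding w1_def w2_def by (intro DERIV_diff DERIV_cmult p d dq)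
    have "s * w2 s + (\<nu> + 1) * w1 s + s powr - \<nu> * z s / 4 =
        s powr - \<nu> * (s * z2 s + (- \<nu> + 1) * z1 s + z s / 4)"
      using s unfolding w1_def w2_def by (simp add: field_simps)
    then show "s * w2 s + (\<nu> + 1) * w1 s + s powr - \<nu> * z s / 4 = s powr - \<nu> * e s"
      using d(3) by simp
  qed
  then show ?thesis by blast
qed

text \<open>The logarithm stems from differentiating (x / 2) powr \<nu> in \<nu>. It creates the
  source g1 + \<nu> g / (2 s), and the order derivative of the series cancels the first
  term.\<close>

lemma bessel_ode_log:
  "\<exists>z1 z2. bessel_ode \<nu> (\<lambda>s. \<nu> * bessel_series \<nu> s / (2 * s))
     (\<lambda>s. ln (s / 4) / 2 * bessel_series \<nu> s + bessel_series_deriv \<nu> s) z1 z2"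
proof -
  let ?g = "bessel_series \<nu>"
  obtain g1 g2 h1 h2 where g: "bessel_ode \<nu> (\<lambda>s. 0) ?g g1 g2"
    and h: "bessel_ode \<nu> (\<lambda>s. - g1 s) (bessel_series_deriv \<nu>) h1 h2"
    using bessel_ode_series by metis
  define l1 where "l1 s = ?g s / (2 * s) + ln (s / 4) / 2 * g1 s" for s
  define l2 where "l2 s = (g1 s * (2 * s) - ?g s * 2) / (2 * s * (2 * s)) + (g1 s / (2 * s) + ln (s / 4) / 2 * g2 s)" for s
  have "bessel_ode \<nu> (\<lambda>s. g1 s + \<nu> * ?g s / (2 * s)) (\<lambda>s. ln (s / 4) / 2 * ?g s) l1 l2"
    unfolding bessel_ode_def
  proof (intro allI impI conjI)
    fix s :: real assume s: "s > 0"
    note d = bessel_odeD[OF g s]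
    have p: "((\<lambda>s. ln (s / 4) / 2 * f s) has_real_derivative f s / (2 * s) + ln (s / 4) / 2 * f1) (at s)"
      if "(f has_real_derivative f1) (at s)" for f f1
      using s that by (auto intro!: derivative_eq_intros)
    show "((\<lambda>s. ln (s / 4) / 2 * ?g s) has_real_derivative l1 s) (at s)"
      unfolding l1_def by (rule p[OF d(1)])
    have dq: "((\<lambda>s. ?g s / (2 * s)) has_real_derivative (g1 s * (2 * s) - ?g s * 2) / (2 * s * (2 * s))) (at s)"
      by (rule DERIV_divide[OF d(1)]) (use s in \<open>auto intro!: derivative_eq_intros\<close>)
    show "(l1 has_real_derivative l2 s) (at s)"
      unfolding l1_def l2_def by (intro DERIV_add p d dq)
    have "s * l2 s + (\<nu> + 1) * l1 s + ln (s / 4) / 2 * ?g s / 4 =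
        g1 s + \<nu> * ?g s / (2 * s) + ln (s / 4) / 2 * (s * g2 s + (\<nu> + 1) * g1 s + ?g s / 4)"
      using s unfolding l1_def l2_def by (simp add: field_simps)
    then show "s * l2 s + (\<nu> + 1) * l1 s + ln (s / 4) / 2 * ?g s / 4 = g1 s + \<nu> * ?g s / (2 * s)"
      using d(3) by simp
  qed
  from bessel_ode_add[OF this h] show ?thesis by auto
qed

text \<open>\<open>s powr (\<nu> + 1)\<close> times the Wronskian is constant.  If it vanished, then \<open>z\<close> would be a multiple
  of the bounded function \<open>y\<close> near \<open>0\<close>, so \<open>s powr \<nu> * z s\<close> would tend to \<open>0\<close>.\<close>

lemma wronskian_nonzero:
  assumes y: "bessel_ode \<nu> (\<lambda>s. 0) y y1 y2" and z: "bessel_ode \<nu> (\<lambda>s. 0) z z1 z2"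
    and "\<nu> > 0" and y0: "(y \<longlongrightarrow> a) (at_right 0)" "a \<noteq> 0"
    and z0: "((\<lambda>s. s powr \<nu> * z s) \<longlongrightarrow> b) (at_right 0)" "b \<noteq> 0"
    and "t > 0"
  shows "y t * z1 t - y1 t * z t \<noteq> 0"
proof
  assume zero: "y t * z1 t - y1 t * z t = 0"
  define W where "W s = s powr (\<nu> + 1) * (y s * z1 s - y1 s * z s)" for s
  have W_deriv: "(W has_real_derivative 0) (at s)" if s: "s > 0" for s
  proof -
    note dy = bessel_odeD[OF y s] and dz = bessel_odeD[OF z s]
    have "(W has_real_derivative (\<nu> + 1) * s powr (\<nu> + 1 - 1) * (y s * z1 s - y1 s * z s) +
        (y1 s * z1 s + z2 s * y s - (y2 s * z s + z1 s * y1 s)) * s powr (\<nu> + 1)) (at s)"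
      unfolding W_def by (intro DERIV_mult DERIV_diff dy dz has_real_derivative_powr s)
    also have "(\<nu> + 1) * s powr (\<nu> + 1 - 1) * (y s * z1 s - y1 s * z s) +
        (y1 s * z1 s + z2 s * y s - (y2 s * z s + z1 s * y1 s)) * s powr (\<nu> + 1)
      = s powr \<nu> * (y s * (s * z2 s + (\<nu> + 1) * z1 s + z s / 4) - z s * (s * y2 s + (\<nu> + 1) * y1 s + y s / 4))"
      using s by (simp add: powr_add algebra_simps)
    finally show ?thesis using dy(3) dz(3) by simp
  qed
  have "W s = W t" if "s > 0" for s
  proof -
    have "\<exists>c. \<forall>s\<in>{0<..}. W s = c"
      by (intro has_field_derivative_zero_constant) (auto intro!: has_field_derivative_at_within[OF W_deriv])
    then show ?thesis using that \<open>t > 0\<close> by force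
  qed
  then have W0: "y s * z1 s - y1 s * z s = 0" if "s > 0" for s
    using zero that by (auto simp: W_def)
  have "\<forall>\<^sub>F s in at_right 0. y s \<noteq> 0"
    using tendsto_imp_eventually_ne[OF y0] .
  then obtain d where d: "d > 0" "\<And>s. 0 < s \<Longrightarrow> s < d \<Longrightarrow> y s \<noteq> 0"
    unfolding eventually_at_right_field by auto
  have dq: "((\<lambda>s. z s / y s) has_real_derivative 0) (at s)" if "0 < s" "s < d" for s
  proof -
    have comm: "z1 s * y s - z s * y1 s = y s * z1 s - y1 s * z s" by (simp only: mult.commute)
    show ?thesis
      by (rule DERIV_cong[OF DERIV_divide[OF bessel_odeD(1)[OF z that(1)] bessel_odeD(1)[OF y that(1)] d(2)[OF that]]])
        (simp only: trans[OF comm W0[OF that(1)]] div_0)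
  qed
  define c where "c = z (d/2) / y (d/2)"
  have zc: "z s = c * y s" if "0 < s" "s < d" for s
  proof -
    have "\<exists>c. \<forall>s\<in>{0<..<d}. z s / y s = c"
      by (rule has_field_derivative_zero_constant)
        (auto intro!: has_field_derivative_at_within[OF dq])
    then have "z s / y s = c" 
      unfolding c_def using that d(1) by force
    then show ?thesis using d(2)[OF that] by (auto simp: field_simps)
  qed
  have "((\<lambda>s. s powr \<nu> * (c * y s)) \<longlongrightarrow> 0 * (c * a)) (at_right 0)"
  proof (intro tendsto_mult y0 tendsto_const)
    show "((\<lambda>s. s powr \<nu>) \<longlongrightarrow> 0) (at_right 0)"
      using \<open>\<nu> > 0\<close> by real_asymp
  qed
  moreover have "\<forall>\<^sub>F s in at_right 0. s powr \<nu> * (c * y s) = s powr \<nu> * z s"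
    unfolding eventually_at_right_field using d(1) zc by auto
  ultimately have "((\<lambda>s. s powr \<nu> * z s) \<longlongrightarrow> 0) (at_right 0)"
    using Lim_transform_eventually by fastforce
  then show False using z0 tendsto_unique[OF trivial_limit_at_right_real] by blast
qed


text \<open>In terms of Bessel functions this is J_(-m) = (-1)^m J_m: the first m coefficients die
  at the zeros of \<open>rGamma\<close>, and the others are those of order m shifted by m.\<close>

lemma bessel_series_neg_nat:
  "bessel_series (- real m) s = (-1/4) ^ m * s ^ m * bessel_series (real m) s"
proof -
  have z: "bessel_coeff (- real m) k = 0" if "k < m" for k
  proof -
    have "- real m + real k + 1 = - real (m - k - 1)"
      using that by (simp add: of_nat_diff)
    then show ?thesis unfolding bessel_coeff_def by (metis mult_zero_right rGamma_eq_zero_iff minus_of_nat_in_nonpos_Ints)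
  qed
  have r: "rGamma (real j + 1) = 1 / fact j" for j :: nat
    by (simp add: rGamma_inverse_Gamma Gamma_fact[symmetric] add.commute inverse_eq_divide)
  have sh: "bessel_coeff (- real m) (k + m) = (-1/4) ^ m * bessel_coeff (real m) k" for k
  proof -
    have e: "- real m + real (k + m) + 1 = real k + 1" "real m + real k + 1 = real (k + m) + 1" by auto
    show ?thesis unfolding bessel_coeff_def e r by (simp add: power_add mult_ac)
  qed
  have "(\<Sum>k. bessel_coeff (- real m) k * s ^ k) =
      (\<Sum>k. bessel_coeff (- real m) (k + m) * s ^ (k + m)) + (\<Sum>k<m. bessel_coeff (- real m) k * s ^ k)"
    by (rule suminf_split_initial_segment[OF summable_bessel_coeff])
  also have "(\<Sum>k<m. bessel_coeff (- real m) k * s ^ k) = 0"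
    by (simp add: z)
  also have "(\<lambda>k. bessel_coeff (- real m) (k + m) * s ^ (k + m)) =
      (\<lambda>k. ((-1/4) ^ m * s ^ m) * (bessel_coeff (real m) k * s ^ k))"
    unfolding sh by (simp add: power_add mult_ac)
  finally show ?thesis
    unfolding bessel_series_def by (simp add: suminf_mult[OF summable_bessel_coeff])
qed

lemma bessel_series_0: "bessel_series \<nu> 0 = rGamma (\<nu> + 1)"
  and bessel_series_deriv_0: "bessel_series_deriv \<nu> 0 = rGamma_deriv (\<nu> + 1)"
  unfolding bessel_series_def bessel_series_deriv_def powser_zero
  by (simp_all add: bessel_coeff_def bessel_coeff_deriv_def)

text \<open>By l'Hospital's rule in the order, \<open>bessel_Y m\<close> is the quotient of the derivatives with respect
  to \<open>\<mu>\<close> of the numerator and the denominator in its definition.  The result is written in the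
  variable \<open>s = x\<^sup>2\<close>, where \<open>ln (s / 4) / 2 = ln (x / 2)\<close>.\<close>

definition bessel_Y2 :: "nat \<Rightarrow> real \<Rightarrow> real" where
  "bessel_Y2 m s = (1 / pi) * ((1/2) ^ m * (ln (s / 4) / 2 * bessel_series (real m) s + bessel_series_deriv (real m) s)
     + (-2) ^ m * (s powr - real m * (ln (s / 4) / 2 * bessel_series (- real m) s + bessel_series_deriv (- real m) s)))"

lemma bessel_Y_nat_eq:
  assumes "x > 0"
  shows "bessel_Y (real m) x = x powr real m * bessel_Y2 m (x\<^sup>2)"
proof -
  define q where "q \<mu> = (bessel_J \<mu> x * cos (\<mu> * pi) - bessel_J (- \<mu>) x) / sin (\<mu> * pi)" for \<mu>
  define L where "L = ln (x / 2)"
  have L: "ln (x\<^sup>2 / 4) / 2 = L"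
    using assms ln_realpow[of "x/2" 2] by (simp add: L_def power_divide)
  let ?g = "\<lambda>\<mu>. L * bessel_series \<mu> (x\<^sup>2) + bessel_series_deriv \<mu> (x\<^sup>2)"
  have dJ: "((\<lambda>\<mu>. bessel_J \<mu> x) has_real_derivative (x / 2) powr \<mu> * ?g \<mu>) (at \<mu>)" for \<mu>
  proof -
    have "((\<lambda>\<mu>. (x / 2) powr \<mu>) has_real_derivative (x / 2) powr \<mu> * L) (at \<mu>)"
      unfolding L_def using assms by (auto intro!: derivative_eq_intros simp: powr_def)
    from DERIV_mult[OF this DERIV_bessel_series_order] show ?thesis
      unfolding bessel_J_eq_series[OF assms] by (simp add: algebra_simps)
  qed
  have dJm: "((\<lambda>\<mu>. bessel_J (- \<mu>) x) has_real_derivative - ((x / 2) powr - \<mu> * ?g (- \<mu>))) (at \<mu>)" for \<mu>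
    using DERIV_chain2[OF dJ DERIV_minus[OF DERIV_ident], of \<mu>] by simp
  define N where "N \<mu> = bessel_J \<mu> x * cos (\<mu> * pi) - bessel_J (- \<mu>) x" for \<mu>
  define N' where "N' = (x / 2) powr real m * ?g (real m) * (-1) ^ m + (x / 2) powr - real m * ?g (- real m)"
  have cm: "cos (real m * pi) = (-1) ^ m" "sin (real m * pi) = 0"
    by (simp_all add: cos_npi sin_npi)
  have dc: "((\<lambda>\<mu>. cos (\<mu> * pi)) has_real_derivative 0) (at (real m))"
    by (rule derivative_eq_intros refl | simp add: cm)+
  have ds: "((\<lambda>\<mu>. sin (\<mu> * pi)) has_real_derivative (-1) ^ m * pi) (at (real m))"
    by (rule derivative_eq_intros refl | simp add: cm)+
  have dN: "(N has_real_derivative N') (at (real m))"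
    unfolding N_def by (rule DERIV_cong[OF DERIV_diff[OF DERIV_mult[OF dJ dc] dJm]])
      (simp add: N'_def cm)
  \<comment> \<open>By J_(-m) = (-1)^m J_m the numerator vanishes at m together with the sine, so
    \<open>q\<close> is a quotient of two difference quotients.\<close>
  have N0: "N (real m) = 0"
  proof -
    have "(x / 2) powr - real m * ((-1/4) ^ m * (x\<^sup>2) ^ m) = (x / 2) powr real m * (-1) ^ m"
    proof -
      have "(-1/4) ^ m * (x\<^sup>2) ^ m = (-1) ^ m * ((x/2) ^ m * (x/2) ^ m)"
        by (simp add: power_mult_distrib[symmetric] power2_eq_square)
      then show ?thesis using assms by (simp add: powr_minus powr_realpow field_simps)
    qed
    then show ?thesis
      unfolding N_def bessel_J_eq_series[OF assms] bessel_series_neg_nat cm by (simp add: mult_ac)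
  qed
  have "((\<lambda>\<mu>. ((N \<mu> - N (real m)) / (\<mu> - real m)) / ((sin (\<mu> * pi) - sin (real m * pi)) / (\<mu> - real m)))
      \<longlongrightarrow> N' / ((-1) ^ m * pi)) (at (real m))"
    using dN ds by (intro tendsto_divide) (auto simp: has_field_derivative_iff)
  moreover have "\<forall>\<^sub>F \<mu> in at (real m). ((N \<mu> - N (real m)) / (\<mu> - real m)) / ((sin (\<mu> * pi) - sin (real m * pi)) / (\<mu> - real m)) = q \<mu>"
  proof -
    have "q \<mu> = N \<mu> / sin (\<mu> * pi)" for \<mu> by (simp add: q_def N_def)
    then show ?thesis unfolding eventually_at_filter by (intro always_eventually) (auto simp: N0 cm)
  qed
  ultimately have "(q \<longlongrightarrow> N' / ((-1) ^ m * pi)) (at (real m))"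
    using Lim_transform_eventually by blast
  then have "Lim (at (real m)) q = N' / ((-1) ^ m * pi)"
    by (intro tendsto_Lim) auto
  then have "bessel_Y (real m) x = N' / ((-1) ^ m * pi)"
    unfolding bessel_Y_def by (simp add: q_def[abs_def])
  also have "\<dots> = x powr real m * bessel_Y2 m (x\<^sup>2)"
  proof -
    have "(x\<^sup>2) powr - real m = x powr - real m * x powr - real m"
      using assms by (simp add: power2_eq_square powr_mult)
    moreover have "(- 2 :: real) ^ m = (-1) ^ m * 2 ^ m"
      by (metis power_mult_distrib mult_minus1)
    ultimately show ?thesis
      using assms unfolding N'_def bessel_Y2_def L
      by (simp add: powr_divide powr_minus powr_realpow field_simps power_mult_distrib)
  qed
  finally show ?thesis .
qed

text \<open>The orders m and -m leave sources of opposite sign in \<open>bessel_ode_log\<close>;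
  with the weights (1/2)^m and (-2)^m they cancel by \<open>bessel_series_neg_nat\<close>.\<close>

lemma bessel_ode_Y2:
  "\<exists>z1 z2. bessel_ode (real m) (\<lambda>s. 0) (bessel_Y2 m) z1 z2"
proof -
  obtain a1 a2 where a: "bessel_ode (real m) (\<lambda>s. real m * bessel_series (real m) s / (2 * s))
     (\<lambda>s. ln (s / 4) / 2 * bessel_series (real m) s + bessel_series_deriv (real m) s) a1 a2"
    using bessel_ode_log by blast
  obtain b1 b2 where b: "bessel_ode (real m) (\<lambda>s. s powr - real m * ((- real m) * bessel_series (- real m) s / (2 * s)))
     (\<lambda>s. s powr - real m * (ln (s / 4) / 2 * bessel_series (- real m) s + bessel_series_deriv (- real m) s)) b1 b2"
    using bessel_ode_log[of "- real m"] bessel_ode_powr by blast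
  have e: "(1/2) ^ m * (real m * bessel_series (real m) s / (2 * s)) + (-2) ^ m *
      (s powr - real m * ((- real m) * bessel_series (- real m) s / (2 * s))) = 0" if "s > 0" for s
  proof -
    have "s powr - real m * s ^ m = 1"
      using that by (simp add: powr_minus powr_realpow)
    moreover have "(-2 :: real) ^ m * (-1/4) ^ m = (1/2) ^ m"
      by (simp add: power_mult_distrib[symmetric])
    ultimately have H: "(-2) ^ m * (s powr - real m * bessel_series (- real m) s) = (1/2) ^ m * bessel_series (real m) s"
      unfolding bessel_series_neg_nat by (metis (no_types, opaque_lifting) mult.assoc mult.left_commute mult.right_neutral)
    have alg: "a * (c * g / t) + b * (p * ((- c) * h / t)) = c / t * (a * g - b * (p * h))" for a b c g h p t :: real
      by (simp add: algebra_simps diff_divide_distrib)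
    show ?thesis unfolding alg H by simp
  qed
  note sol = bessel_ode_cmult[OF bessel_ode_add[OF bessel_ode_cmult[OF a, of "(1/2) ^ m"]
    bessel_ode_cmult[OF b, of "(-2) ^ m"]], of "1 / pi", folded bessel_Y2_def]
  show ?thesis
    by (rule exI, rule exI, rule bessel_ode_rhs[OF sol]) (simp only: e mult_zero_right)
qed

text \<open>After multiplication by s^m every term carries s^m or s^m * ln (s / 4), except the order
  derivative of the series of order -m. Its value at 0 is rGamma'(1 - m), nonzero because 1 - m is a
  pole of \<open>Gamma\<close>.\<close>

lemma bessel_Y2_at_0:
  assumes "m > 0"
  shows "((\<lambda>s. s powr real m * bessel_Y2 m s) \<longlongrightarrow> (-2) ^ m / pi * rGamma_deriv (1 - real m)) (at_right 0)"
proof -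
  have at0: "((\<lambda>s. f s) \<longlongrightarrow> f 0) (at_right 0)" if "isCont f 0" for f :: "real \<Rightarrow> real"
    using that unfolding isCont_def by (rule tendsto_within_subset) simp
  have ln0: "((\<lambda>s. s powr real m * ln (s / 4)) \<longlongrightarrow> 0) (at_right 0)"
    using assms by real_asymp
  have p0: "((\<lambda>s. s powr real m) \<longlongrightarrow> 0) (at_right 0)"
    using assms by real_asymp
  have "((\<lambda>s. (1 / pi) * ((1/2) ^ m * (s powr real m * ln (s / 4) / 2 * bessel_series (real m) s + s powr real m * bessel_series_deriv (real m) s)
     + (-2) ^ m * ((s powr real m * ln (s / 4)) / 2 * ((-1/4) ^ m * bessel_series (real m) s) + bessel_series_deriv (- real m) s)))
    \<longlongrightarrow> (1 / pi) * ((1/2) ^ m * (0 / 2 * bessel_series (real m) 0 + 0 * bessel_series_deriv (real m) 0)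
     + (-2) ^ m * (0 / 2 * ((-1/4) ^ m * bessel_series (real m) 0) + bessel_series_deriv (- real m) 0))) (at_right 0)"
    by (intro tendsto_intros ln0 p0 at0 isCont_bessel_series isCont_bessel_series_deriv) auto
  moreover have "\<forall>\<^sub>F s in at_right 0.
     (1 / pi) * ((1/2) ^ m * (s powr real m * ln (s / 4) / 2 * bessel_series (real m) s + s powr real m * bessel_series_deriv (real m) s)
     + (-2) ^ m * ((s powr real m * ln (s / 4)) / 2 * ((-1/4) ^ m * bessel_series (real m) s) + bessel_series_deriv (- real m) s))
     = s powr real m * bessel_Y2 m s"
    using eventually_at_right_less[of 0]
  proof eventually_elim
    case (elim s)
    show ?case
      unfolding bessel_Y2_def bessel_series_neg_nat using elim
      by (simp add: powr_minus powr_realpow field_simps)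
  qed
  ultimately show ?thesis
    using Lim_transform_eventually[of _ "(-2) ^ m / pi * bessel_series_deriv (- real m) 0"]
    unfolding bessel_series_deriv_0 by (simp add: add.commute)
qed

text \<open>The poles of \<open>Gamma\<close> are simple, hence so are the zeros of
  \<open>rGamma\<close>.\<close>

lemma rGamma_deriv_nonpos_int: "rGamma_deriv (- real k) \<noteq> 0"
  using DERIV_unique[OF DERIV_rGamma has_field_derivative_rGamma_nonpos_int[of k]] by simp

text \<open>All that is used later of the Bessel functions: two solutions in s with nonvanishing
  Wronskian and the common prefactor x powr \<nu>. The parity of n is hidden in
  \<open>G\<close>.\<close>

lemma bessel_pair:
  assumes "n > 2"
  defines "\<nu> \<equiv> real n / 2 - 1"
  defines "G \<equiv> if even n then bessel_Y \<nu> else bessel_J (- real n / 2 + 1)"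
  shows "\<exists>y y1 y2 z z1 z2. bessel_ode \<nu> (\<lambda>s. 0) y y1 y2 \<and> bessel_ode \<nu> (\<lambda>s. 0) z z1 z2 \<and>
    (\<forall>s>0. y s * z1 s - y1 s * z s \<noteq> 0) \<and>
    (\<forall>x>0. bessel_J \<nu> x = x powr \<nu> * y (x\<^sup>2) \<and> G x = x powr \<nu> * z (x\<^sup>2))"
proof -
  have nu: "\<nu> > 0" using assms(1) by (simp add: \<nu>_def)
  define y where "y s = (1/2) powr \<nu> * bessel_series \<nu> s" for s
  obtain g1 g2 where g: "bessel_ode \<nu> (\<lambda>s. 0) (bessel_series \<nu>) g1 g2"
    using bessel_ode_series by blast
  have y: "bessel_ode \<nu> (\<lambda>s. 0) y (\<lambda>s. (1/2) powr \<nu> * g1 s) (\<lambda>s. (1/2) powr \<nu> * g2 s)"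
    using bessel_ode_cmult[OF g] unfolding y_def[abs_def] by simp
  have Jy: "bessel_J \<nu> x = x powr \<nu> * y (x\<^sup>2)" if "x > 0" for x
    unfolding bessel_J_eq_series[OF that] y_def using that by (simp add: powr_divide)
  have at0: "((\<lambda>s. f s) \<longlongrightarrow> f 0) (at_right 0)" if "isCont f 0" for f :: "real \<Rightarrow> real"
    using that unfolding isCont_def by (rule tendsto_within_subset) simp
  have y0: "(y \<longlongrightarrow> y 0) (at_right 0)" unfolding y_def
    by (intro tendsto_intros at0 isCont_bessel_series)
  have "\<nu> + 1 \<notin> \<int>\<^sub>\<le>\<^sub>0" using nu by (auto elim!: nonpos_Ints_cases)
  then have y0': "y 0 \<noteq> 0" by (simp add: y_def bessel_series_0 rGamma_eq_zero_iff)
  obtain z z1 z2 b where z: "bessel_ode \<nu> (\<lambda>s. 0) z z1 z2"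
    and Gz: "\<And>x. x > 0 \<Longrightarrow> G x = x powr \<nu> * z (x\<^sup>2)"
    and b: "((\<lambda>s. s powr \<nu> * z s) \<longlongrightarrow> b) (at_right 0)" "b \<noteq> 0"
  proof (cases "even n")
    case True
    define m where "m = n div 2 - 1"
    have m: "\<nu> = real m" "m > 0" using True assms(1) by (auto simp: \<nu>_def m_def of_nat_diff elim!: evenE)
    obtain z1 z2 where "bessel_ode \<nu> (\<lambda>s. 0) (bessel_Y2 m) z1 z2"
      using bessel_ode_Y2[of m] unfolding m(1) by blast
    moreover have "G x = x powr \<nu> * bessel_Y2 m (x\<^sup>2)" if "x > 0" for x
      using True bessel_Y_nat_eq[OF that] by (simp add: G_def m)
    moreover have "rGamma_deriv (1 - real m) \<noteq> 0"
      using rGamma_deriv_nonpos_int[of "m - 1"] m by (simp add: of_nat_diff)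
    ultimately show ?thesis
      using that[of "bessel_Y2 m" z1 z2] bessel_Y2_at_0[OF m(2)] m(1) by simp
  next
    case False
    obtain g1 g2 where "bessel_ode (- \<nu>) (\<lambda>s. 0) (bessel_series (- \<nu>)) g1 g2"
      using bessel_ode_series by blast
    from bessel_ode_powr[OF this] obtain w1 w2 where
      "bessel_ode \<nu> (\<lambda>s. 0) (\<lambda>s. s powr - \<nu> * bessel_series (- \<nu>) s) w1 w2" by auto
    from bessel_ode_cmult[OF this, of "2 powr \<nu>"]
    have "bessel_ode \<nu> (\<lambda>s. 0) (\<lambda>s. 2 powr \<nu> * (s powr - \<nu> * bessel_series (- \<nu>) s))
      (\<lambda>s. 2 powr \<nu> * w1 s) (\<lambda>s. 2 powr \<nu> * w2 s)" by simp
    moreover have "G x = x powr \<nu> * (2 powr \<nu> * ((x\<^sup>2) powr - \<nu> * bessel_series (- \<nu>) (x\<^sup>2)))" if "x > 0" for x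
    proof -
      have e: "- real n / 2 + 1 = - \<nu>" by (simp add: \<nu>_def)
      have GJ: "G x = bessel_J (- \<nu>) x" for x using False unfolding G_def e by simp
      have "(x\<^sup>2) powr - \<nu> = x powr - \<nu> * x powr - \<nu>"
        using that by (simp add: power2_eq_square powr_mult)
      then show ?thesis
        using that unfolding GJ bessel_J_eq_series[OF that]
        by (simp add: powr_divide powr_minus field_simps)
    qed
    moreover have "((\<lambda>s. s powr \<nu> * (2 powr \<nu> * (s powr - \<nu> * bessel_series (- \<nu>) s))) \<longlongrightarrow>
        2 powr \<nu> * bessel_series (- \<nu>) 0) (at_right 0)"
    proof (rule Lim_transform_eventually)
      show "((\<lambda>s. 2 powr \<nu> * bessel_series (- \<nu>) s) \<longlongrightarrow> 2 powr \<nu> * bessel_series (- \<nu>) 0) (at_right 0)"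
        by (intro tendsto_intros at0 isCont_bessel_series)
      show "\<forall>\<^sub>F s in at_right 0. 2 powr \<nu> * bessel_series (- \<nu>) s =
          s powr \<nu> * (2 powr \<nu> * (s powr - \<nu> * bessel_series (- \<nu>) s))"
        using eventually_at_right_less[of 0] by eventually_elim (simp add: powr_minus)
    qed
    moreover have "2 powr \<nu> * bessel_series (- \<nu>) 0 \<noteq> 0"
    proof -
      \<comment> \<open>An integer value i would make n = 4 - 2 i even.\<close>
      have "- \<nu> + 1 \<notin> \<int>\<^sub>\<le>\<^sub>0"
      proof
        assume "- \<nu> + 1 \<in> \<int>\<^sub>\<le>\<^sub>0"
        then obtain i where "- \<nu> + 1 = of_int i" by (auto elim!: nonpos_Ints_cases)
        then have "real n = real_of_int (4 - 2 * i)" by (simp add: \<nu>_def)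
        then have "int n = 4 - 2 * i" by linarith
        then show False using False by presburger
      qed
      then show ?thesis by (simp add: bessel_series_0 rGamma_eq_zero_iff)
    qed
    ultimately show ?thesis by (rule that)
  qed
  show ?thesis
    using y z wronskian_nonzero[OF y z nu y0 y0' b] Jy Gz by blast
qed


section \<open>The smallest root of the transcendental equation\<close>

text \<open>The equation of \<open>s \<mapsto> y (q * s)\<close> when \<open>y\<close> solves \<^const>\<open>bessel_ode\<close>.  For
  \<open>\<nu> = n / 2 - 1\<close> it says that \<open>x \<mapsto> h (\<parallel>x\<parallel>\<^sup>2)\<close> is an eigenfunction of \<open>-\<Delta>\<close> for \<open>q\<close>.\<close>

definition radial_ode ::
  "real \<Rightarrow> real \<Rightarrow> (real \<Rightarrow> real) \<Rightarrow> (real \<Rightarrow> real) \<Rightarrow> (real \<Rightarrow> real) \<Rightarrow> bool" where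
  "radial_ode \<nu> q h h1 h2 \<longleftrightarrow> (\<forall>s>0. (h has_real_derivative h1 s) (at s) \<and>
     (h1 has_real_derivative h2 s) (at s) \<and> s * h2 s + (\<nu> + 1) * h1 s + q * h s / 4 = 0)"

lemma radial_odeD:
  assumes "radial_ode \<nu> q y y1 y2" "s > 0"
  shows "(y has_real_derivative y1 s) (at s)" "(y1 has_real_derivative y2 s) (at s)"
    "s * y2 s + (\<nu> + 1) * y1 s + q * y s / 4 = 0"
  using assms by (auto simp: radial_ode_def)

lemma radial_ode_cmult:
  assumes "radial_ode \<nu> q y y1 y2"
  shows "radial_ode \<nu> q (\<lambda>s. c * y s) (\<lambda>s. c * y1 s) (\<lambda>s. c * y2 s)"
  unfolding radial_ode_def
proof (intro allI impI conjI)
  fix s :: real assume s: "s > 0"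
  note d = radial_odeD[OF assms s]
  show "((\<lambda>s. c * y s) has_real_derivative c * y1 s) (at s)"
    "((\<lambda>s. c * y1 s) has_real_derivative c * y2 s) (at s)"
    by (intro DERIV_cmult d)+
  have "s * (c * y2 s) + (\<nu> + 1) * (c * y1 s) + q * (c * y s) / 4 =
      c * (s * y2 s + (\<nu> + 1) * y1 s + q * y s / 4)"
    by (simp add: algebra_simps)
  then show "s * (c * y2 s) + (\<nu> + 1) * (c * y1 s) + q * (c * y s) / 4 = 0"
    using d(3) by simp
qed

lemma radial_ode_combination:
  assumes y: "bessel_ode \<nu> (\<lambda>s. 0) y y1 y2" and z: "bessel_ode \<nu> (\<lambda>s. 0) z z1 z2" and q: "q > 0"
  shows "radial_ode \<nu> q (\<lambda>s. y (q * s) * a - b * z (q * s)) (\<lambda>s. q * (y1 (q * s) * a - b * z1 (q * s)))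
    (\<lambda>s. q * (q * (y2 (q * s) * a - b * z2 (q * s))))"
  unfolding radial_ode_def
proof (intro allI impI conjI)
  fix s :: real assume s: "s > 0"
  have qs: "q * s > 0" using q s by simp
  have ch: "((\<lambda>s. f (q * s)) has_real_derivative q * f1) (at s)"
    if "(f has_real_derivative f1) (at (q * s))" for f f1
    using DERIV_chain2[OF that DERIV_cmult[OF DERIV_ident]] by (simp add: mult.commute)
  note dy = bessel_odeD[OF y qs] and dz = bessel_odeD[OF z qs]
  show "((\<lambda>s. y (q * s) * a - b * z (q * s)) has_real_derivative q * (y1 (q * s) * a - b * z1 (q * s))) (at s)"
    by (rule DERIV_cong[OF DERIV_diff[OF DERIV_cmult_right[OF ch[OF dy(1)]] DERIV_cmult[OF ch[OF dz(1)]]]])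
      (simp add: algebra_simps)
  show "((\<lambda>s. q * (y1 (q * s) * a - b * z1 (q * s))) has_real_derivative
      q * (q * (y2 (q * s) * a - b * z2 (q * s)))) (at s)"
    by (rule DERIV_cong[OF DERIV_cmult[OF DERIV_diff[OF DERIV_cmult_right[OF ch[OF dy(2)]] DERIV_cmult[OF ch[OF dz(2)]]]]])
      (simp add: algebra_simps)
  have "s * (q * (q * (y2 (q * s) * a - b * z2 (q * s)))) + (\<nu> + 1) * (q * (y1 (q * s) * a - b * z1 (q * s)))
      + q * (y (q * s) * a - b * z (q * s)) / 4 =
     q * a * (q * s * y2 (q * s) + (\<nu> + 1) * y1 (q * s) + y (q * s) / 4) -
     q * b * (q * s * z2 (q * s) + (\<nu> + 1) * z1 (q * s) + z (q * s) / 4)"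
    by (simp add: algebra_simps add_divide_distrib diff_divide_distrib)
  then show "s * (q * (q * (y2 (q * s) * a - b * z2 (q * s)))) + (\<nu> + 1) * (q * (y1 (q * s) * a - b * z1 (q * s)))
      + q * (y (q * s) * a - b * z (q * s)) / 4 = 0"
    using dy(3) dz(3) by simp
qed

text \<open>\<open>Z s = s powr (\<nu> / 2) * h s\<close> satisfies \<open>s * (s * Z')' = (\<nu>\<^sup>2 - q * s) / 4 * Z\<close>.\<close>

lemma radial_ode_normal_form:
  assumes "radial_ode \<nu> q h h1 h2"
  defines "Z \<equiv> \<lambda>s. s powr (\<nu> / 2) * h s"
  defines "V \<equiv> \<lambda>s. s powr (\<nu> / 2) * (\<nu> / 2 * h s + s * h1 s)"
  assumes s: "s > 0"
  shows "(Z has_real_derivative V s / s) (at s)"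
    "(V has_real_derivative (\<nu>\<^sup>2 - q * s) / 4 * Z s / s) (at s)"
proof -
  note d = radial_odeD[OF assms(1) s]
  have p: "((\<lambda>s. s powr (\<nu> / 2)) has_real_derivative \<nu> / 2 * s powr (\<nu> / 2) / s) (at s)"
    using has_real_derivative_powr[OF s, of "\<nu> / 2"] s by (simp add: powr_diff)
  show "(Z has_real_derivative V s / s) (at s)"
    unfolding Z_def V_def by (rule DERIV_cong[OF DERIV_mult[OF p d(1)]]) (use s in \<open>simp add: field_simps\<close>)
  have "((\<lambda>s. \<nu> / 2 * h s + s * h1 s) has_real_derivative \<nu> / 2 * h1 s + (1 * h1 s + h2 s * s)) (at s)"
    by (intro DERIV_add DERIV_cmult DERIV_mult DERIV_ident d)
  from DERIV_mult[OF p this]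
  have "(V has_real_derivative \<nu> / 2 * s powr (\<nu> / 2) / s * (\<nu> / 2 * h s + s * h1 s) +
    (\<nu> / 2 * h1 s + (1 * h1 s + h2 s * s)) * s powr (\<nu> / 2)) (at s)" by (simp add: V_def)
  also have "\<nu> / 2 * s powr (\<nu> / 2) / s * (\<nu> / 2 * h s + s * h1 s) +
    (\<nu> / 2 * h1 s + (1 * h1 s + h2 s * s)) * s powr (\<nu> / 2) =
    (\<nu>\<^sup>2 - q * s) / 4 * Z s / s + s powr (\<nu> / 2) * (s * h2 s + (\<nu> + 1) * h1 s + q * h s / 4)"
    using s unfolding Z_def by (simp add: field_simps power2_eq_square)
  finally show "(V has_real_derivative (\<nu>\<^sup>2 - q * s) / 4 * Z s / s) (at s)"
    using d(3) by simp
qed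

text \<open>The positive slope keeps \<open>h\<close> above 0 on (\<alpha>, \<alpha> + e), so the
  zero at \<alpha> can be cut off: the nonpositive points in [\<alpha> + e/2, d] form a compact set,
  and its least element is the required point.\<close>

lemma first_nonpos:
  fixes h :: "real \<Rightarrow> real"
  assumes "continuous_on {\<alpha>..d} h" "h \<alpha> = 0" "(h has_real_derivative l) (at \<alpha>)" "l > 0" "h d \<le> 0" "\<alpha> < d"
  shows "\<exists>c. \<alpha> < c \<and> c \<le> d \<and> h c \<le> 0 \<and> (\<forall>s. \<alpha> < s \<and> s < c \<longrightarrow> h s > 0)"
proof -
  obtain e where e: "e > 0" "\<And>x. 0 < x \<Longrightarrow> x < e \<Longrightarrow> h \<alpha> < h (\<alpha> + x)"
    using DERIV_pos_inc_right[OF assms(3,4)] by auto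
  define C where "C = {s \<in> {\<alpha> + e / 2..d}. h s \<le> 0}"
  have pos: "h s > 0" if "\<alpha> < s" "s < \<alpha> + e" for s
    using e(2)[of "s - \<alpha>"] that assms(2) by simp
  have "d \<in> C" using pos[of d] assms(5,6) e(1) unfolding C_def by (cases "d < \<alpha> + e") auto
  moreover have "compact C"
  proof -
    have "closed {s \<in> {\<alpha> + e / 2..d}. h s \<le> 0}"
      by (intro continuous_on_closed_Collect_le continuous_on_subset[OF assms(1)] continuous_on_const closed_atLeastAtMost)
        (use e in auto)
    moreover have "bounded C" unfolding C_def
      by (rule bounded_subset[OF bounded_closed_interval[of "\<alpha> + e / 2" d]]) auto
    ultimately show ?thesis unfolding compact_eq_bounded_closed C_def by blast
  qed
  ultimately obtain c where c: "c \<in> C" "\<And>s. s \<in> C \<Longrightarrow> c \<le> s"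
    using compact_attains_inf[of C] by blast
  have "h s > 0" if "\<alpha> < s" "s < c" for s
  proof (rule ccontr)
    assume "\<not> h s > 0"
    then have "s \<in> C" using pos[of s] that c(1) e(1) unfolding C_def by (cases "s < \<alpha> + e") auto
    then show False using c(2) that by force
  qed
  then show ?thesis using c(1) e(1) by (intro exI[of _ c]) (auto simp: C_def)
qed

text \<open>While q s < \<nu>^2 and Z > 0, the equation s (s Z')' = (\<nu>^2 - q s) / 4 Z makes V =
  s Z' increase from a positive value, so Z increases and cannot return to 0.\<close>

lemma radial_ode_no_zero:
  assumes ode: "radial_ode \<nu> q h h1 h2" and \<alpha>: "0 < \<alpha>" "h \<alpha> = 0" "h1 \<alpha> > 0"
    and d: "\<alpha> < d" "q * d \<le> \<nu>\<^sup>2" and "q > 0"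
  shows "h d > 0"
proof (rule ccontr)
  assume "\<not> h d > 0"
  have cont: "continuous_on {\<alpha>..d} h"
    using \<alpha>(1) by (intro DERIV_continuous_on[OF has_field_derivative_at_within[OF radial_odeD(1)[OF ode]]]) auto
  obtain c where c: "\<alpha> < c" "c \<le> d" "h c \<le> 0" "\<And>s. \<alpha> < s \<Longrightarrow> s < c \<Longrightarrow> h s > 0"
    using first_nonpos[OF cont \<alpha>(2) radial_odeD(1)[OF ode \<alpha>(1)] \<alpha>(3) _ d(1)] \<open>\<not> h d > 0\<close> by force
  define Z where "Z = (\<lambda>s. s powr (\<nu> / 2) * h s)"
  define V where "V = (\<lambda>s. s powr (\<nu> / 2) * (\<nu> / 2 * h s + s * h1 s))"
  have dZ: "(Z has_real_derivative V s / s) (at s)"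
    and dV: "(V has_real_derivative (\<nu>\<^sup>2 - q * s) / 4 * Z s / s) (at s)" if "s > 0" for s
    using radial_ode_normal_form[OF ode that] by (simp_all add: Z_def V_def)
  have contV: "continuous_on {\<alpha>..c} V"
    by (rule DERIV_continuous_on[OF has_field_derivative_at_within[OF dV]]) (use \<alpha>(1) in auto)
  have contZ: "continuous_on {\<alpha>..c} Z"
    by (rule DERIV_continuous_on[OF has_field_derivative_at_within[OF dZ]]) (use \<alpha>(1) in auto)
  have V0: "V \<alpha> > 0" using \<alpha> by (simp add: V_def)
  have Vpos: "V s > 0" if "\<alpha> < s" "s < c" for s
  proof -
    have "V \<alpha> < V s"
    proof (rule DERIV_pos_imp_increasing_open[OF that(1)])
      fix t assume t: "\<alpha> < t" "t < s"
      have "q * t < q * d" using t that c(2) \<open>q > 0\<close> by simp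
      then have "(\<nu>\<^sup>2 - q * t) / 4 * Z t / t > 0"
        using d(2) t \<alpha>(1) c(4)[of t] that by (auto simp: Z_def intro!: mult_pos_pos divide_pos_pos)
      then show "\<exists>y. (V has_real_derivative y) (at t) \<and> 0 < y"
        using dV[of t] t \<alpha>(1) by auto
    next
      show "continuous_on {\<alpha>..s} V"
        by (rule continuous_on_subset[OF contV]) (use that in auto)
    qed
    then show ?thesis using V0 by simp
  qed
  have "Z \<alpha> < Z c"
  proof (rule DERIV_pos_imp_increasing_open[OF c(1)])
    fix t assume t: "\<alpha> < t" "t < c"
    then show "\<exists>y. (Z has_real_derivative y) (at t) \<and> 0 < y"
      using dZ[of t] Vpos[OF t] \<alpha>(1) by (intro exI[of _ "V t / t"]) auto
  qed (rule contZ)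
  then have "c powr (\<nu> / 2) * h c > 0" using \<alpha>(2) by (simp add: Z_def)
  then show False using c(3) by (smt (verit) mult_nonneg_nonpos powr_ge_zero)
qed

text \<open>Sturm comparison with \<open>sin (\<omega> * ln (s / \<alpha>))\<close>, which solves \<open>s * (s * S')' = - \<omega>\<^sup>2 * S\<close>.\<close>

lemma radial_ode_zero:
  assumes ode: "radial_ode \<nu> q h h1 h2" and \<alpha>: "0 < \<alpha>" "h \<alpha> = 0" "\<alpha> < \<beta>"
  defines "\<omega> \<equiv> pi / ln (\<beta> / \<alpha>)"
  assumes q: "q * \<alpha> > \<nu>\<^sup>2 + 4 * \<omega>\<^sup>2" "q > 0"
  shows "\<exists>d. \<alpha> < d \<and> d \<le> \<beta> \<and> h d \<le> 0"
proof (rule ccontr)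
  assume "\<not> ?thesis"
  then have hpos: "h d > 0" if "\<alpha> < d" "d \<le> \<beta>" for d using that by force
  define Z where "Z = (\<lambda>s. s powr (\<nu> / 2) * h s)"
  define V where "V = (\<lambda>s. s powr (\<nu> / 2) * (\<nu> / 2 * h s + s * h1 s))"
  have dZ: "(Z has_real_derivative V s / s) (at s)"
    and dV: "(V has_real_derivative (\<nu>\<^sup>2 - q * s) / 4 * Z s / s) (at s)" if "s > 0" for s
    using radial_ode_normal_form[OF ode that] by (simp_all add: Z_def V_def)
  have lpos: "ln (\<beta> / \<alpha>) > 0" using \<alpha> by simp
  then have \<omega>: "\<omega> > 0" "\<omega> * ln (\<beta> / \<alpha>) = pi" by (simp_all add: \<omega>_def)
  \<comment> \<open>The choice of \<omega> lets \<theta> run from 0 to pi, so the sine is positive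
    inside and zero at both ends.\<close>
  define \<theta> where "\<theta> s = \<omega> * ln (s / \<alpha>)" for s
  \<comment> \<open>The Wronskian of Z and sin \<theta> with respect to ln s. It would have to
    decrease from 0 at \<alpha> to Z \<beta> * \<omega> > 0 at \<beta>.\<close>
  define \<Phi> where "\<Phi> s = V s * sin (\<theta> s) - Z s * (\<omega> * cos (\<theta> s))" for s
  have d\<Phi>: "(\<Phi> has_real_derivative sin (\<theta> s) * (Z s / s) * ((\<nu>\<^sup>2 - q * s) / 4 + \<omega>\<^sup>2)) (at s)" if "s > 0" for s
  proof -
    have t: "(\<theta> has_real_derivative \<omega> / s) (at s)"
      unfolding \<theta>_def using that \<alpha>(1) by (auto intro!: derivative_eq_intros)
    have ds: "((\<lambda>s. sin (\<theta> s)) has_real_derivative cos (\<theta> s) * (\<omega> / s)) (at s)"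
      by (rule DERIV_chain2[OF DERIV_sin t])
    have dc: "((\<lambda>s. cos (\<theta> s)) has_real_derivative - sin (\<theta> s) * (\<omega> / s)) (at s)"
      by (rule DERIV_chain2[OF DERIV_cos t])
    show ?thesis unfolding \<Phi>_def
      by (rule DERIV_cong[OF DERIV_diff[OF DERIV_mult[OF dV[OF that] ds] DERIV_mult[OF dZ[OF that] DERIV_cmult[OF dc]]]])
        (use that in \<open>simp add: field_simps power2_eq_square\<close>)
  qed
  have "\<Phi> \<beta> < \<Phi> \<alpha>"
  proof (rule DERIV_neg_imp_decreasing_open[OF \<alpha>(3)])
    fix t assume t: "\<alpha> < t" "t < \<beta>"
    then have tp: "t > 0" using \<alpha>(1) by simp
    have "0 < ln (t / \<alpha>)" "ln (t / \<alpha>) < ln (\<beta> / \<alpha>)"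
      using t \<alpha>(1) tp by (auto simp: divide_strict_right_mono)
    then have "0 < \<theta> t" "\<theta> t < \<omega> * ln (\<beta> / \<alpha>)"
      using \<omega>(1) unfolding \<theta>_def by (simp, intro mult_strict_left_mono)
    then have sp: "sin (\<theta> t) > 0" using sin_gt_zero \<omega>(2) by simp
    have "q * \<alpha> < q * t" using t q by simp
    then have neg: "\<nu>\<^sup>2 + 4 * \<omega>\<^sup>2 - q * t < 0" using q(1) by linarith
    have eq: "(\<nu>\<^sup>2 - q * t) / 4 + \<omega>\<^sup>2 = (\<nu>\<^sup>2 + 4 * \<omega>\<^sup>2 - q * t) / 4"
      by (simp add: field_simps)
    have "(\<nu>\<^sup>2 - q * t) / 4 + \<omega>\<^sup>2 < 0" unfolding eq using neg by simp
    moreover have "sin (\<theta> t) * (Z t / t) > 0"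
      using sp hpos[of t] t tp by (simp add: Z_def)
    ultimately show "\<exists>y. (\<Phi> has_real_derivative y) (at t) \<and> y < 0"
      using d\<Phi>[OF tp] mult_pos_neg by blast
  next
    show "continuous_on {\<alpha>..\<beta>} \<Phi>"
      using \<alpha>(1) by (intro DERIV_continuous_on[OF has_field_derivative_at_within[OF d\<Phi>]]) auto
  qed
  moreover have "\<Phi> \<alpha> = 0" using \<alpha> by (simp add: \<Phi>_def Z_def \<theta>_def)
  moreover have "\<Phi> \<beta> = Z \<beta> * \<omega>" by (simp add: \<Phi>_def \<theta>_def \<omega>(2))
  moreover have "Z \<beta> * \<omega> > 0" using hpos[of \<beta>] \<alpha> \<omega>(1) by (simp add: Z_def)
  ultimately show False by simp
qed


text \<open>\<open>q\<close> is the infimum of the parameters for which \<open>D q\<close> has a zero in \<open>(\<alpha>, \<beta>]\<close>.  A zero of \<open>D q\<close> in the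
  open interval would be a double one, which is impossible.\<close>

lemma bessel_ground_state_aux:
  assumes y: "bessel_ode \<nu> (\<lambda>s. 0) y y1 y2" and z: "bessel_ode \<nu> (\<lambda>s. 0) z z1 z2"
    and W: "\<And>s. s > 0 \<Longrightarrow> y s * z1 s - y1 s * z s < 0"
    and "\<nu> > 0" and \<alpha>: "0 < \<alpha>" "\<alpha> < \<beta>"
  defines "D \<equiv> \<lambda>q s. y (q * s) * z (q * \<alpha>) - y (q * \<alpha>) * z (q * s)"
  shows "\<exists>q>0. D q \<beta> = 0 \<and> (\<forall>p. 0 < p \<and> p < q \<longrightarrow> D p \<beta> \<noteq> 0) \<and> (\<forall>s. \<alpha> < s \<and> s < \<beta> \<longrightarrow> D q s > 0)"
proof -
  define D1 where "D1 q s = q * (y1 (q * s) * z (q * \<alpha>) - y (q * \<alpha>) * z1 (q * s))" for q s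
  define D2 where "D2 q s = q * (q * (y2 (q * s) * z (q * \<alpha>) - y (q * \<alpha>) * z2 (q * s)))" for q s
  have ode: "radial_ode \<nu> q (D q) (D1 q) (D2 q)" if "q > 0" for q
    using radial_ode_combination[OF y z that] unfolding D_def D1_def[abs_def] D2_def[abs_def] .
  have Da: "D q \<alpha> = 0" for q by (simp add: D_def)
  \<comment> \<open>With a negative Wronskian, \<open>D q\<close> leaves its zero at \<alpha>
    upwards for every q.\<close>
  have D1a: "D1 q \<alpha> > 0" if "q > 0" for q
  proof -
    have "y1 (q * \<alpha>) * z (q * \<alpha>) - y (q * \<alpha>) * z1 (q * \<alpha>) > 0"
      using W[of "q * \<alpha>"] that \<alpha>(1) by simp
    then show ?thesis using that by (simp add: D1_def)
  qed
  \<comment> \<open>A double zero puts the vector (a, -b) into the kernel of the Wronskian matrix,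
    so a = b = 0; then \<open>D q\<close> is identically zero and has no positive slope at
    \<alpha>.\<close>
  have no_double: False if "q > 0" "s > 0" "D q s = 0" "D1 q s = 0" for q s
  proof -
    define a b w where "a = z (q * \<alpha>)" and "b = y (q * \<alpha>)"
      and "w = y (q * s) * z1 (q * s) - y1 (q * s) * z (q * s)"
    have e: "y (q * s) * a = b * z (q * s)" "y1 (q * s) * a = b * z1 (q * s)"
      using that by (auto simp: D_def D1_def a_def b_def)
    have "w \<noteq> 0" using W[of "q * s"] that by (simp add: w_def)
    moreover have "a * w = z1 (q * s) * (y (q * s) * a) - z (q * s) * (y1 (q * s) * a)"
      by (simp add: w_def algebra_simps)
    then have "a * w = 0" unfolding e by simp
    moreover have "b * w = y (q * s) * (b * z1 (q * s)) - y1 (q * s) * (b * z (q * s))"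
      by (simp add: w_def algebra_simps)
    then have "b * w = 0" unfolding e[symmetric] by simp
    ultimately have "a = 0" "b = 0" by auto
    then show False using D1a[OF that(1)] by (simp add: D1_def a_def b_def)
  qed
  have ct: "isCont y s" "isCont z s" "isCont y1 s" "isCont z1 s" if "s > 0" for s
    using DERIV_isCont bessel_odeD[OF y that] bessel_odeD[OF z that] by blast+
  have D_tendsto: "(\<lambda>j. D (q j) (s j)) \<longlonglongrightarrow> D q' s'" and D1_tendsto: "(\<lambda>j. D1 (q j) (s j)) \<longlonglongrightarrow> D1 q' s'"
    if "q \<longlonglongrightarrow> q'" "s \<longlonglongrightarrow> s'" "q' > 0" "s' > 0" for q s :: "nat \<Rightarrow> real" and q' s'
  proof -
    have a: "(\<lambda>j. q j * s j) \<longlonglongrightarrow> q' * s'" "(\<lambda>j. q j * \<alpha>) \<longlonglongrightarrow> q' * \<alpha>"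
      using that by (auto intro!: tendsto_intros)
    have p: "q' * s' > 0" "q' * \<alpha> > 0" using that \<alpha> by auto
    note t = isCont_tendsto_compose[OF ct(1)[OF p(1)] a(1)] isCont_tendsto_compose[OF ct(1)[OF p(2)] a(2)]
      isCont_tendsto_compose[OF ct(2)[OF p(1)] a(1)] isCont_tendsto_compose[OF ct(2)[OF p(2)] a(2)]
      isCont_tendsto_compose[OF ct(3)[OF p(1)] a(1)] isCont_tendsto_compose[OF ct(4)[OF p(1)] a(1)]
    show "(\<lambda>j. D (q j) (s j)) \<longlonglongrightarrow> D q' s'" unfolding D_def by (intro tendsto_diff tendsto_mult t)
    show "(\<lambda>j. D1 (q j) (s j)) \<longlonglongrightarrow> D1 q' s'" unfolding D1_def by (intro tendsto_diff tendsto_mult t that)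
  qed
  define K where "K = {q. q > 0 \<and> (\<exists>d. \<alpha> < d \<and> d \<le> \<beta> \<and> D q d \<le> 0)}"
  define \<omega> where "\<omega> = pi / ln (\<beta> / \<alpha>)"
  \<comment> \<open>Q * \<alpha> lies 1 above the threshold of \<open>radial_ode_zero\<close>, so
    \<open>K\<close> is not empty.\<close>
  define Q where "Q = (\<nu>\<^sup>2 + 4 * \<omega>\<^sup>2 + 1) / \<alpha>"
  have "\<nu>\<^sup>2 + 4 * \<omega>\<^sup>2 + 1 > 0" by (smt (verit) zero_le_power2)
  then have Q: "Q > 0" "Q * \<alpha> > \<nu>\<^sup>2 + 4 * \<omega>\<^sup>2" using \<alpha>(1) by (auto simp: Q_def)
  then have "Q \<in> K"
    using radial_ode_zero[OF ode[OF Q(1)] \<alpha>(1) Da \<alpha>(2)] unfolding K_def \<omega>_def by auto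
  \<comment> \<open>This keeps the infimum of \<open>K\<close> away from 0, where the scaling of s
    by q degenerates.\<close>
  have lower: "\<nu>\<^sup>2 / \<beta> \<le> q" if "q \<in> K" for q
  proof (rule ccontr)
    assume less: "\<not> \<nu>\<^sup>2 / \<beta> \<le> q"
    obtain d where d: "\<alpha> < d" "d \<le> \<beta>" "D q d \<le> 0" and "q > 0" using \<open>q \<in> K\<close> by (auto simp: K_def)
    have "q * d \<le> q * \<beta>" using d \<open>q > 0\<close> by simp
    also have "q * \<beta> \<le> \<nu>\<^sup>2" using less \<alpha> by (simp add: field_simps)
    finally have "D q d > 0"
      using radial_ode_no_zero[OF ode[OF \<open>q > 0\<close>] \<alpha>(1) Da D1a[OF \<open>q > 0\<close>] d(1) _ \<open>q > 0\<close>] by simp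
    then show False using d by simp
  qed
  define q where "q = Inf K"
  have bdd: "bdd_below K" using lower by (intro bdd_belowI)
  have "q \<ge> \<nu>\<^sup>2 / \<beta>" unfolding q_def using \<open>Q \<in> K\<close> lower by (intro cInf_greatest) auto
  moreover have "\<nu>\<^sup>2 / \<beta> > 0" using \<alpha> \<open>\<nu> > 0\<close> by simp
  ultimately have q: "q > 0" by linarith
  have below: "D p s > 0" if "0 < p" "p < q" "\<alpha> < s" "s \<le> \<beta>" for p s
  proof (rule ccontr)
    assume "\<not> D p s > 0"
    then have "p \<in> K" using that by (force simp: K_def)
    then show False using cInf_lower[OF _ bdd] that(2) by (force simp: q_def)
  qed
  have nonneg: "D q s \<ge> 0" if "\<alpha> < s" "s \<le> \<beta>" for s
  proof (rule LIMSEQ_le_const)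
    \<comment> \<open>The parameters approach q from below; \<open>Suc (Suc j)\<close> instead of
      \<open>Suc j\<close> keeps them positive at j = 0.\<close>
    show "(\<lambda>j. D (q - q / real (Suc (Suc j))) s) \<longlonglongrightarrow> D q s"
    proof (rule D_tendsto[OF _ tendsto_const])
      have "(\<lambda>j. q - q * inverse (real (Suc (Suc j)))) \<longlonglongrightarrow> q - q * 0"
        by (intro tendsto_intros LIMSEQ_Suc[OF LIMSEQ_inverse_real_of_nat])
      then show "(\<lambda>j. q - q / real (Suc (Suc j))) \<longlonglongrightarrow> q" by (simp add: divide_inverse)
    qed (use q that \<alpha> in auto)
    have "D (q - q / real (Suc (Suc j))) s \<ge> 0" for j
      by (rule less_imp_le, rule below) (use q that in \<open>auto simp: field_simps add_pos_nonneg\<close>)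
    then show "\<exists>N. \<forall>n\<ge>N. 0 \<le> D (q - q / real (Suc (Suc n))) s" by blast
  qed
  \<comment> \<open>Parameters of \<open>K\<close> tending to q: their points with D \<le> 0
    accumulate at some \<open>d'\<close>, where D q \<le> 0 as well.\<close>
  have "\<exists>p\<in>K. p < q + 1 / real (Suc j)" for j
    using cInf_lessD[of K "q + 1 / real (Suc j)"] \<open>Q \<in> K\<close> by (auto simp: q_def)
  then obtain p where p: "\<And>j. p j \<in> K" "\<And>j. p j < q + 1 / real (Suc j)" by metis
  have pq: "q \<le> p j" for j using cInf_lower[OF p(1) bdd] by (simp add: q_def)
  have p_lim: "p \<longlonglongrightarrow> q"
  proof (rule tendsto_sandwich[OF _ _ tendsto_const])
    show "(\<lambda>j. q + 1 / real (Suc j)) \<longlonglongrightarrow> q"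
      using tendsto_add[OF tendsto_const[of q] LIMSEQ_inverse_real_of_nat] by (simp add: inverse_eq_divide)
  qed (use pq p(2) in \<open>auto intro!: always_eventually intro: less_imp_le\<close>)
  have "\<forall>j. \<exists>d. \<alpha> < d \<and> d \<le> \<beta> \<and> D (p j) d \<le> 0" using p(1) by (simp add: K_def)
  then obtain d where d: "\<And>j. \<alpha> < d j" "\<And>j. d j \<le> \<beta>" "\<And>j. D (p j) (d j) \<le> 0" by metis
  have "\<forall>j. d j \<in> {\<alpha>..\<beta>}" using d by (simp add: less_imp_le)
  then obtain d' \<rho> where d': "d' \<in> {\<alpha>..\<beta>}" "strict_mono (\<rho> :: nat \<Rightarrow> nat)" "(d \<circ> \<rho>) \<longlonglongrightarrow> d'"
    using compact_Icc[of \<alpha> \<beta>] unfolding compact_def by metis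
  have pr: "(\<lambda>j. p (\<rho> j)) \<longlonglongrightarrow> q" using LIMSEQ_subseq_LIMSEQ[OF p_lim d'(2)] by (simp add: o_def)
  have dr: "(\<lambda>j. d (\<rho> j)) \<longlonglongrightarrow> d'" using d'(3) by (simp add: o_def)
  have "d' > 0" using d'(1) \<alpha> by simp
  have Dd': "D q d' \<le> 0"
    by (rule LIMSEQ_le_const2[OF D_tendsto[OF pr dr q \<open>d' > 0\<close>]]) (use d(3) in auto)
  \<comment> \<open>If the points collapsed to \<alpha>, the mean value theorem would give slopes
    \<le> 0 at points tending to \<alpha>, against D1 q \<alpha> > 0.\<close>
  have "d' \<noteq> \<alpha>"
  proof
    assume "d' = \<alpha>"
    have "\<exists>\<xi>. \<alpha> < \<xi> \<and> \<xi> < d j \<and> D1 (p j) \<xi> \<le> 0" for j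
    proof -
      have pj: "p j > 0" using pq[of j] q by linarith
      obtain \<xi> where "\<alpha> < \<xi>" "\<xi> < d j" "D (p j) (d j) - D (p j) \<alpha> = (d j - \<alpha>) * D1 (p j) \<xi>"
        using MVT2[OF d(1)[of j], of "D (p j)" "D1 (p j)"] radial_odeD(1)[OF ode[OF pj]] \<alpha>(1) by force
      then show ?thesis using d(1)[of j] d(3)[of j] Da by (auto simp: mult_le_0_iff)
    qed
    then obtain \<xi> where xi: "\<And>j. \<alpha> < \<xi> j" "\<And>j. \<xi> j < d j" "\<And>j. D1 (p j) (\<xi> j) \<le> 0" by metis
    have "(\<lambda>j. \<xi> (\<rho> j)) \<longlonglongrightarrow> \<alpha>"
      by (rule tendsto_sandwich[OF _ _ tendsto_const dr[unfolded \<open>d' = \<alpha>\<close>]])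
        (use xi in \<open>auto intro!: always_eventually intro: less_imp_le\<close>)
    then have "D1 q \<alpha> \<le> 0"
      by (intro LIMSEQ_le_const2[OF D1_tendsto[OF pr _ q \<alpha>(1)]]) (use xi(3) in auto)
    then show False using D1a[OF q] by simp
  qed
  then have d'_in: "\<alpha> < d'" "d' \<le> \<beta>" using d'(1) by auto
  have pos: "D q s > 0" if "\<alpha> < s" "s < \<beta>" for s
  proof (rule ccontr)
    assume "\<not> D q s > 0"
    then have s0: "D q s = 0" using nonneg[of s] that by simp
    define e where "e = min (s - \<alpha>) (\<beta> - s)"
    have "D1 q s = 0"
    proof (rule DERIV_local_min[of "D q" _ s e])
      show "(D q has_real_derivative D1 q s) (at s)"
        using radial_odeD(1)[OF ode[OF q]] that \<alpha> by simp
      show "0 < e" using that by (simp add: e_def)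
      show "\<forall>t. \<bar>s - t\<bar> < e \<longrightarrow> D q s \<le> D q t"
        unfolding s0 e_def by (intro allI impI nonneg) auto
    qed
    then show False using no_double[OF q _ s0] that \<alpha> by simp
  qed
  have "d' = \<beta>" using pos[of d'] Dd' d'_in by force
  then have "D q \<beta> = 0" using Dd' nonneg[of \<beta>] \<alpha> by simp
  moreover have "D r \<beta> \<noteq> 0" if "0 < r" "r < q" for r
    using below[of r \<beta>] that \<alpha> by simp
  ultimately show ?thesis using q pos by blast
qed

text \<open>Continuity makes the sign of the Wronskian constant on s > 0. If it is positive, z is
  replaced by -z, which changes the sign of D; \<sigma> remembers this.\<close>

lemma bessel_ground_state:
  assumes y: "bessel_ode \<nu> (\<lambda>s. 0) y y1 y2" and z: "bessel_ode \<nu> (\<lambda>s. 0) z z1 z2"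
    and W: "\<And>s. s > 0 \<Longrightarrow> y s * z1 s - y1 s * z s \<noteq> 0"
    and "\<nu> > 0" and \<alpha>: "0 < \<alpha>" "\<alpha> < \<beta>"
  defines "D \<equiv> \<lambda>q s. y (q * s) * z (q * \<alpha>) - y (q * \<alpha>) * z (q * s)"
  shows "\<exists>q>0. D q \<beta> = 0 \<and> (\<forall>p. 0 < p \<and> p < q \<longrightarrow> D p \<beta> \<noteq> 0) \<and>
    (\<exists>\<sigma>. \<sigma> \<noteq> 0 \<and> (\<forall>s. \<alpha> < s \<and> s < \<beta> \<longrightarrow> \<sigma> * D q s > 0))"
proof (cases "\<forall>s>0. y s * z1 s - y1 s * z s < 0")
  case True
  with bessel_ground_state_aux[OF y z _ \<open>\<nu> > 0\<close> \<alpha>] show ?thesis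
    unfolding D_def by (metis mult_1 zero_neq_one)
next
  case False
  let ?W = "\<lambda>s. y s * z1 s - y1 s * z s"
  have cont: "continuous_on {0<..} ?W"
    by (intro continuous_at_imp_continuous_on ballI continuous_intros)
      (use DERIV_isCont bessel_odeD[OF y] bessel_odeD[OF z] in force)+
  have "connected (?W ` {0<..})"
    by (intro connected_continuous_image cont) auto
  then have "?W s > 0" if "s > 0" for s
    using W False that connectedD_interval[of "?W ` {0<..}"] by (smt (verit, ccfv_threshold) greaterThan_iff imageE image_eqI)
  moreover have mz: "bessel_ode \<nu> (\<lambda>s. 0) (\<lambda>s. - z s) (\<lambda>s. - z1 s) (\<lambda>s. - z2 s)"
    using bessel_ode_cmult[OF z, of "-1"] by simp
  ultimately obtain q where q: "q > 0" "y (q * \<beta>) * - z (q * \<alpha>) - y (q * \<alpha>) * - z (q * \<beta>) = 0"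
    "\<forall>p. 0 < p \<and> p < q \<longrightarrow> y (p * \<beta>) * - z (p * \<alpha>) - y (p * \<alpha>) * - z (p * \<beta>) \<noteq> 0"
    "\<forall>s. \<alpha> < s \<and> s < \<beta> \<longrightarrow> y (q * s) * - z (q * \<alpha>) - y (q * \<alpha>) * - z (q * s) > 0"
    using bessel_ground_state_aux[OF y mz _ \<open>\<nu> > 0\<close> \<alpha>] by force
  show ?thesis
    by (rule exI[of _ q]) (use q in \<open>auto simp: D_def intro!: exI[of _ "-1"]\<close>)
qed


section \<open>Smooth functions\<close>

text \<open>The one-dimensional counterpart of \<open>C_k\<close>, relative to a set because the
  profiles are known for s > 0 only. The derivatives are two-sided at points of S, so open sets are
  intended.\<close>

primrec D_k :: "nat \<Rightarrow> real set \<Rightarrow> (real \<Rightarrow> real) \<Rightarrow> bool" where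
  "D_k 0 S f \<longleftrightarrow> continuous_on S f"
| "D_k (Suc k) S f \<longleftrightarrow> (\<exists>f'. (\<forall>x\<in>S. (f has_real_derivative f' x) (at x)) \<and> D_k k S f')"

lemma D_k_SucI:
  assumes "\<And>x. x \<in> S \<Longrightarrow> (f has_real_derivative f' x) (at x)" "D_k k S f'"
  shows "D_k (Suc k) S f"
  using assms by auto

lemma D_k_SucD: "D_k (Suc k) S f \<Longrightarrow> D_k k S f"
proof (induction k arbitrary: f)
  case 0
  then show ?case
    by (auto intro: DERIV_continuous_on has_field_derivative_at_within)
next
  case (Suc k)
  then show ?case by (metis D_k.simps(2))
qed

lemma D_k_const: "D_k k S (\<lambda>x. c)"
proof (induction k arbitrary: c)
  case (Suc k)
  then show ?case by (intro D_k_SucI[of _ _ "\<lambda>x. 0"]) auto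
qed auto

lemma D_k_add: "D_k k S f \<Longrightarrow> D_k k S g \<Longrightarrow> D_k k S (\<lambda>x. f x + g x)"
proof (induction k arbitrary: f g)
  case (Suc k)
  obtain f' g' where
    f: "\<And>x. x \<in> S \<Longrightarrow> (f has_real_derivative f' x) (at x)" "D_k k S f'" and
    g: "\<And>x. x \<in> S \<Longrightarrow> (g has_real_derivative g' x) (at x)" "D_k k S g'"
    using Suc.prems by auto
  show ?case
    by (rule D_k_SucI[OF DERIV_add[OF f(1) g(1)] Suc.IH[OF f(2) g(2)]])
qed (auto intro!: continuous_intros)

lemma D_k_mult: "D_k k S f \<Longrightarrow> D_k k S g \<Longrightarrow> D_k k S (\<lambda>x. f x * g x)"
proof (induction k arbitrary: f g)
  case (Suc k)
  obtain f' g' where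
    f: "\<And>x. x \<in> S \<Longrightarrow> (f has_real_derivative f' x) (at x)" "D_k k S f'" and
    g: "\<And>x. x \<in> S \<Longrightarrow> (g has_real_derivative g' x) (at x)" "D_k k S g'"
    using Suc.prems by auto
  show ?case
    by (rule D_k_SucI[OF DERIV_mult[OF f(1) g(1)]
      D_k_add[OF Suc.IH[OF f(2) D_k_SucD[OF Suc.prems(2)]] Suc.IH[OF g(2) D_k_SucD[OF Suc.prems(1)]]]])
qed (auto intro!: continuous_intros)

lemma D_k_compose:
  "D_k k S f \<Longrightarrow> D_k k UNIV g \<Longrightarrow> D_k k S (\<lambda>x. g (f x))"
proof (induction k arbitrary: g)
  case 0
  then show ?case using continuous_on_compose2[of UNIV g S f] by auto
next
  case (Suc k)
  obtain f' g' where
    f: "\<And>x. x \<in> S \<Longrightarrow> (f has_real_derivative f' x) (at x)" "D_k k S f'" and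
    g: "\<And>x. (g has_real_derivative g' x) (at x)" "D_k k UNIV g'"
    using Suc.prems by auto
  show ?case
    by (rule D_k_SucI[OF DERIV_chain2[OF g(1) f(1)] D_k_mult[OF Suc.IH[OF D_k_SucD[OF Suc.prems(1)] g(2)] f(2)]])
qed

lemma D_k_inverse: "D_k k {0<..} (\<lambda>s. inverse s)"
proof (induction k)
  case 0
  then show ?case by (auto intro!: continuous_intros)
next
  case (Suc k)
  show ?case
  proof (rule D_k_SucI)
    show "((\<lambda>s. inverse s) has_real_derivative (-1) * (inverse x * inverse x)) (at x)" if "x \<in> {0<..}" for x :: real
      using that by (auto intro!: derivative_eq_intros)
    show "D_k k {0<..} (\<lambda>x. (-1) * (inverse x * inverse x))"
      by (intro D_k_mult D_k_const Suc.IH)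
  qed
qed

lemma D_k_cong:
  assumes "open S" "\<And>x. x \<in> S \<Longrightarrow> f x = g x" "D_k k S f"
  shows "D_k k S g"
proof (cases k)
  case 0
  then show ?thesis using assms by (auto cong: continuous_on_cong)
next
  case (Suc j)
  then obtain f' where f': "\<And>x. x \<in> S \<Longrightarrow> (f has_real_derivative f' x) (at x)" "D_k j S f'"
    using assms(3) by auto
  have "(g has_real_derivative f' x) (at x)" if "x \<in> S" for x
    by (rule has_field_derivative_transform_within_open[OF f'(1)[OF that] assms(1) that assms(2)])
  then show ?thesis unfolding Suc by (rule D_k_SucI) (use f'(2) in auto)
qed

text \<open>The complement of C is open, so the derivative vanishes off C too; extended by zero it
  satisfies the same hypotheses, and induction applies.\<close>

lemma D_k_extend_by_zero:
  assumes "open S" "closed C" "C \<subseteq> S" "D_k k S f" "\<And>x. x \<notin> C \<Longrightarrow> f x = 0"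
  shows "D_k k UNIV f"
  using assms(4,5)
proof (induction k arbitrary: f)
  case 0
  have "continuous_on (- C) f" 
    using 0(2) continuous_on_cong[of "- C" "- C" f "\<lambda>x. 0"] by simp
  then have "continuous_on (S \<union> - C) f"
    using 0(1) assms(1,2) by (intro continuous_on_open_Un) auto
  then show ?case using assms(3) 
    by (metis D_k.simps(1) Compl_partition Un_mono order_refl top.extremum_uniqueI)
next
  case (Suc k)
  obtain f' where f': "\<And>x. x \<in> S \<Longrightarrow> (f has_real_derivative f' x) (at x)" "D_k k S f'"
    using Suc.prems(1) by auto
  define g where "g x = (if x \<in> S then f' x else 0)" for x
  have out: "(f has_real_derivative 0) (at x)" if "x \<notin> C" for x
    by (rule has_field_derivative_transform_within_open[of "\<lambda>x. 0" _ _ "- C"])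
      (use assms(2) that Suc.prems(2) in auto)
  have g0: "g x = 0" if "x \<notin> C" for x
    using f'(1)[of x] out[OF that] DERIV_unique by (auto simp: g_def)
  have "D_k k S g" by (rule D_k_cong[OF assms(1) _ f'(2)]) (simp add: g_def)
  then have "D_k k UNIV g" by (rule Suc.IH) (rule g0)
  moreover have "(f has_real_derivative g x) (at x)" for x
    using f'(1)[of x] out[of x] g0[of x] assms(3) by (cases "x \<in> C") (auto simp: g_def)
  ultimately show ?case by (intro D_k_SucI) auto
qed

text \<open>The case m = 0 is the classical smooth function exp (-1/t), flat at 0. The powers of 1/t
  make linear combinations of the family closed under differentiation, so smoothness follows by
  induction.\<close>

definition flat :: "nat \<Rightarrow> real \<Rightarrow> real" where
  "flat m t = (if t > 0 then inverse t ^ m * exp (- inverse t) else 0)"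

lemma power_le_fact_exp:
  assumes "0 \<le> (y::real)" shows "y ^ k \<le> fact k * exp y"
proof -
  have "(\<Sum>n\<in>{k}. inverse (fact n) *\<^sub>R y ^ n) \<le> (\<Sum>n. inverse (fact n) *\<^sub>R y ^ n)"
    by (intro sum_le_suminf summable_exp_generic) (use assms in auto)
  then have "y ^ k / fact k \<le> exp y" by (simp add: exp_def divide_inverse mult.commute)
  then show ?thesis by (simp add: field_simps)
qed

text \<open>With y = 1/t, one term of the exponential series gives y^(m+2) \<le> (m+2)! exp y. The
  order t^2 is enough for the derivative 0 at the origin.\<close>

lemma flat_bound: "\<bar>flat m t\<bar> \<le> fact (m + 2) * t\<^sup>2"
proof (cases "t > 0")
  case True
  have "inverse t ^ (m + 2) \<le> fact (m + 2) * exp (inverse t)"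
    using True by (intro power_le_fact_exp) auto
  then have "inverse t ^ (m + 2) / exp (inverse t) \<le> fact (m + 2)"
    by (simp only: divide_le_eq) simp
  then have "inverse t ^ (m + 2) * exp (- inverse t) \<le> fact (m + 2)"
    by (simp only: exp_minus divide_inverse)
  then have le: "t\<^sup>2 * (inverse t ^ (m + 2) * exp (- inverse t)) \<le> t\<^sup>2 * fact (m + 2)"
    by (intro mult_left_mono) auto
  have eq: "t\<^sup>2 * (inverse t ^ (m + 2) * exp (- inverse t)) = inverse t ^ m * exp (- inverse t)"
  proof -
    have "t\<^sup>2 * inverse t ^ 2 = 1" using True by (simp add: power_mult_distrib[symmetric])
    moreover have "t\<^sup>2 * (inverse t ^ (m + 2) * exp (- inverse t)) =
        (t\<^sup>2 * inverse t ^ 2) * (inverse t ^ m * exp (- inverse t))"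
      by (simp only: power_add mult_ac)
    ultimately show ?thesis by simp
  qed
  show ?thesis using le[unfolded eq] True by (simp add: flat_def mult.commute del: fact_Suc)
qed (auto simp: flat_def)

lemma DERIV_flat: "(flat m has_real_derivative flat (m + 2) t - real m * flat (m + 1) t) (at t)"
proof -
  consider "t > 0" | "t = 0" | "t < 0" by linarith
  then show ?thesis
  proof cases
    case 1
    have "((\<lambda>t. inverse t ^ m * exp (- inverse t)) has_real_derivative
        flat (m + 2) t - real m * flat (m + 1) t) (at t)"
    proof -
      have i: "((\<lambda>t. inverse t) has_real_derivative - (inverse t * inverse t)) (at t)"
        using 1 by (auto intro!: derivative_eq_intros)
      have p: "((\<lambda>t. inverse t ^ m) has_real_derivative - real m * inverse t ^ (m + 1)) (at t)"
        by (rule DERIV_cong[OF DERIV_power[OF i]]) (cases m; simp add: algebra_simps)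
      have e: "((\<lambda>t. exp (- inverse t)) has_real_derivative exp (- inverse t) * inverse t ^ 2) (at t)"
        by (rule DERIV_cong[OF DERIV_chain2[OF DERIV_exp DERIV_minus[OF i]]]) (simp add: power2_eq_square)
      show ?thesis
        by (rule DERIV_cong[OF DERIV_mult[OF p e]])
          (use 1 in \<open>simp add: flat_def power_add power2_eq_square algebra_simps\<close>)
    qed
    then show ?thesis
      by (rule has_field_derivative_transform_within_open[of _ _ _ "{0<..}"]) (use 1 in \<open>auto simp: flat_def\<close>)
  next
    case 2
    have "((\<lambda>h. flat m h / h) \<longlongrightarrow> 0) (at 0)"
    proof (rule tendsto_0_le[where K = "fact (m + 2)"])
      show "((\<lambda>h::real. h) \<longlongrightarrow> 0) (at 0)" by simp
      show "\<forall>\<^sub>F h in at 0. norm (flat m h / h) \<le> norm h * fact (m + 2)"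
      proof -
        have "norm (flat m h / h) \<le> norm h * fact (m + 2)" if "h \<noteq> 0" for h
        proof -
          have "\<bar>flat m h\<bar> \<le> fact (m + 2) * (\<bar>h\<bar> * \<bar>h\<bar>)"
            using flat_bound[of m h] by (simp only: power2_eq_square abs_mult_self_eq)
          then show ?thesis using that by (simp add: abs_divide divide_le_eq mult_ac del: fact_Suc)
        qed
        then show ?thesis unfolding eventually_at_filter by (intro always_eventually) blast
      qed
    qed
    then show ?thesis using 2 by (simp add: DERIV_def flat_def[of _ 0])
  next
    case 3
    have "flat (m + 2) t - real m * flat (m + 1) t = 0" using 3 by (simp add: flat_def)
    moreover have "(flat m has_real_derivative 0) (at t)"
      by (rule has_field_derivative_transform_within_open[of "\<lambda>x. 0" _ _ "{..<0}"]) (use 3 in \<open>auto simp: flat_def\<close>)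
    ultimately show ?thesis by simp
  qed
qed

lemma D_k_flat: "D_k k UNIV (flat m)"
proof (induction k arbitrary: m)
  case 0
  then show ?case 
    by (simp, intro DERIV_continuous_on[OF has_field_derivative_at_within[OF DERIV_flat]])
next
  case (Suc k)
  have "D_k k UNIV (\<lambda>t. flat (m + 2) t + (- real m) * flat (m + 1) t)"
    by (intro D_k_add D_k_mult D_k_const Suc.IH)
  then show ?case using DERIV_flat[of m] by (intro D_k_SucI[of _ "flat m"]) auto
qed

section \<open>Calculus of \<open>C_k\<close> in several variables\<close>

lemma partial_eq:
  assumes "(f has_derivative f') (at x)"
  shows "partial i f x = f' (axis i 1)"
  unfolding partial_def using frechet_derivative_at[OF assms] by simp

lemma C_k_SucD: "C_k (Suc k) f \<Longrightarrow> C_k k f"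
proof (induction k arbitrary: f)
  case 0
  then show ?case
    by (auto simp: continuous_on_eq_continuous_at intro: differentiable_imp_continuous_within)
qed auto

lemma C_k_const: "C_k k (\<lambda>x :: real ^ 'n::finite. c)"
proof (induction k arbitrary: c)
  case (Suc k)
  have "partial i (\<lambda>x :: real ^ 'n. c) = (\<lambda>x. 0)" for i
    by (auto simp: partial_eq[OF has_derivative_const])
  then show ?case using Suc by simp
qed simp

lemma C_k_component: "C_k k (\<lambda>x. x $ i)"
proof (cases k)
  case 0
  then show ?thesis by (auto intro!: continuous_intros)
next
  case (Suc j)
  have d: "((\<lambda>x. x $ i) has_derivative (\<lambda>h. h $ i)) (at x)" for x :: "real ^ 'a"
    by (rule bounded_linear_imp_has_derivative) (rule bounded_linear_vec_nth)
  have "partial l (\<lambda>x. x $ i) = (\<lambda>x. axis l 1 $ i)" for l by (auto simp: partial_eq[OF d])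
  then show ?thesis unfolding Suc using d by (auto simp: differentiable_def C_k_const)
qed

lemma frechet_derivative_works_at:
  "f differentiable (at x) \<Longrightarrow> (f has_derivative frechet_derivative f (at x)) (at x)"
  using frechet_derivative_works by blast

lemma C_k_add: "C_k k f \<Longrightarrow> C_k k g \<Longrightarrow> C_k k (\<lambda>x. f x + g x)"
proof (induction k arbitrary: f g)
  case (Suc k)
  have "partial i (\<lambda>x. f x + g x) = (\<lambda>x. partial i f x + partial i g x)" for i
    using Suc.prems by (auto simp: fun_eq_iff partial_def[of _ f] partial_def[of _ g]
      intro!: partial_eq has_derivative_add frechet_derivative_works_at)
  then show ?case using Suc by (auto intro!: differentiable_add)
qed (auto intro!: continuous_intros)

lemma C_k_mult: "C_k k f \<Longrightarrow> C_k k g \<Longrightarrow> C_k k (\<lambda>x. f x * g x)"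
proof (induction k arbitrary: f g)
  case (Suc k)
  have "partial i (\<lambda>x. f x * g x) = (\<lambda>x. f x * partial i g x + partial i f x * g x)" for i
  proof
    fix x
    have "f differentiable (at x)" "g differentiable (at x)" using Suc.prems by auto
    then show "partial i (\<lambda>x. f x * g x) x = f x * partial i g x + partial i f x * g x"
      unfolding partial_def[of _ f] partial_def[of _ g]
      by (intro partial_eq[THEN trans, OF has_derivative_mult]) (auto intro: frechet_derivative_works_at)
  qed
  moreover have "C_k k (\<lambda>x. f x * partial i g x + partial i f x * g x)" for i
    using Suc.prems C_k_SucD by (intro C_k_add Suc.IH) (auto simp del: C_k.simps(1))
  ultimately show ?case using Suc.prems by (auto intro!: differentiable_mult)
qed (auto intro!: continuous_intros)

lemma has_derivative_radial:
  fixes x :: "'a :: real_inner"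
  assumes "(P has_real_derivative P') (at (x \<bullet> x))"
  shows "((\<lambda>x. P (x \<bullet> x)) has_derivative (\<lambda>h. 2 * (x \<bullet> h) * P')) (at x)"
proof -
  have "((\<lambda>x. x \<bullet> x) has_derivative (\<lambda>h. x \<bullet> h + h \<bullet> x)) (at x)"
    by (intro has_derivative_inner has_derivative_ident)
  from has_derivative_compose[OF this assms[unfolded has_field_derivative_def]] show ?thesis
    by (simp add: inner_commute mult_ac)
qed

text \<open>The argument x \<bullet> x, unlike the norm, is smooth at the origin as well.\<close>

lemma C_k_radial: "D_k k UNIV P \<Longrightarrow> C_k k (\<lambda>x :: real ^ 'n::finite. P (x \<bullet> x))"
proof (induction k arbitrary: P)
  case 0
  then show ?case by (auto intro!: continuous_on_compose2[of UNIV P] continuous_intros)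
next
  case (Suc k)
  then obtain P' where P': "\<And>s. (P has_real_derivative P' s) (at s)" "D_k k UNIV P'" by auto
  have d: "((\<lambda>x :: real ^ 'n. P (x \<bullet> x)) has_derivative (\<lambda>h. 2 * (x \<bullet> h) * P' (x \<bullet> x))) (at x)" for x
    by (rule has_derivative_radial[OF P'(1)])
  have "partial i (\<lambda>x :: real ^ 'n. P (x \<bullet> x)) = (\<lambda>x. 2 * x $ i * P' (x \<bullet> x))" for i
    by (auto simp: partial_eq[OF d] inner_axis)
  moreover have "C_k k (\<lambda>x :: real ^ 'n. 2 * x $ i * P' (x \<bullet> x))" for i
    by (intro C_k_mult C_k_const C_k_component Suc.IH P')
  ultimately show ?case using d by (auto simp: differentiable_def)
qed


section \<open>Integration by parts\<close>

lemma continuous_on_extend_by_zero: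
  fixes f :: "'a::t2_space \<Rightarrow> 'b::real_normed_vector"
  assumes "open \<Omega>" "compact K" "K \<subseteq> \<Omega>" "continuous_on \<Omega> f" "\<And>x. x \<notin> K \<Longrightarrow> f x = 0"
  shows "continuous_on UNIV f"
proof -
  have K: "closed K" using assms(2) compact_imp_closed by blast
  have "continuous_on (- K) f"
    using assms(5) continuous_on_cong[of "- K" "- K" f "\<lambda>x. 0"] by simp
  then have "continuous_on (\<Omega> \<union> - K) f"
    using assms(1,4) K by (intro continuous_on_open_Un) auto
  moreover have "\<Omega> \<union> - K = UNIV" using assms(3) by auto
  ultimately show ?thesis by simp
qed

text \<open>Translation invariance and Fubini are used on \<open>lborel\<close>, whereas the Hilbert
  space is built on \<open>lebesgue_on \<Omega>\<close>; this is the bridge between them.\<close>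

lemma integral_lebesgue_on_eq_lborel:
  fixes f :: "'a::euclidean_space \<Rightarrow> real"
  assumes "\<Omega> \<in> sets borel" "f \<in> borel_measurable borel" "\<And>x. x \<notin> \<Omega> \<Longrightarrow> f x = 0"
  shows "integrable (lebesgue_on \<Omega>) f \<longleftrightarrow> integrable lborel f"
    "integral\<^sup>L (lebesgue_on \<Omega>) f = integral\<^sup>L lborel f"
proof -
  have e: "(\<lambda>x. indicator \<Omega> x *\<^sub>R f x) = f" using assms(3) by (auto simp: fun_eq_iff split: split_indicator)
  have s: "\<Omega> \<inter> space lebesgue \<in> sets lebesgue" using assms(1) by simp
  show "integrable (lebesgue_on \<Omega>) f \<longleftrightarrow> integrable lborel f"
    unfolding integrable_restrict_space[OF s] e using assms(2) by (simp add: integrable_completion)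
  show "integral\<^sup>L (lebesgue_on \<Omega>) f = integral\<^sup>L lborel f"
    unfolding integral_restrict_space[OF s] e using assms(2) by (simp add: integral_completion)
qed

lemma integrable_continuous_compact_support:
  fixes f :: "'a::euclidean_space \<Rightarrow> real"
  assumes "open \<Omega>" "compact K" "K \<subseteq> \<Omega>" "continuous_on \<Omega> f" "\<And>x. x \<in> \<Omega> - K \<Longrightarrow> f x = 0"
  shows "integrable (lebesgue_on \<Omega>) f"
proof -
  have s: "\<Omega> \<inter> space lebesgue \<in> sets lebesgue" using assms(1) by simp
  have "integrable lborel (\<lambda>x. indicator K x *\<^sub>R f x)"
    using assms by (intro borel_integrable_compact) (auto intro: continuous_on_subset)
  moreover have "(\<lambda>x. indicator \<Omega> x *\<^sub>R f x) = (\<lambda>x. indicator K x *\<^sub>R f x)"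
    using assms(3,5) by (auto simp: indicator_def fun_eq_iff)
  ultimately show ?thesis
    unfolding integrable_restrict_space[OF s] by (simp add: integrable_completion)
qed

lemma integral_translation:
  fixes f :: "'a::euclidean_space \<Rightarrow> real"
  assumes "f \<in> borel_measurable borel"
  shows "integral\<^sup>L lborel (\<lambda>x. f (c + x)) = integral\<^sup>L lborel f"
    "integrable lborel (\<lambda>x. f (c + x)) \<longleftrightarrow> integrable lborel f"
proof -
  have "integral\<^sup>L lborel f = integral\<^sup>L (distr lborel borel ((+) c)) f" by (simp add: lborel_distr_plus)
  also have "\<dots> = integral\<^sup>L lborel (\<lambda>x. f (c + x))" using assms by (intro integral_distr) auto
  finally show "integral\<^sup>L lborel (\<lambda>x. f (c + x)) = integral\<^sup>L lborel f" by simp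
  have "integrable lborel f \<longleftrightarrow> integrable (distr lborel borel ((+) c)) f" by (simp add: lborel_distr_plus)
  also have "\<dots> \<longleftrightarrow> integrable lborel (\<lambda>x. f (c + x))" using assms by (intro integrable_distr_eq) auto
  finally show "integrable lborel (\<lambda>x. f (c + x)) \<longleftrightarrow> integrable lborel f" by simp
qed

text \<open>The difference quotients \<open>(F (x + h e) - F x) / h\<close> have integral zero by translation invariance.\<close>

lemma integral_partial_eq_0:
  fixes F :: "'a::euclidean_space \<Rightarrow> real"
  assumes \<Omega>: "open \<Omega>" "compact K" "K \<subseteq> \<Omega>"
    and F: "\<And>x. x \<in> \<Omega> \<Longrightarrow> (F has_derivative F' x) (at x)"
    and cont: "continuous_on \<Omega> (\<lambda>x. F' x e)"
    and zero: "\<And>x. x \<in> \<Omega> - K \<Longrightarrow> F x = 0"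
  shows "integrable (lebesgue_on \<Omega>) (\<lambda>x. F' x e)" "(\<integral>x. F' x e \<partial>lebesgue_on \<Omega>) = 0"
proof -
  have K: "closed K" using \<Omega>(2) compact_imp_closed by blast
  have F'0: "F' x e = 0" if "x \<in> \<Omega> - K" for x
  proof -
    have "(F has_derivative (\<lambda>h. 0)) (at x)"
      by (rule has_derivative_transform_within_open[OF has_derivative_const[of 0] open_Diff[OF \<Omega>(1) K] that])
        (simp add: zero)
    then have "F' x = (\<lambda>h. 0)" using F[of x] that by (intro has_derivative_unique) auto
    then show ?thesis by simp
  qed
  show int: "integrable (lebesgue_on \<Omega>) (\<lambda>x. F' x e)"
    by (rule integrable_continuous_compact_support[OF \<Omega> cont F'0])
  \<comment> \<open>\<open>F\<close> is controlled on \<Omega> only, while translations need a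
    function on the whole space.\<close>
  define G where "G x = (if x \<in> \<Omega> then F x else 0)" for x
  define d where "d x = (if x \<in> \<Omega> then F' x e else 0)" for x
  have G0: "G x = 0" and d0: "d x = 0" if "x \<notin> K" for x
    using that zero F'0 by (auto simp: G_def d_def)
  have dG: "\<exists>G'. (G has_derivative G') (at x) \<and> G' e = d x" for x
  proof (cases "x \<in> K")
    case True
    then have x: "x \<in> \<Omega>" using \<Omega>(3) by auto
    have "(G has_derivative F' x) (at x)"
      by (rule has_derivative_transform_within_open[OF F[OF x] \<Omega>(1) x]) (simp add: G_def)
    then show ?thesis using x by (auto simp: d_def)
  next
    case False
    have "(G has_derivative (\<lambda>h. 0)) (at x)"
      by (rule has_derivative_transform_within_open[OF has_derivative_const[of 0] open_Compl[OF K]])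
        (use False G0 in auto)
    then show ?thesis using d0[OF False] by auto
  qed
  have contd: "continuous_on UNIV d"
    by (rule continuous_on_extend_by_zero[OF \<Omega> _ d0])
      (use cont continuous_on_cong[of \<Omega> \<Omega> d "\<lambda>x. F' x e"] in \<open>simp add: d_def\<close>)
  have contG: "continuous_on UNIV G"
  proof (intro continuous_at_imp_continuous_on ballI)
    show "isCont G x" for x using dG[of x] has_derivative_continuous by blast
  qed
  have line: "((\<lambda>t. G (t *\<^sub>R e + x)) has_real_derivative d (t *\<^sub>R e + x)) (at t)" for t x
  proof -
    obtain G' where G': "(G has_derivative G') (at (t *\<^sub>R e + x))" "G' e = d (t *\<^sub>R e + x)"
      using dG by blast
    have "((\<lambda>t. t *\<^sub>R e + x) has_derivative (\<lambda>h. h *\<^sub>R e)) (at t)"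
      by (auto intro!: derivative_eq_intros)
    from has_derivative_compose[OF this G'(1)]
    have "((\<lambda>t. G (t *\<^sub>R e + x)) has_derivative (\<lambda>h. G' (h *\<^sub>R e))) (at t)" .
    moreover have "G' (h *\<^sub>R e) = d (t *\<^sub>R e + x) * h" for h
      using G' has_derivative_linear[OF G'(1)] by (simp add: linear_cmul mult.commute)
    ultimately show ?thesis by (simp add: has_field_derivative_def)
  qed
  obtain B where B: "\<And>x. \<bar>d x\<bar> \<le> B"
  proof -
    obtain B0 where "\<And>x. x \<in> K \<Longrightarrow> \<bar>d x\<bar> \<le> B0"
      using compact_imp_bounded[OF compact_continuous_image[OF continuous_on_subset[OF contd, of K] \<Omega>(2)]]
      unfolding bounded_iff by force
    then have "\<bar>d x\<bar> \<le> max B0 0" for x using d0[of x] by (cases "x \<in> K") force+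
    then show ?thesis by (rule that)
  qed
  \<comment> \<open>The points x for which the segment from x to x + e meets K. It contains the
    supports of all difference quotients with step at most 1.\<close>
  define K' where "K' = (\<lambda>(t, x). x - t *\<^sub>R e) ` ({0..1::real} \<times> K)"
  have K': "compact K'" unfolding K'_def
    by (intro compact_continuous_image compact_Times \<Omega>(2) compact_Icc) (auto intro!: continuous_intros simp: case_prod_beta)
  define h where "h n = 1 / real (Suc n)" for n
  have h: "0 < h n" "h n \<le> 1" for n by (auto simp: h_def)
  define q where "q n x = (G (h n *\<^sub>R e + x) - G x) / h n" for n x
  have Gm[measurable]: "G \<in> borel_measurable borel" by (rule borel_measurable_continuous_onI[OF contG])
  have dm: "d \<in> borel_measurable borel" by (rule borel_measurable_continuous_onI[OF contd])
  have intG: "integrable lborel G"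
  proof -
    have "integrable lborel (\<lambda>x. indicator K x *\<^sub>R G x)"
      using continuous_on_subset[OF contG] by (intro borel_integrable_compact \<Omega>(2)) auto
    moreover have "(\<lambda>x. indicator K x *\<^sub>R G x) = G" using G0 by (auto simp: indicator_def fun_eq_iff)
    ultimately show ?thesis by simp
  qed
  have q_int: "integral\<^sup>L lborel (q n) = 0" for n
    using intG by (simp add: q_def[abs_def] integral_translation[OF Gm])
  have "(\<lambda>n. integral\<^sup>L lborel (q n)) \<longlonglongrightarrow> integral\<^sup>L lborel d"
  proof (rule integral_dominated_convergence[where w = "\<lambda>x. indicator K' x *\<^sub>R B"])
    show "d \<in> borel_measurable lborel" using dm by simp
    show "q n \<in> borel_measurable lborel" for n unfolding q_def[abs_def] by simp
    show "integrable lborel (\<lambda>x. indicator K' x *\<^sub>R B)"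
      by (rule borel_integrable_compact[OF K' continuous_on_const])
    show "AE x in lborel. (\<lambda>n. q n x) \<longlonglongrightarrow> d x"
    proof (rule AE_I2)
      fix x
      have "((\<lambda>t. (G (t *\<^sub>R e + x) - G x) / t) \<longlongrightarrow> d x) (at 0)"
        using line[of x 0] by (simp add: has_field_derivative_iff)
      moreover have "filterlim h (at 0) sequentially"
        unfolding filterlim_at using h LIMSEQ_inverse_real_of_nat
        by (auto simp: h_def[abs_def] inverse_eq_divide intro!: always_eventually)
      ultimately show "(\<lambda>n. q n x) \<longlonglongrightarrow> d x"
        unfolding q_def by (rule filterlim_compose)
    qed
    show "AE x in lborel. norm (q n x) \<le> indicator K' x *\<^sub>R B" for n
    proof (rule AE_I2)
      fix x
      \<comment> \<open>The mean value theorem turns the quotient into a value of \<open>d\<close>,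
        which is bounded by \<open>B\<close>.\<close>
      obtain \<xi> where xi: "0 < \<xi>" "\<xi> < h n" "G (h n *\<^sub>R e + x) - G (0 *\<^sub>R e + x) = (h n - 0) * d (\<xi> *\<^sub>R e + x)"
        using MVT2[OF h(1)[of n], of "\<lambda>t. G (t *\<^sub>R e + x)" "\<lambda>t. d (t *\<^sub>R e + x)"] line by blast
      then have qx: "q n x = d (\<xi> *\<^sub>R e + x)" using h(1)[of n] by (simp add: q_def)
      show "norm (q n x) \<le> indicator K' x *\<^sub>R B"
      proof (cases "\<xi> *\<^sub>R e + x \<in> K")
        case True
        have "x = (\<lambda>(t, x). x - t *\<^sub>R e) (\<xi>, \<xi> *\<^sub>R e + x)" by simp
        moreover have "(\<xi>, \<xi> *\<^sub>R e + x) \<in> {0..1} \<times> K" using True xi h(2)[of n] by auto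
        ultimately have "x \<in> K'" unfolding K'_def by blast
        then show ?thesis using B qx by simp
      next
        case False
        have "B \<ge> 0" using B[of x] by linarith
        then show ?thesis using d0[OF False] qx by (simp add: indicator_def)
      qed
    qed
  qed
  then have "0 = integral\<^sup>L lborel d" by (simp only: q_int LIMSEQ_const_iff)
  moreover have d0': "d x = 0" if "x \<notin> \<Omega>" for x using that by (simp add: d_def)
  moreover have "(\<integral>x. F' x e \<partial>lebesgue_on \<Omega>) = (\<integral>x. d x \<partial>lebesgue_on \<Omega>)"
    by (rule Bochner_Integration.integral_cong) (auto simp: d_def)
  ultimately show "(\<integral>x. F' x e \<partial>lebesgue_on \<Omega>) = 0"
    using integral_lebesgue_on_eq_lborel(2)[OF _ dm d0', of \<Omega>] \<Omega>(1) by simp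
qed

lemma integral_divergence_eq_0:
  fixes F :: "'n::finite \<Rightarrow> (real ^ 'n \<Rightarrow> real)"
  assumes \<Omega>: "open \<Omega>" "compact K" "K \<subseteq> \<Omega>"
    and F: "\<And>i x. x \<in> \<Omega> \<Longrightarrow> (F i has_derivative F' i x) (at x)"
    and cont: "\<And>i. continuous_on \<Omega> (\<lambda>x. F' i x (axis i 1))"
    and zero: "\<And>i x. x \<in> \<Omega> - K \<Longrightarrow> F i x = 0"
  shows "integrable (lebesgue_on \<Omega>) (\<lambda>x. \<Sum>i\<in>UNIV. F' i x (axis i 1))"
    "(\<integral>x. (\<Sum>i\<in>UNIV. F' i x (axis i 1)) \<partial>lebesgue_on \<Omega>) = 0"
proof -
  have *: "integrable (lebesgue_on \<Omega>) (\<lambda>x. F' i x (axis i 1))"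
    "(\<integral>x. F' i x (axis i 1) \<partial>lebesgue_on \<Omega>) = 0" for i
    by (rule integral_partial_eq_0[OF \<Omega> F cont zero]; assumption)+
  show "integrable (lebesgue_on \<Omega>) (\<lambda>x. \<Sum>i\<in>UNIV. F' i x (axis i 1))"
    by (intro Bochner_Integration.integrable_sum *(1))
  show "(\<integral>x. (\<Sum>i\<in>UNIV. F' i x (axis i 1)) \<partial>lebesgue_on \<Omega>) = 0"
    by (subst Bochner_Integration.integral_sum) (simp_all add: *)
qed

section \<open>Test functions\<close>

lemma has_derivative_partial:
  fixes f :: "real ^ 'n::finite \<Rightarrow> real"
  assumes "f differentiable (at x)"
  shows "(f has_derivative (\<lambda>h. \<Sum>i\<in>UNIV. h $ i * partial i f x)) (at x)"
proof -
  have d: "(f has_derivative frechet_derivative f (at x)) (at x)"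
    using assms frechet_derivative_works by blast
  have lin: "linear (frechet_derivative f (at x))" using has_derivative_linear[OF d] .
  have "frechet_derivative f (at x) h = (\<Sum>i\<in>UNIV. h $ i * partial i f x)" for h
  proof -
    have "frechet_derivative f (at x) h = frechet_derivative f (at x) (\<Sum>i\<in>UNIV. h $ i *\<^sub>R axis i 1)"
      using basis_expansion[of h] by (simp add: scalar_mult_eq_scaleR)
    then show ?thesis by (simp add: linear_sum[OF lin] linear_cmul[OF lin] partial_def)
  qed
  then show ?thesis using d by presburger
qed

lemma test_functions_support:
  assumes "v \<in> test_functions \<Omega>"
  shows "\<exists>K. compact K \<and> K \<subseteq> \<Omega> \<and> (\<forall>x. x \<notin> K \<longrightarrow> v x = 0)"
  using assms closure_subset[of "{x. v x \<noteq> 0}"] unfolding test_functions_def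
  by (intro exI[of _ "closure {x. v x \<noteq> 0}"]) auto

lemma test_functions_smooth:
  assumes "v \<in> test_functions \<Omega>"
  shows "v differentiable (at x)" "partial i v differentiable (at x)"
    "continuous_on UNIV v" "continuous_on UNIV (partial i v)" "continuous_on UNIV (partial j (partial i v))"
proof -
  have C: "C_k k v" for k using assms by (simp add: test_functions_def)
  show "v differentiable (at x)" using C[of 1] by simp
  show "continuous_on UNIV v" using C[of 0] by simp
  show "continuous_on UNIV (partial i v)" using C[of "Suc 0"] by simp
  show "partial i v differentiable (at x)" using C[of "Suc (Suc 0)"] by simp
  show "continuous_on UNIV (partial j (partial i v))" using C[of "Suc (Suc 0)"] by simp
qed

lemma partial_eq_0:
  assumes "closed K" "\<And>x. x \<notin> K \<Longrightarrow> v x = 0" "x \<notin> K"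
  shows "partial i v x = 0"
proof -
  have "(v has_derivative (\<lambda>h. 0)) (at x)"
    by (rule has_derivative_transform_within_open[OF has_derivative_const[of 0] open_Compl[OF assms(1)]])
      (use assms in auto)
  then show ?thesis by (rule partial_eq)
qed

lemma test_functionsI:
  assumes "\<And>k. C_k k v" "compact K" "K \<subseteq> \<Omega>" "\<And>x. x \<notin> K \<Longrightarrow> v x = 0"
  shows "v \<in> test_functions \<Omega>"
proof -
  have "closure {x. v x \<noteq> 0} \<subseteq> K"
    using assms(2,4) by (intro closure_minimal) (auto intro: compact_imp_closed)
  moreover have "compact (closure {x. v x \<noteq> 0})"
    using compact_Int_closed[OF assms(2) closed_closure] calculation by (metis inf.absorb2)
  ultimately show ?thesis
    using assms(1,3) unfolding test_functions_def by simp
qed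

lemma test_functions_combination:
  assumes u: "u \<in> test_functions \<Omega>" and v: "v \<in> test_functions \<Omega>"
  shows "(\<lambda>x. u x + c * v x) \<in> test_functions \<Omega>"
    "partial i (\<lambda>x. u x + c * v x) = (\<lambda>x. partial i u x + c * partial i v x)"
    "laplacian (\<lambda>x. u x + c * v x) = (\<lambda>x. laplacian u x + c * laplacian v x)"
proof -
  have p: "partial i (\<lambda>x. f x + c * g x) = (\<lambda>x. partial i f x + c * partial i g x)"
    if "\<And>x. f differentiable (at x)" "\<And>x. g differentiable (at x)" for f g :: "real ^ 'a \<Rightarrow> real" and i
  proof
    fix x
    have "(f has_derivative frechet_derivative f (at x)) (at x)" "(g has_derivative frechet_derivative g (at x)) (at x)"
      using that frechet_derivative_works by blast+
    then show "partial i (\<lambda>x. f x + c * g x) x = partial i f x + c * partial i g x"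
      unfolding partial_def[of _ f] partial_def[of _ g]
      by (intro partial_eq[THEN trans, OF has_derivative_add[OF _ has_derivative_mult_right]]) auto
  qed
  show pp: "partial i (\<lambda>x. u x + c * v x) = (\<lambda>x. partial i u x + c * partial i v x)" for i
    by (rule p) (rule test_functions_smooth[OF u] test_functions_smooth[OF v])+
  show "laplacian (\<lambda>x. u x + c * v x) = (\<lambda>x. laplacian u x + c * laplacian v x)"
    unfolding laplacian_def pp
    by (subst p) (auto simp: sum.distrib sum_distrib_left intro: test_functions_smooth[OF u] test_functions_smooth[OF v])
  obtain K where K: "compact K" "K \<subseteq> \<Omega>" "\<And>x. x \<notin> K \<Longrightarrow> u x = 0" using test_functions_support[OF u] by auto
  obtain L where L: "compact L" "L \<subseteq> \<Omega>" "\<And>x. x \<notin> L \<Longrightarrow> v x = 0" using test_functions_support[OF v] by auto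
  show "(\<lambda>x. u x + c * v x) \<in> test_functions \<Omega>"
  proof (rule test_functionsI[of _ "K \<union> L"])
    show "C_k k (\<lambda>x. u x + c * v x)" for k
      using u v by (intro C_k_add C_k_mult C_k_const) (auto simp: test_functions_def)
  qed (use K L in auto)
qed

text \<open>Green's identity: the divergence of \<psi> grad \<phi> has integral zero because \<psi>
  has compact support.\<close>

lemma integral_laplacian:
  fixes \<phi> \<psi> :: "real ^ 'n::finite \<Rightarrow> real"
  assumes \<Omega>: "open \<Omega>" and \<phi>: "\<phi> \<in> test_functions \<Omega>" and \<psi>: "\<psi> \<in> test_functions \<Omega>"
  shows "L2_inner \<Omega> (\<lambda>x. - laplacian \<phi> x) \<psi> = (\<integral>x. (\<Sum>i\<in>UNIV. partial i \<phi> x * partial i \<psi> x) \<partial>lebesgue_on \<Omega>)"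
proof -
  obtain K where K: "compact K" "K \<subseteq> \<Omega>" "\<And>x. x \<notin> K \<Longrightarrow> \<psi> x = 0" using test_functions_support[OF \<psi>] by auto
  note s = test_functions_smooth[OF \<phi>] test_functions_smooth[OF \<psi>]
  define F' where "F' i x h = \<psi> x * (\<Sum>j\<in>UNIV. h $ j * partial j (partial i \<phi>) x) + (\<Sum>j\<in>UNIV. h $ j * partial j \<psi> x) * partial i \<phi> x"
    for i :: 'n and x h :: "real ^ 'n"
  have F': "((\<lambda>x. \<psi> x * partial i \<phi> x) has_derivative F' i x) (at x)" for i x
    unfolding F'_def by (intro has_derivative_mult has_derivative_partial s)
  have ax: "(\<Sum>j\<in>UNIV. axis i 1 $ j * f j) = f i" for i :: 'n and f :: "'n \<Rightarrow> real"
    by (simp add: axis_def if_distrib[of "\<lambda>x. x * _"] sum.delta cong: if_cong)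
  have F'_ax: "F' i x (axis i 1) = \<psi> x * partial i (partial i \<phi>) x + partial i \<psi> x * partial i \<phi> x" for i x
    by (simp add: F'_def ax)
  have c: "continuous_on \<Omega> (\<lambda>x. \<psi> x * partial i (partial i \<phi>) x + partial i \<psi> x * partial i \<phi> x)" for i
    by (intro continuous_intros continuous_on_subset[OF s(3)] continuous_on_subset[OF s(4)]
      continuous_on_subset[OF s(5)] continuous_on_subset[OF s(8)] continuous_on_subset[OF s(9)]) auto
  have int: "(\<integral>x. (\<Sum>i\<in>UNIV. F' i x (axis i 1)) \<partial>lebesgue_on \<Omega>) = 0"
    by (rule integral_divergence_eq_0[OF \<Omega> K(1,2) F']) (use c K(3) in \<open>auto simp: F'_ax\<close>)
  have i1: "integrable (lebesgue_on \<Omega>) (\<lambda>x. laplacian \<phi> x * \<psi> x)"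
    unfolding laplacian_def
    by (rule integrable_continuous_compact_support[OF \<Omega> K(1,2)])
      (auto simp: K(3) intro!: continuous_intros continuous_on_subset[OF s(5)] continuous_on_subset[OF s(8)])
  have i2: "integrable (lebesgue_on \<Omega>) (\<lambda>x. \<Sum>i\<in>UNIV. partial i \<phi> x * partial i \<psi> x)"
    by (rule integrable_continuous_compact_support[OF \<Omega> K(1,2)])
      (use partial_eq_0[OF compact_imp_closed[OF K(1)] K(3)] in \<open>auto intro!: continuous_intros sum.neutral
        continuous_on_subset[OF s(4)] continuous_on_subset[OF s(9)]\<close>)
  have "(\<Sum>i\<in>UNIV. F' i x (axis i 1)) = laplacian \<phi> x * \<psi> x + (\<Sum>i\<in>UNIV. partial i \<phi> x * partial i \<psi> x)" for x
    by (simp add: F'_ax laplacian_def sum.distrib sum_distrib_left mult.commute)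
  then have "(\<integral>x. laplacian \<phi> x * \<psi> x \<partial>lebesgue_on \<Omega>) + (\<integral>x. (\<Sum>i\<in>UNIV. partial i \<phi> x * partial i \<psi> x) \<partial>lebesgue_on \<Omega>) = 0"
    using int i1 i2 by simp
  then show ?thesis unfolding L2_inner_def by simp
qed


section \<open>The Dirichlet form\<close>

text \<open>The discriminant criterion behind both Cauchy-Schwarz inequalities. The case c = 0 is
  included because the L2 product is only semidefinite on functions.\<close>

lemma square_le_of_quadratic_nonneg:
  fixes a b c :: real
  assumes "\<And>t. a + 2 * t * b + t\<^sup>2 * c \<ge> 0" "c \<ge> 0"
  shows "b\<^sup>2 \<le> a * c"
proof (cases "c = 0")
  case True
  have "b = 0"
  proof (rule ccontr)
    assume b: "b \<noteq> 0"
    \<comment> \<open>For this value of t, a + 2 t b becomes a - 2 (abs a + 1), which is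
      negative.\<close>
    have eq: "2 * (- (\<bar>a\<bar> + 1) / b) * b = - 2 * (\<bar>a\<bar> + 1)" using b by simp
    have "0 \<le> a + 2 * t * b" for t using assms(1)[of t] True by simp
    from this[of "- (\<bar>a\<bar> + 1) / b"] have "0 \<le> a + (- 2 * (\<bar>a\<bar> + 1))" unfolding eq .
    then show False using abs_ge_self[of a] by (smt (verit))
  qed
  then show ?thesis using True by simp
next
  case False
  then have c: "c > 0" using assms(2) by simp
  have "a + 2 * (- b / c) * b + (- b / c)\<^sup>2 * c = a - b\<^sup>2 / c"
    using c by (simp add: field_simps power2_eq_square)
  then have "b\<^sup>2 / c \<le> a" using assms(1)[of "- b / c"] by simp
  then show ?thesis using c by (simp add: field_simps)
qed

section \<open>Scalar product and Cauchy-Schwarz inequality in \<open>L2\<close>\<close>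

lemma L2_mult_integrable:
  assumes "u \<in> L2 \<Omega>" "v \<in> L2 \<Omega>"
  shows "integrable (lebesgue_on \<Omega>) (\<lambda>x. u x * v x)"
proof (rule Bochner_Integration.integrable_bound)
  show "integrable (lebesgue_on \<Omega>) (\<lambda>x. (u x)\<^sup>2 + (v x)\<^sup>2)"
    using assms by (auto simp: L2_def)
  show "(\<lambda>x. u x * v x) \<in> borel_measurable (lebesgue_on \<Omega>)"
    using assms by (auto simp: L2_def intro!: borel_measurable_times)
  have "\<bar>a * b\<bar> \<le> a\<^sup>2 + b\<^sup>2" for a b :: real
  proof -
    have "0 \<le> (\<bar>a\<bar> - \<bar>b\<bar>)\<^sup>2" by simp
    then have "2 * (\<bar>a\<bar> * \<bar>b\<bar>) \<le> a\<^sup>2 + b\<^sup>2" by (simp add: power2_diff)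
    moreover have "0 \<le> \<bar>a\<bar> * \<bar>b\<bar>" by simp
    ultimately show ?thesis unfolding abs_mult by linarith
  qed
  then show "AE x in lebesgue_on \<Omega>. norm (u x * v x) \<le> norm ((u x)\<^sup>2 + (v x)\<^sup>2)"
    by (intro AE_I2) simp
qed

lemma L2_combination:
  assumes "u \<in> L2 \<Omega>" "v \<in> L2 \<Omega>"
  shows "(\<lambda>x. u x + c * v x) \<in> L2 \<Omega>"
proof -
  have "(\<lambda>x. (u x + c * v x)\<^sup>2) = (\<lambda>x. (u x)\<^sup>2 + 2 * c * (u x * v x) + c\<^sup>2 * (v x)\<^sup>2)"
    by (simp add: power2_sum power_mult_distrib algebra_simps)
  then show ?thesis
    using assms L2_mult_integrable[OF assms] by (auto simp: L2_def)
qed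

lemma L2_inner_add:
  assumes "u \<in> L2 \<Omega>" "v \<in> L2 \<Omega>" "f \<in> L2 \<Omega>"
  shows "L2_inner \<Omega> f (\<lambda>x. u x + c * v x) = L2_inner \<Omega> f u + c * L2_inner \<Omega> f v"
proof -
  have "(\<integral>x. f x * (u x + c * v x) \<partial>lebesgue_on \<Omega>) = (\<integral>x. f x * u x + c * (f x * v x) \<partial>lebesgue_on \<Omega>)"
    by (simp add: algebra_simps)
  also have "\<dots> = (\<integral>x. f x * u x \<partial>lebesgue_on \<Omega>) + c * (\<integral>x. f x * v x \<partial>lebesgue_on \<Omega>)"
    using L2_mult_integrable[OF assms(3,1)] L2_mult_integrable[OF assms(3,2)] by simp
  finally show ?thesis by (simp add: L2_inner_def)
qed

lemma L2_inner_commute: "L2_inner \<Omega> u v = L2_inner \<Omega> v u"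
  by (simp add: L2_inner_def mult.commute)

lemma L2_inner_ge_0: "L2_inner \<Omega> u u \<ge> 0"
  unfolding L2_inner_def by (intro Bochner_Integration.integral_nonneg) simp

lemma L2_inner_expand:
  assumes "u \<in> L2 \<Omega>" "v \<in> L2 \<Omega>"
  shows "L2_inner \<Omega> (\<lambda>x. u x + t * v x) (\<lambda>x. u x + t * v x) =
    L2_inner \<Omega> u u + 2 * t * L2_inner \<Omega> u v + t\<^sup>2 * L2_inner \<Omega> v v"
proof -
  have "L2_inner \<Omega> (\<lambda>x. u x + t * v x) (\<lambda>x. u x + t * v x) =
      L2_inner \<Omega> (\<lambda>x. u x + t * v x) u + t * L2_inner \<Omega> (\<lambda>x. u x + t * v x) v"
    by (intro L2_inner_add L2_combination assms)
  also have "\<dots> = L2_inner \<Omega> u u + t * L2_inner \<Omega> u v + t * (L2_inner \<Omega> v u + t * L2_inner \<Omega> v v)"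
    unfolding L2_inner_commute[of _ "\<lambda>x. u x + t * v x"] by (simp add: L2_inner_add assms)
  finally show ?thesis
    by (simp add: L2_inner_commute[of _ v u] power2_eq_square algebra_simps)
qed

lemma L2_Cauchy_Schwarz:
  assumes "u \<in> L2 \<Omega>" "v \<in> L2 \<Omega>"
  shows "(L2_inner \<Omega> u v)\<^sup>2 \<le> L2_inner \<Omega> u u * L2_inner \<Omega> v v"
proof (rule square_le_of_quadratic_nonneg)
  show "0 \<le> L2_inner \<Omega> u u + 2 * t * L2_inner \<Omega> u v + t\<^sup>2 * L2_inner \<Omega> v v" for t
    unfolding L2_inner_expand[OF assms, symmetric] by (rule L2_inner_ge_0)
qed (rule L2_inner_ge_0)

section \<open>Test functions and their Dirichlet form\<close>

lemma continuous_compact_support_L2: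
  fixes v :: "real ^ 'n::finite \<Rightarrow> real"
  assumes "open \<Omega>" "compact K" "K \<subseteq> \<Omega>" "continuous_on UNIV v" "\<And>x. x \<notin> K \<Longrightarrow> v x = 0"
  shows "v \<in> L2 \<Omega>"
proof -
  have c: "continuous_on \<Omega> v" using assms(4) continuous_on_subset by blast
  have "v \<in> borel_measurable (lebesgue_on \<Omega>)"
    using continuous_imp_measurable_on_sets_lebesgue[OF c] assms(1) by simp
  moreover have "integrable (lebesgue_on \<Omega>) (\<lambda>x. (v x)\<^sup>2)"
    by (rule integrable_continuous_compact_support[OF assms(1-3)]) (use assms c in \<open>auto intro!: continuous_intros\<close>)
  ultimately show ?thesis by (simp add: L2_def)
qed

lemma test_functions_L2:
  assumes "open \<Omega>" "v \<in> test_functions \<Omega>"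
  shows "v \<in> L2 \<Omega>" "(\<lambda>x. - laplacian v x) \<in> L2 \<Omega>"
proof -
  obtain K where K: "compact K" "K \<subseteq> \<Omega>" "\<And>x. x \<notin> K \<Longrightarrow> v x = 0"
    using test_functions_support[OF assms(2)] by auto
  note s = test_functions_smooth[OF assms(2)]
  show "v \<in> L2 \<Omega>"
    by (rule continuous_compact_support_L2[OF assms(1) K(1,2) s(3) K(3)])
  have z: "partial i v x = 0" if "x \<notin> K" for i x
    by (rule partial_eq_0[OF compact_imp_closed[OF K(1)] K(3) that])
  have zz: "partial i (partial i v) x = 0" if "x \<notin> K" for i x
    by (rule partial_eq_0[OF compact_imp_closed[OF K(1)] z that])
  show "(\<lambda>x. - laplacian v x) \<in> L2 \<Omega>"
    by (rule continuous_compact_support_L2[OF assms(1) K(1,2)])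
      (auto simp: laplacian_def zz intro!: continuous_intros s(5))
qed

definition dirichlet_form :: "(real ^ 'n::finite) set \<Rightarrow> (real ^ 'n \<Rightarrow> real) \<Rightarrow> (real ^ 'n \<Rightarrow> real) \<Rightarrow> real" where
  "dirichlet_form \<Omega> \<phi> \<psi> = (\<integral>x. (\<Sum>i\<in>UNIV. partial i \<phi> x * partial i \<psi> x) \<partial>lebesgue_on \<Omega>)"

lemma dirichlet_form_integrable:
  assumes "open \<Omega>" "\<phi> \<in> test_functions \<Omega>" "\<psi> \<in> test_functions \<Omega>"
  shows "integrable (lebesgue_on \<Omega>) (\<lambda>x. \<Sum>i\<in>UNIV. partial i \<phi> x * partial i \<psi> x)"
proof -
  obtain K where K: "compact K" "K \<subseteq> \<Omega>" "\<And>x. x \<notin> K \<Longrightarrow> \<phi> x = 0"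
    using test_functions_support[OF assms(2)] by auto
  have z: "partial i \<phi> x = 0" if "x \<notin> K" for i x
    by (rule partial_eq_0[OF compact_imp_closed[OF K(1)] K(3) that])
  show ?thesis
    by (rule integrable_continuous_compact_support[OF assms(1) K(1,2)])
      (auto simp: z intro!: continuous_intros continuous_on_subset[OF test_functions_smooth(4)[OF assms(2)]]
        continuous_on_subset[OF test_functions_smooth(4)[OF assms(3)]])
qed

lemma dirichlet_form_expand:
  assumes \<Omega>: "open \<Omega>" and \<phi>: "\<phi> \<in> test_functions \<Omega>" and \<psi>: "\<psi> \<in> test_functions \<Omega>"
  shows "dirichlet_form \<Omega> (\<lambda>x. \<phi> x + c * \<psi> x) (\<lambda>x. \<phi> x + c * \<psi> x) =
    dirichlet_form \<Omega> \<phi> \<phi> + 2 * c * dirichlet_form \<Omega> \<phi> \<psi> + c\<^sup>2 * dirichlet_form \<Omega> \<psi> \<psi>"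
proof -
  have "(\<Sum>i\<in>UNIV. (partial i \<phi> x + c * partial i \<psi> x) * (partial i \<phi> x + c * partial i \<psi> x)) =
    (\<Sum>i\<in>UNIV. partial i \<phi> x * partial i \<phi> x) + 2 * c * (\<Sum>i\<in>UNIV. partial i \<phi> x * partial i \<psi> x)
    + c\<^sup>2 * (\<Sum>i\<in>UNIV. partial i \<psi> x * partial i \<psi> x)" for x
    unfolding sum_distrib_left sum.distrib[symmetric]
    by (intro sum.cong refl) (simp add: algebra_simps power2_eq_square)
  then show ?thesis
    unfolding dirichlet_form_def test_functions_combination(2)[OF \<phi> \<psi>]
    using dirichlet_form_integrable[OF \<Omega> \<phi> \<phi>] dirichlet_form_integrable[OF \<Omega> \<phi> \<psi>]
      dirichlet_form_integrable[OF \<Omega> \<psi> \<psi>] by simp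
qed

lemma dirichlet_form_diff_right:
  assumes \<Omega>: "open \<Omega>" and "\<phi> \<in> test_functions \<Omega>" "\<psi> \<in> test_functions \<Omega>" "\<eta> \<in> test_functions \<Omega>"
  shows "dirichlet_form \<Omega> \<eta> (\<lambda>x. \<phi> x + c * \<psi> x) = dirichlet_form \<Omega> \<eta> \<phi> + c * dirichlet_form \<Omega> \<eta> \<psi>"
proof -
  have "(\<Sum>i\<in>UNIV. partial i \<eta> x * (partial i \<phi> x + c * partial i \<psi> x)) =
    (\<Sum>i\<in>UNIV. partial i \<eta> x * partial i \<phi> x) + c * (\<Sum>i\<in>UNIV. partial i \<eta> x * partial i \<psi> x)" for x
    unfolding sum_distrib_left sum.distrib[symmetric]
    by (intro sum.cong refl) (simp add: algebra_simps)
  then show ?thesis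
    unfolding dirichlet_form_def test_functions_combination(2)[OF assms(2,3)]
    using dirichlet_form_integrable[OF \<Omega> assms(4,2)] dirichlet_form_integrable[OF \<Omega> assms(4,3)] by simp
qed

lemma dirichlet_form_ge_0: "dirichlet_form \<Omega> \<phi> \<phi> \<ge> 0"
  unfolding dirichlet_form_def by (intro Bochner_Integration.integral_nonneg sum_nonneg) simp

lemma dirichlet_form_Cauchy_Schwarz:
  assumes "open \<Omega>" "\<phi> \<in> test_functions \<Omega>" "\<psi> \<in> test_functions \<Omega>"
  shows "(dirichlet_form \<Omega> \<phi> \<psi>)\<^sup>2 \<le> dirichlet_form \<Omega> \<phi> \<phi> * dirichlet_form \<Omega> \<psi> \<psi>"
proof (rule square_le_of_quadratic_nonneg)
  show "0 \<le> dirichlet_form \<Omega> \<phi> \<phi> + 2 * t * dirichlet_form \<Omega> \<phi> \<psi> + t\<^sup>2 * dirichlet_form \<Omega> \<psi> \<psi>" for t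
    unfolding dirichlet_form_expand[OF assms, symmetric] by (rule dirichlet_form_ge_0)
qed (rule dirichlet_form_ge_0)

text \<open>With \<open>a\<close> the Dirichlet form, \<open>a (\<phi> k) (\<phi> k) - \<mu> * \<langle>u, \<phi> k\<rangle>\<close> is the limit over \<open>j\<close> of
  \<open>a (\<phi> k) (\<phi> k - \<phi> j)\<close>, which is small by the Cauchy-Schwarz inequality.\<close>

lemma eigenfunction_approximation:
  fixes u :: "real ^ 'n::finite \<Rightarrow> real"
  assumes \<Omega>: "open \<Omega>" and u: "eigenfunction \<Omega> \<mu> u"
  shows "\<exists>\<phi> :: nat \<Rightarrow> real ^ 'n \<Rightarrow> real. (\<forall>k. \<phi> k \<in> test_functions \<Omega>) \<and>
    (\<lambda>k. L2_inner \<Omega> (\<lambda>x. \<phi> k x - u x) (\<lambda>x. \<phi> k x - u x)) \<longlonglongrightarrow> 0 \<and>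
    (\<lambda>k. L2_inner \<Omega> (\<phi> k) (\<phi> k)) \<longlonglongrightarrow> L2_inner \<Omega> u u \<and>
    (\<lambda>k. dirichlet_form \<Omega> (\<phi> k) (\<phi> k)) \<longlonglongrightarrow> \<mu> * L2_inner \<Omega> u u"
proof -
  let ?S = "\<lambda>v x. - laplacian v x"
  from u obtain \<phi> :: "nat \<Rightarrow> real ^ 'n \<Rightarrow> real" where
    uL: "u \<in> L2 \<Omega>" and weak: "\<And>v. v \<in> test_functions \<Omega> \<Longrightarrow> L2_inner \<Omega> u (?S v) = L2_inner \<Omega> (\<lambda>x. \<mu> * u x) v"
    and \<phi>: "\<And>k. \<phi> k \<in> test_functions \<Omega>"
    and lim: "(\<lambda>k. L2_norm \<Omega> (\<lambda>x. \<phi> k x - u x)) \<longlonglongrightarrow> 0"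
    and cauchy: "\<And>e. e > 0 \<Longrightarrow> \<exists>N. \<forall>j\<ge>N. \<forall>k\<ge>N.
      L2_inner \<Omega> (?S (\<lambda>x. \<phi> j x - \<phi> k x)) (\<lambda>x. \<phi> j x - \<phi> k x) < e"
    unfolding eigenfunction_def dirichlet_laplacian_def friedrichs_extension_def energy_space_def by auto
  let ?a = "dirichlet_form \<Omega>"
  \<comment> \<open>The difference is written with the coefficient -1 to fit
    \<open>L2_combination\<close> and \<open>L2_inner_expand\<close>.\<close>
  define d where "d k x = u x + (-1) * \<phi> k x" for k x
  have \<phi>L: "\<phi> k \<in> L2 \<Omega>" for k by (rule test_functions_L2(1)[OF \<Omega> \<phi>])
  have dL: "d k \<in> L2 \<Omega>" for k unfolding d_def[abs_def] by (rule L2_combination[OF uL \<phi>L])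
  have "(\<lambda>k. (L2_norm \<Omega> (\<lambda>x. \<phi> k x - u x))\<^sup>2) \<longlonglongrightarrow> 0\<^sup>2" by (intro tendsto_intros lim)
  then have lim0: "(\<lambda>k. L2_inner \<Omega> (\<lambda>x. \<phi> k x - u x) (\<lambda>x. \<phi> k x - u x)) \<longlonglongrightarrow> 0"
    by (simp add: L2_norm_def L2_inner_ge_0)
  have "L2_inner \<Omega> (\<lambda>x. \<phi> k x - u x) (\<lambda>x. \<phi> k x - u x) = L2_inner \<Omega> (d k) (d k)" for k
    unfolding L2_inner_def d_def by (intro Bochner_Integration.integral_cong) (auto simp: algebra_simps)
  then have d0: "(\<lambda>k. L2_inner \<Omega> (d k) (d k)) \<longlonglongrightarrow> 0" using lim0 by simp
  have fd: "(\<lambda>k. L2_inner \<Omega> f (d k)) \<longlonglongrightarrow> 0" if "f \<in> L2 \<Omega>" for f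
  proof -
    have "(\<lambda>k. L2_inner \<Omega> f f * L2_inner \<Omega> (d k) (d k)) \<longlonglongrightarrow> L2_inner \<Omega> f f * 0" by (intro tendsto_intros d0)
    then have up: "(\<lambda>k. L2_inner \<Omega> f f * L2_inner \<Omega> (d k) (d k)) \<longlonglongrightarrow> 0" by simp
    have "(\<lambda>k. (L2_inner \<Omega> f (d k))\<^sup>2) \<longlonglongrightarrow> 0"
    proof (rule tendsto_sandwich[OF _ _ tendsto_const up])
      show "\<forall>\<^sub>F k in sequentially. (L2_inner \<Omega> f (d k))\<^sup>2 \<le> L2_inner \<Omega> f f * L2_inner \<Omega> (d k) (d k)"
        by (intro always_eventually allI L2_Cauchy_Schwarz that dL)
    qed simp
    then have "(\<lambda>k. sqrt ((L2_inner \<Omega> f (d k))\<^sup>2)) \<longlonglongrightarrow> sqrt 0" by (intro tendsto_intros)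
    then show ?thesis by (simp add: tendsto_rabs_zero_iff)
  qed
  have \<phi>d: "\<phi> k = (\<lambda>x. u x + (-1) * d k x)" for k by (auto simp: d_def)
  have f\<phi>: "(\<lambda>k. L2_inner \<Omega> f (\<phi> k)) \<longlonglongrightarrow> L2_inner \<Omega> f u" if "f \<in> L2 \<Omega>" for f
  proof -
    have "(\<lambda>k. L2_inner \<Omega> f u + (-1) * L2_inner \<Omega> f (d k)) \<longlonglongrightarrow> L2_inner \<Omega> f u + (-1) * 0"
      by (intro tendsto_intros fd that)
    then show ?thesis by (subst \<phi>d, subst L2_inner_add[OF uL dL that]) simp
  qed
  have \<phi>\<phi>: "(\<lambda>k. L2_inner \<Omega> (\<phi> k) (\<phi> k)) \<longlonglongrightarrow> L2_inner \<Omega> u u"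
  proof -
    have "(\<lambda>k. L2_inner \<Omega> u u + 2 * (-1) * L2_inner \<Omega> u (d k) + (-1)\<^sup>2 * L2_inner \<Omega> (d k) (d k)) \<longlonglongrightarrow>
      L2_inner \<Omega> u u + 2 * (-1) * 0 + (-1)\<^sup>2 * 0"
      by (intro tendsto_intros fd uL d0)
    then show ?thesis by (subst (1 2) \<phi>d, subst L2_inner_expand[OF uL dL]) simp
  qed
  define \<delta> where "\<delta> j k = (\<lambda>x. \<phi> j x + (-1) * \<phi> k x)" for j k
  have \<delta>T: "\<delta> j k \<in> test_functions \<Omega>" for j k
    unfolding \<delta>_def by (rule test_functions_combination(1)[OF \<phi> \<phi>])
  have cauchy': "\<exists>N. \<forall>j\<ge>N. \<forall>k\<ge>N. ?a (\<delta> j k) (\<delta> j k) < e" if "e > 0" for e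
  proof -
    have "L2_inner \<Omega> (?S (\<lambda>x. \<phi> j x - \<phi> k x)) (\<lambda>x. \<phi> j x - \<phi> k x) = ?a (\<delta> j k) (\<delta> j k)" for j k
      using integral_laplacian[OF \<Omega> \<delta>T \<delta>T, of j k j k] by (simp add: \<delta>_def dirichlet_form_def)
    then show ?thesis using cauchy[OF that] by simp
  qed
  obtain N0 where N0: "\<And>j k. j \<ge> N0 \<Longrightarrow> k \<ge> N0 \<Longrightarrow> ?a (\<delta> j k) (\<delta> j k) < 1" using cauchy'[of 1] by auto
  define M where "M = 2 * ?a (\<phi> N0) (\<phi> N0) + 2"
  have bound: "?a (\<phi> k) (\<phi> k) \<le> M" if "k \<ge> N0" for k
  proof -
    \<comment> \<open>Nonnegativity of the energy of \<phi> k - 2 \<phi> N0 yields a(\<phi> k) \<le>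
      2 a(\<phi> k - \<phi> N0) + 2 a(\<phi> N0), whence the constant \<open>M\<close>.\<close>
    have "0 \<le> ?a (\<phi> k) (\<phi> k) + 2 * (-2) * ?a (\<phi> k) (\<phi> N0) + (-2)\<^sup>2 * ?a (\<phi> N0) (\<phi> N0)"
      unfolding dirichlet_form_expand[OF \<Omega> \<phi> \<phi>, symmetric] by (rule dirichlet_form_ge_0)
    moreover have "?a (\<delta> k N0) (\<delta> k N0) = ?a (\<phi> k) (\<phi> k) + 2 * (-1) * ?a (\<phi> k) (\<phi> N0) + (-1)\<^sup>2 * ?a (\<phi> N0) (\<phi> N0)"
      unfolding \<delta>_def by (rule dirichlet_form_expand[OF \<Omega> \<phi> \<phi>])
    ultimately show ?thesis using N0[OF that order_refl] by (simp add: M_def)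
  qed
  have M: "M > 0" using dirichlet_form_ge_0[of \<Omega> "\<phi> N0"] by (simp add: M_def)
  have key: "(?a (\<phi> k) (\<phi> k) - \<mu> * L2_inner \<Omega> u (\<phi> k))\<^sup>2 \<le> M * e"
    if "k \<ge> N0" "k \<ge> N" "\<And>j. j \<ge> N \<Longrightarrow> ?a (\<delta> k j) (\<delta> k j) < e" for k N e
  proof (rule LIMSEQ_le_const2)
    have "L2_inner \<Omega> (?S (\<phi> k)) (\<phi> j) = ?a (\<phi> k) (\<phi> j)" for j
      using integral_laplacian[OF \<Omega> \<phi> \<phi>] by (simp add: dirichlet_form_def)
    moreover have "(\<lambda>j. L2_inner \<Omega> (?S (\<phi> k)) (\<phi> j)) \<longlonglongrightarrow> L2_inner \<Omega> (?S (\<phi> k)) u"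
      by (rule f\<phi>[OF test_functions_L2(2)[OF \<Omega> \<phi>]])
    moreover have "L2_inner \<Omega> (?S (\<phi> k)) u = \<mu> * L2_inner \<Omega> u (\<phi> k)"
      unfolding L2_inner_commute[of \<Omega> "?S (\<phi> k)" u] weak[OF \<phi>[of k]]
      by (simp add: L2_inner_def mult.assoc)
    ultimately have "(\<lambda>j. ?a (\<phi> k) (\<phi> j)) \<longlonglongrightarrow> \<mu> * L2_inner \<Omega> u (\<phi> k)" by simp
    then show "(\<lambda>j. (?a (\<phi> k) (\<phi> k) - ?a (\<phi> k) (\<phi> j))\<^sup>2) \<longlonglongrightarrow> (?a (\<phi> k) (\<phi> k) - \<mu> * L2_inner \<Omega> u (\<phi> k))\<^sup>2"
      by (intro tendsto_intros)
    have "(?a (\<phi> k) (\<phi> k) - ?a (\<phi> k) (\<phi> j))\<^sup>2 \<le> M * e" if "j \<ge> N" for j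
    proof -
      have "?a (\<phi> k) (\<delta> k j) = ?a (\<phi> k) (\<phi> k) + (-1) * ?a (\<phi> k) (\<phi> j)"
        unfolding \<delta>_def by (rule dirichlet_form_diff_right[OF \<Omega> \<phi> \<phi> \<phi>])
      then have "(?a (\<phi> k) (\<phi> k) - ?a (\<phi> k) (\<phi> j))\<^sup>2 \<le> ?a (\<phi> k) (\<phi> k) * ?a (\<delta> k j) (\<delta> k j)"
        using dirichlet_form_Cauchy_Schwarz[OF \<Omega> \<phi> \<delta>T, of k k j] by simp
      also have "\<dots> \<le> M * e"
        using bound[OF \<open>k \<ge> N0\<close>] \<open>\<And>j. j \<ge> N \<Longrightarrow> ?a (\<delta> k j) (\<delta> k j) < e\<close>[OF that] M
        by (intro mult_mono dirichlet_form_ge_0) auto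
      finally show ?thesis .
    qed
    then show "\<exists>N. \<forall>n\<ge>N. (?a (\<phi> k) (\<phi> k) - ?a (\<phi> k) (\<phi> n))\<^sup>2 \<le> M * e" by blast
  qed
  have "(\<lambda>k. ?a (\<phi> k) (\<phi> k) - \<mu> * L2_inner \<Omega> u (\<phi> k)) \<longlonglongrightarrow> 0"
  proof (rule LIMSEQ_I)
    fix r :: real assume r: "r > 0"
    define e where "e = (r / 2)\<^sup>2 / M"
    have "e > 0" using r M by (simp add: e_def)
    then obtain N where N: "\<forall>j\<ge>N. \<forall>k\<ge>N. ?a (\<delta> j k) (\<delta> j k) < e" using cauchy' by blast
    have "norm (?a (\<phi> k) (\<phi> k) - \<mu> * L2_inner \<Omega> u (\<phi> k) - 0) < r" if "k \<ge> max N0 N" for k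
    proof -
      have "(?a (\<phi> k) (\<phi> k) - \<mu> * L2_inner \<Omega> u (\<phi> k))\<^sup>2 \<le> M * e"
      proof (rule key)
        show "k \<ge> N0" "k \<ge> N" using that by auto
        show "?a (\<delta> k j) (\<delta> k j) < e" if "j \<ge> N" for j
          using N that \<open>k \<ge> N\<close> by blast
      qed
      also have "M * e = (r / 2)\<^sup>2" using M by (simp add: e_def)
      finally have "\<bar>?a (\<phi> k) (\<phi> k) - \<mu> * L2_inner \<Omega> u (\<phi> k)\<bar> \<le> r / 2"
        using abs_le_square_iff[of "?a (\<phi> k) (\<phi> k) - \<mu> * L2_inner \<Omega> u (\<phi> k)" "r / 2"] r by simp
      then show ?thesis using r by simp
    qed
    then show "\<exists>no. \<forall>n\<ge>no. norm (?a (\<phi> n) (\<phi> n) - \<mu> * L2_inner \<Omega> u (\<phi> n) - 0) < r" by blast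
  qed
  from tendsto_add[OF this tendsto_mult[OF tendsto_const[of \<mu>] f\<phi>[OF uL]]]
  have "(\<lambda>k. ?a (\<phi> k) (\<phi> k)) \<longlonglongrightarrow> \<mu> * L2_inner \<Omega> u u" by simp
  then show ?thesis using \<phi> lim0 \<phi>\<phi> by blast
qed


section \<open>Positive solutions and the bottom of the spectrum\<close>

text \<open>No boundary values are prescribed: positivity inside already bounds all eigenvalues from
  below by \<Lambda> and, on a connected set, makes eigenfunctions for \<Lambda> multiples of
  \<open>w\<close>. Boundary values matter only for \<open>w\<close> to lie in the energy
  space.\<close>

locale positive_solution =
  fixes \<Omega> :: "(real ^ 'n::finite) set" and w :: "real ^ 'n \<Rightarrow> real"
    and W :: "'n \<Rightarrow> real ^ 'n \<Rightarrow> real" and W' :: "'n \<Rightarrow> real ^ 'n \<Rightarrow> real ^ 'n \<Rightarrow> real" and \<Lambda> :: real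
  assumes \<Omega>: "open \<Omega>"
    and w_pos: "\<And>x. x \<in> \<Omega> \<Longrightarrow> w x > 0"
    and w_deriv: "\<And>x. x \<in> \<Omega> \<Longrightarrow> (w has_derivative (\<lambda>h. \<Sum>i\<in>UNIV. h $ i * W i x)) (at x)"
    and W_deriv: "\<And>i x. x \<in> \<Omega> \<Longrightarrow> (W i has_derivative W' i x) (at x)"
    and W'_cont: "\<And>i. continuous_on \<Omega> (\<lambda>x. W' i x (axis i 1))"
    and equation: "\<And>x. x \<in> \<Omega> \<Longrightarrow> (\<Sum>i\<in>UNIV. W' i x (axis i 1)) = - \<Lambda> * w x"
begin

lemma w_cont: "continuous_on \<Omega> w"
  by (rule continuous_at_imp_continuous_on) (use has_derivative_continuous[OF w_deriv] in blast)

lemma W_cont: "continuous_on \<Omega> (W i)"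
  by (rule continuous_at_imp_continuous_on) (use has_derivative_continuous[OF W_deriv] in blast)

lemma sum_axis: "(\<Sum>j\<in>UNIV. axis i 1 $ j * f j) = f i" for i :: 'n and f :: "'n \<Rightarrow> real"
  by (simp add: axis_def if_distrib[of "\<lambda>x. x * _"] sum.delta cong: if_cong)

text \<open>Green's second identity, from the divergence of w grad v - v grad w; the compact support
  of v removes all boundary terms.\<close>

lemma weak_equation:
  assumes v: "v \<in> test_functions \<Omega>"
  shows "L2_inner \<Omega> w (\<lambda>x. - laplacian v x) = L2_inner \<Omega> (\<lambda>x. \<Lambda> * w x) v"
proof -
  obtain K where K: "compact K" "K \<subseteq> \<Omega>" "\<And>x. x \<notin> K \<Longrightarrow> v x = 0"
    using test_functions_support[OF v] by auto
  note s = test_functions_smooth[OF v]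
  have z: "partial i v x = 0" if "x \<notin> K" for i x
    by (rule partial_eq_0[OF compact_imp_closed[OF K(1)] K(3) that])
  have zz: "partial i (partial i v) x = 0" if "x \<notin> K" for i x
    by (rule partial_eq_0[OF compact_imp_closed[OF K(1)] z that])
  define F' where "F' i x h = (w x * (\<Sum>j\<in>UNIV. h $ j * partial j (partial i v) x) + (\<Sum>j\<in>UNIV. h $ j * W j x) * partial i v x)
     - (v x * W' i x h + (\<Sum>j\<in>UNIV. h $ j * partial j v x) * W i x)" for i x h
  have F': "((\<lambda>x. w x * partial i v x - v x * W i x) has_derivative F' i x) (at x)" if "x \<in> \<Omega>" for i x
    unfolding F'_def by (intro has_derivative_diff has_derivative_mult has_derivative_partial s w_deriv[OF that] W_deriv[OF that])
  have F'_ax: "F' i x (axis i 1) = w x * partial i (partial i v) x - v x * W' i x (axis i 1)" for i x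
    by (simp add: F'_def sum_axis)
  have c: "continuous_on \<Omega> (\<lambda>x. w x * partial i (partial i v) x - v x * W' i x (axis i 1))" for i
    by (intro continuous_intros w_cont W'_cont continuous_on_subset[OF s(5)] continuous_on_subset[OF s(3)]) auto
  have int: "(\<integral>x. (\<Sum>i\<in>UNIV. F' i x (axis i 1)) \<partial>lebesgue_on \<Omega>) = 0"
    by (rule integral_divergence_eq_0[OF \<Omega> K(1,2) F']) (use c K(3) z in \<open>auto simp: F'_ax\<close>)
  have i1: "integrable (lebesgue_on \<Omega>) (\<lambda>x. w x * laplacian v x)"
    by (rule integrable_continuous_compact_support[OF \<Omega> K(1,2)])
      (auto simp: laplacian_def zz intro!: continuous_intros w_cont continuous_on_subset[OF s(5)])
  have i2: "integrable (lebesgue_on \<Omega>) (\<lambda>x. w x * v x)"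
    by (rule integrable_continuous_compact_support[OF \<Omega> K(1,2)])
      (auto simp: K(3) intro!: continuous_intros w_cont continuous_on_subset[OF s(3)])
  have "(\<Sum>i\<in>UNIV. F' i x (axis i 1)) = w x * laplacian v x + \<Lambda> * (w x * v x)" if "x \<in> \<Omega>" for x
  proof -
    have "(\<Sum>i\<in>UNIV. F' i x (axis i 1)) = w x * laplacian v x - v x * (\<Sum>i\<in>UNIV. W' i x (axis i 1))"
      by (simp add: F'_ax laplacian_def sum_subtractf sum_distrib_left)
    then show ?thesis unfolding equation[OF that] by (simp add: algebra_simps)
  qed
  then have "(\<integral>x. w x * laplacian v x + \<Lambda> * (w x * v x) \<partial>lebesgue_on \<Omega>) = 0"
    using int by (subst Bochner_Integration.integral_cong[OF refl, of _ _ "\<lambda>x. \<Sum>i\<in>UNIV. F' i x (axis i 1)"]) auto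
  then have "(\<integral>x. w x * laplacian v x \<partial>lebesgue_on \<Omega>) + \<Lambda> * (\<integral>x. w x * v x \<partial>lebesgue_on \<Omega>) = 0"
    using i1 i2 by simp
  then show ?thesis by (simp add: L2_inner_def mult.assoc)
qed

text \<open>\<open>w * grad (\<phi> / w)\<close>; integrating the square of its length gives Jacobi's identity.\<close>

definition jacobi :: "'n \<Rightarrow> (real ^ 'n \<Rightarrow> real) \<Rightarrow> real ^ 'n \<Rightarrow> real" where
  "jacobi i \<phi> x = partial i \<phi> x - \<phi> x * W i x / w x"

lemma w_ne: "x \<in> \<Omega> \<Longrightarrow> w x \<noteq> 0"
  using w_pos by force

lemma jacobi_cont:
  assumes "\<phi> \<in> test_functions \<Omega>" shows "continuous_on \<Omega> (jacobi i \<phi>)"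
  unfolding jacobi_def[abs_def] using w_ne
  by (intro continuous_intros w_cont W_cont continuous_on_subset[OF test_functions_smooth(3)[OF assms]]
      continuous_on_subset[OF test_functions_smooth(4)[OF assms]]) auto

text \<open>The field (\<phi>^2 / w) grad w has compact support, and its divergence is |grad
  \<phi>|^2 - \<Lambda> \<phi>^2 - |w grad (\<phi> / w)|^2.\<close>

lemma jacobi_identity:
  assumes \<phi>: "\<phi> \<in> test_functions \<Omega>"
  shows "integrable (lebesgue_on \<Omega>) (\<lambda>x. \<Sum>i\<in>UNIV. (jacobi i \<phi> x)\<^sup>2)"
    "dirichlet_form \<Omega> \<phi> \<phi> - \<Lambda> * L2_inner \<Omega> \<phi> \<phi> = (\<integral>x. (\<Sum>i\<in>UNIV. (jacobi i \<phi> x)\<^sup>2) \<partial>lebesgue_on \<Omega>)"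
proof -
  obtain K where K: "compact K" "K \<subseteq> \<Omega>" "\<And>x. x \<notin> K \<Longrightarrow> \<phi> x = 0"
    using test_functions_support[OF \<phi>] by auto
  note s = test_functions_smooth[OF \<phi>]
  have z: "partial i \<phi> x = 0" if "x \<notin> K" for i x
    by (rule partial_eq_0[OF compact_imp_closed[OF K(1)] K(3) that])
  show i3: "integrable (lebesgue_on \<Omega>) (\<lambda>x. \<Sum>i\<in>UNIV. (jacobi i \<phi> x)\<^sup>2)"
    by (rule integrable_continuous_compact_support[OF \<Omega> K(1,2)])
      (auto simp: K(3) z jacobi_def intro!: continuous_intros jacobi_cont[OF \<phi>, unfolded jacobi_def[abs_def]])
  define F' where "F' i x h = (\<phi> x * \<phi> x) * ((W' i x h * w x - W i x * (\<Sum>j\<in>UNIV. h $ j * W j x)) / (w x * w x))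
     + (\<phi> x * (\<Sum>j\<in>UNIV. h $ j * partial j \<phi> x) + (\<Sum>j\<in>UNIV. h $ j * partial j \<phi> x) * \<phi> x) * (W i x / w x)" for i x h
  have F': "((\<lambda>x. (\<phi> x * \<phi> x) * (W i x / w x)) has_derivative F' i x) (at x)" if "x \<in> \<Omega>" for i x
    unfolding F'_def by (intro has_derivative_divide' has_derivative_mult has_derivative_partial s w_deriv[OF that] W_deriv[OF that] w_ne[OF that])
  have F'_ax: "F' i x (axis i 1) = (\<phi> x)\<^sup>2 * W' i x (axis i 1) / w x + (partial i \<phi> x)\<^sup>2 - (jacobi i \<phi> x)\<^sup>2"
    if "x \<in> \<Omega>" for i x
    using w_ne[OF that] unfolding F'_def sum_axis jacobi_def by (simp add: field_simps power2_eq_square)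
  have c: "continuous_on \<Omega> (\<lambda>x. F' i x (axis i 1))" for i
  proof -
    have "continuous_on \<Omega> (\<lambda>x. (\<phi> x)\<^sup>2 * W' i x (axis i 1) / w x + (partial i \<phi> x)\<^sup>2 - (jacobi i \<phi> x)\<^sup>2)"
      using w_ne by (intro continuous_intros w_cont W'_cont jacobi_cont \<phi> continuous_on_subset[OF s(4)] continuous_on_subset[OF s(3)]) auto
    then show ?thesis using F'_ax continuous_on_cong[of \<Omega> \<Omega>] by fastforce
  qed
  have int: "(\<integral>x. (\<Sum>i\<in>UNIV. F' i x (axis i 1)) \<partial>lebesgue_on \<Omega>) = 0"
    by (rule integral_divergence_eq_0[OF \<Omega> K(1,2) F' c]) (use K(3) in auto)
  have i1: "integrable (lebesgue_on \<Omega>) (\<lambda>x. \<Sum>i\<in>UNIV. partial i \<phi> x * partial i \<phi> x)"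
    by (rule dirichlet_form_integrable[OF \<Omega> \<phi> \<phi>])
  have i2: "integrable (lebesgue_on \<Omega>) (\<lambda>x. \<phi> x * \<phi> x)"
    using test_functions_L2(1)[OF \<Omega> \<phi>] by (intro L2_mult_integrable)
  have "(\<Sum>i\<in>UNIV. F' i x (axis i 1)) = (\<Sum>i\<in>UNIV. partial i \<phi> x * partial i \<phi> x) - \<Lambda> * (\<phi> x * \<phi> x) - (\<Sum>i\<in>UNIV. (jacobi i \<phi> x)\<^sup>2)"
    if "x \<in> \<Omega>" for x
  proof -
    have "(\<Sum>i\<in>UNIV. F' i x (axis i 1)) = (\<phi> x)\<^sup>2 / w x * (\<Sum>i\<in>UNIV. W' i x (axis i 1)) + (\<Sum>i\<in>UNIV. partial i \<phi> x * partial i \<phi> x) - (\<Sum>i\<in>UNIV. (jacobi i \<phi> x)\<^sup>2)"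
      by (simp add: F'_ax[OF that] sum.distrib sum_subtractf sum_distrib_left power2_eq_square)
    then show ?thesis unfolding equation[OF that] using w_ne[OF that] by (simp add: power2_eq_square)
  qed
  then have "(\<integral>x. (\<Sum>i\<in>UNIV. partial i \<phi> x * partial i \<phi> x) - \<Lambda> * (\<phi> x * \<phi> x) - (\<Sum>i\<in>UNIV. (jacobi i \<phi> x)\<^sup>2) \<partial>lebesgue_on \<Omega>) = 0"
    using int by (subst Bochner_Integration.integral_cong[OF refl, of _ _ "\<lambda>x. \<Sum>i\<in>UNIV. F' i x (axis i 1)"]) auto
  then have "(\<integral>x. (\<Sum>i\<in>UNIV. partial i \<phi> x * partial i \<phi> x) \<partial>lebesgue_on \<Omega>) - \<Lambda> * (\<integral>x. \<phi> x * \<phi> x \<partial>lebesgue_on \<Omega>)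
     - (\<integral>x. (\<Sum>i\<in>UNIV. (jacobi i \<phi> x)\<^sup>2) \<partial>lebesgue_on \<Omega>) = 0"
    using i1 i2 i3 by simp
  then show "dirichlet_form \<Omega> \<phi> \<phi> - \<Lambda> * L2_inner \<Omega> \<phi> \<phi> = (\<integral>x. (\<Sum>i\<in>UNIV. (jacobi i \<phi> x)\<^sup>2) \<partial>lebesgue_on \<Omega>)"
    by (simp add: dirichlet_form_def L2_inner_def)
qed

lemma eigenvalue_ge:
  assumes "eigenvalue \<Omega> \<mu>"
  shows "\<Lambda> \<le> \<mu>"
proof -
  obtain u where u: "eigenfunction \<Omega> \<mu> u" using assms by (auto simp: eigenvalue_def)
  from eigenfunction_approximation[OF \<Omega> u] obtain \<phi> :: "nat \<Rightarrow> real ^ 'n \<Rightarrow> real" where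
    "\<forall>k. \<phi> k \<in> test_functions \<Omega>"
    and lim: "(\<lambda>k. L2_inner \<Omega> (\<phi> k) (\<phi> k)) \<longlonglongrightarrow> L2_inner \<Omega> u u"
    "(\<lambda>k. dirichlet_form \<Omega> (\<phi> k) (\<phi> k)) \<longlonglongrightarrow> \<mu> * L2_inner \<Omega> u u"
    by (elim exE conjE)
  then have \<phi>: "\<phi> k \<in> test_functions \<Omega>" for k by simp
  have "(\<lambda>k. dirichlet_form \<Omega> (\<phi> k) (\<phi> k) - \<Lambda> * L2_inner \<Omega> (\<phi> k) (\<phi> k)) \<longlonglongrightarrow> \<mu> * L2_inner \<Omega> u u - \<Lambda> * L2_inner \<Omega> u u"
    by (intro tendsto_intros lim)
  moreover have "0 \<le> dirichlet_form \<Omega> (\<phi> k) (\<phi> k) - \<Lambda> * L2_inner \<Omega> (\<phi> k) (\<phi> k)" for k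
    unfolding jacobi_identity(2)[OF \<phi>] by (intro Bochner_Integration.integral_nonneg sum_nonneg) simp
  ultimately have "0 \<le> \<mu> * L2_inner \<Omega> u u - \<Lambda> * L2_inner \<Omega> u u"
    by (intro LIMSEQ_le_const) auto
  moreover have "L2_inner \<Omega> u u > 0"
  proof -
    have uL: "u \<in> L2 \<Omega>" and nz: "\<not> (AE x in lebesgue_on \<Omega>. u x = 0)"
      using u by (auto simp: eigenfunction_def dirichlet_laplacian_def friedrichs_extension_def energy_space_def)
    have "L2_inner \<Omega> u u = 0 \<longleftrightarrow> (AE x in lebesgue_on \<Omega>. u x * u x = 0)"
      unfolding L2_inner_def by (intro integral_nonneg_eq_0_iff_AE L2_mult_integrable uL) auto
    then have "L2_inner \<Omega> u u \<noteq> 0" using nz by simp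
    then show ?thesis using L2_inner_ge_0[of \<Omega> u] by linarith
  qed
  ultimately show ?thesis by (simp add: left_diff_distrib[symmetric] zero_le_mult_iff)
qed

end


section \<open>Simplicity\<close>

text \<open>The mean of f' over [0, 1] is e = f 1 - f 0, and its variance is nonnegative. Values in
  \<open>ennreal\<close> allow an exchange of integrals later without checking
  integrability.\<close>

lemma square_increment_le_nn_integral:
  fixes f f' :: "real \<Rightarrow> real"
  assumes d: "\<And>t. 0 \<le> t \<Longrightarrow> t \<le> 1 \<Longrightarrow> (f has_real_derivative f' t) (at t)"
    and c: "\<And>t. 0 \<le> t \<Longrightarrow> t \<le> 1 \<Longrightarrow> isCont f' t"
  shows "ennreal ((f 1 - f 0)\<^sup>2) \<le> (\<integral>\<^sup>+t. ennreal ((f' t)\<^sup>2 * indicator {0..1} t) \<partial>lborel)"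
proof -
  define e where "e = f 1 - f 0"
  have cont: "continuous_on {0..1} f'"
    by (rule continuous_at_imp_continuous_on) (use c in auto)
  have b: "has_bochner_integral lborel (\<lambda>t. f' t * indicator {0..1} t) e"
    unfolding e_def by (rule has_bochner_integral_FTC_Icc_real[OF _ d c]) auto
  have i2: "integrable lborel (\<lambda>t. (f' t)\<^sup>2 * indicator {0..1} t)"
    using borel_integrable_compact[of "{0..1}" "\<lambda>t. (f' t)\<^sup>2"] cont
    by (auto intro!: continuous_intros simp: mult.commute)
  have i0: "integrable lborel (\<lambda>t. indicator {0..1::real} t :: real)" "(\<integral>t. indicator {0..1::real} t \<partial>lborel) = (1::real)"
    by auto
  have "0 \<le> (\<integral>t. (f' t - e)\<^sup>2 * indicator {0..1} t \<partial>lborel)"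
    by (intro Bochner_Integration.integral_nonneg) simp
  also have "(\<lambda>t. (f' t - e)\<^sup>2 * indicator {0..1} t) =
      (\<lambda>t. (f' t)\<^sup>2 * indicator {0..1} t - 2 * e * (f' t * indicator {0..1} t) + e\<^sup>2 * indicator {0..1} t)"
    by (auto simp: power2_diff algebra_simps)
  also have "(\<integral>t. (f' t)\<^sup>2 * indicator {0..1} t - 2 * e * (f' t * indicator {0..1} t) + e\<^sup>2 * indicator {0..1} t \<partial>lborel)
      = (\<integral>t. (f' t)\<^sup>2 * indicator {0..1} t \<partial>lborel) - 2 * e * e + e\<^sup>2 * 1"
    using i2 i0 b by (simp add: has_bochner_integral_iff)
  finally have "e\<^sup>2 \<le> (\<integral>t. (f' t)\<^sup>2 * indicator {0..1} t \<partial>lborel)"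
    by (simp add: power2_eq_square)
  then have "ennreal (e\<^sup>2) \<le> ennreal (\<integral>t. (f' t)\<^sup>2 * indicator {0..1} t \<partial>lborel)"
    by (rule ennreal_leI)
  also have "\<dots> = (\<integral>\<^sup>+t. ennreal ((f' t)\<^sup>2 * indicator {0..1} t) \<partial>lborel)"
    by (rule nn_integral_eq_integral[symmetric, OF i2]) simp
  finally show ?thesis by (simp add: e_def)
qed

section \<open>Functions almost everywhere invariant under small translations\<close>

lemma AE_lborel_obtain_in_ball:
  fixes z :: "'a::euclidean_space"
  assumes "AE x in lborel. P x" "r > 0"
  shows "\<exists>x\<in>ball z r. P x"
proof (rule ccontr)
  assume "\<not> ?thesis"
  then have "AE x in lborel. x \<notin> ball z r" using assms(1) by (auto elim: AE_mp)
  then have "ball z r \<in> null_sets lborel" by (subst AE_iff_null_sets) auto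
  then have "measure lborel (ball z r) = 0" by (simp add: measure_def null_setsD1)
  then show False using content_ball_pos[OF assms(2), of z] by simp
qed

text \<open>Fubini exchanges the quantifiers: for almost every x the identity holds for almost every
  h. One such x near z is fixed, and y = x + h then covers the ball; the radius \<delta> / 2 for x
  and y keeps y - x within \<delta>.\<close>

lemma AE_constant_of_translations:
  fixes g :: "'a::euclidean_space \<Rightarrow> real"
  assumes g[measurable]: "g \<in> borel_measurable borel" and "\<delta> > 0"
    and tr: "\<And>h. h \<in> ball 0 \<delta> \<Longrightarrow> AE x in lborel. x \<in> ball z \<delta> \<longrightarrow> g (h + x) = g x"
  shows "\<exists>c. AE y in lborel. y \<in> ball z (\<delta> / 2) \<longrightarrow> g y = c"
proof -
  have "AE h in lborel. AE x in lborel. h \<in> ball 0 \<delta> \<and> x \<in> ball z \<delta> \<longrightarrow> g (h + x) = g x"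
  proof (rule AE_I2)
    show "AE x in lborel. h \<in> ball 0 \<delta> \<and> x \<in> ball z \<delta> \<longrightarrow> g (h + x) = g x" for h
      by (cases "h \<in> ball 0 \<delta>") (use tr[of h] in simp_all)
  qed
  moreover have "{p \<in> space (lborel \<Otimes>\<^sub>M lborel). fst p \<in> ball 0 \<delta> \<and> snd p \<in> ball z \<delta> \<longrightarrow> g (fst p + snd p) = g (snd p)}
      \<in> sets (lborel \<Otimes>\<^sub>M lborel)"
  proof -
    let ?M = "lborel \<Otimes>\<^sub>M lborel :: ('a \<times> 'a) measure"
    have f: "fst \<in> borel_measurable ?M" and s: "snd \<in> borel_measurable ?M"
      using measurable_fst[of lborel lborel] measurable_snd[of lborel lborel] by simp_all
    have gf: "(\<lambda>p. g (fst p + snd p)) \<in> borel_measurable ?M" and gs: "(\<lambda>p. g (snd p)) \<in> borel_measurable ?M"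
      by (rule measurable_compose[OF _ g], intro borel_measurable_add f s)
        (rule measurable_compose[OF s g])
    have b: "{p \<in> space ?M. fst p \<in> ball 0 \<delta>} \<in> sets ?M" "{p \<in> space ?M. snd p \<in> ball z \<delta>} \<in> sets ?M"
      using measurable_sets[OF f, of "ball 0 \<delta>"] measurable_sets[OF s, of "ball z \<delta>"]
      by (simp_all add: vimage_def Int_def conj_commute)
    show ?thesis
      by (intro sets.sets_Collect_imp sets.sets_Collect_conj b borel_measurable_eq gf gs)
  qed
  ultimately have "AE x in lborel. AE h in lborel. h \<in> ball 0 \<delta> \<and> x \<in> ball z \<delta> \<longrightarrow> g (h + x) = g x"
    using lborel_pair.AE_commute[of "\<lambda>h x. h \<in> ball 0 \<delta> \<and> x \<in> ball z \<delta> \<longrightarrow> g (h + x) = g x"] by blast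
  then obtain x where x: "x \<in> ball z (\<delta> / 2)"
    and ae: "AE h in lborel. h \<in> ball 0 \<delta> \<and> x \<in> ball z \<delta> \<longrightarrow> g (h + x) = g x"
    using AE_lborel_obtain_in_ball[of _ "\<delta> / 2" z] \<open>\<delta> > 0\<close> by (metis (no_types, lifting) half_gt_zero)
  have m: "{y \<in> space borel. y - x \<in> ball 0 \<delta> \<and> x \<in> ball z \<delta> \<longrightarrow> g y = g x} \<in> sets borel"
  proof -
    have "{y \<in> space borel. y - x \<in> ball 0 \<delta>} \<in> sets borel"
      using open_ball[of x \<delta>] by (simp add: ball_def dist_norm norm_minus_commute)
    moreover have "{y \<in> space borel. g y = g x} \<in> sets borel"
      by (intro borel_measurable_eq g) simp
    ultimately show ?thesis by (intro sets.sets_Collect_imp sets.sets_Collect_conj) simp_all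
  qed
  have "AE y in distr lborel borel ((+) x). y - x \<in> ball 0 \<delta> \<and> x \<in> ball z \<delta> \<longrightarrow> g y = g x"
    by (subst AE_distr_iff[OF _ m]) (use ae in \<open>auto simp: add.commute\<close>)
  then have "AE y in lborel. y - x \<in> ball 0 \<delta> \<and> x \<in> ball z \<delta> \<longrightarrow> g y = g x"
    by (simp only: lborel_distr_plus)
  moreover have "y - x \<in> ball 0 \<delta> \<and> x \<in> ball z \<delta>" if "y \<in> ball z (\<delta> / 2)" for y
  proof -
    have "dist x y < \<delta>" using x that dist_triangle_half_l[of x z \<delta> y] by (simp add: dist_commute)
    moreover have "dist z x < \<delta>" using x \<open>\<delta> > 0\<close> by simp
    ultimately show ?thesis by (simp add: dist_norm norm_minus_commute)
  qed
  ultimately have "AE y in lborel. y \<in> ball z (\<delta> / 2) \<longrightarrow> g y = g x"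
    by (auto elim: AE_mp)
  then show ?thesis by blast
qed

text \<open>Balls that overlap meet in a set of positive measure, so their constants agree and
  depend on z in a locally constant way. Lindelof's theorem leaves only countably many exceptional
  null sets.\<close>

lemma AE_constant_on_connected:
  fixes g :: "'a::euclidean_space \<Rightarrow> real"
  assumes "connected \<Omega>"
    and loc: "\<And>z. z \<in> \<Omega> \<Longrightarrow> \<exists>e>0. \<exists>c. ball z e \<subseteq> \<Omega> \<and> (AE y in lborel. y \<in> ball z e \<longrightarrow> g y = c)"
  shows "\<exists>c. AE y in lborel. y \<in> \<Omega> \<longrightarrow> g y = c"
proof -
  obtain e c where e: "\<And>z. z \<in> \<Omega> \<Longrightarrow> e z > 0" "\<And>z. z \<in> \<Omega> \<Longrightarrow> ball z (e z) \<subseteq> \<Omega>"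
    and c: "\<And>z. z \<in> \<Omega> \<Longrightarrow> AE y in lborel. y \<in> ball z (e z) \<longrightarrow> g y = c z"
    using loc by metis
  have loc_const: "c z' = c z" if z: "z \<in> \<Omega>" "z' \<in> ball z (e z)" for z z'
  proof -
    have z': "z' \<in> \<Omega>" using e(2)[OF z(1)] z(2) by blast
    have "open (ball z (e z) \<inter> ball z' (e z'))" by auto
    moreover have "z' \<in> ball z (e z) \<inter> ball z' (e z')" using z(2) e(1)[OF z'] by auto
    ultimately obtain r where r: "r > 0" "ball z' r \<subseteq> ball z (e z) \<inter> ball z' (e z')"
      using open_contains_ball by blast
    have "AE y in lborel. (y \<in> ball z (e z) \<longrightarrow> g y = c z) \<and> (y \<in> ball z' (e z') \<longrightarrow> g y = c z')"
      using c[OF z(1)] c[OF z'] by eventually_elim auto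
    then obtain y where "y \<in> ball z' r" "(y \<in> ball z (e z) \<longrightarrow> g y = c z) \<and> (y \<in> ball z' (e z') \<longrightarrow> g y = c z')"
      using AE_lborel_obtain_in_ball[OF _ r(1)] by blast
    then show ?thesis using r(2) by auto
  qed
  have "c constant_on \<Omega>"
  proof (rule locally_constant_imp_constant[OF assms(1)])
    fix a assume a: "a \<in> \<Omega>"
    have "openin (top_of_set \<Omega>) (ball a (e a))"
      by (rule openin_open_Int[OF open_ball, of \<Omega> a "e a", unfolded Int_absorb1[OF e(2)[OF a]]])
    then show "\<exists>T. openin (top_of_set \<Omega>) T \<and> a \<in> T \<and> (\<forall>x\<in>T. c x = c a)"
    proof (intro exI conjI ballI)
      show "a \<in> ball a (e a)" using e(1)[OF a] by simp
      show "c x = c a" if "x \<in> ball a (e a)" for x by (rule loc_const[OF a that])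
    qed
  qed
  then obtain C where C: "\<And>z. z \<in> \<Omega> \<Longrightarrow> c z = C" by (auto simp: constant_on_def)
  obtain F where F: "F \<subseteq> (\<lambda>z. ball z (e z)) ` \<Omega>" "countable F" "\<Union>F = (\<Union>z\<in>\<Omega>. ball z (e z))"
    using Lindelof[of "(\<lambda>z. ball z (e z)) ` \<Omega>"] by auto
  have "AE y in lborel. \<forall>S\<in>F. y \<in> S \<longrightarrow> g y = C"
    unfolding AE_ball_countable[OF F(2)]
  proof
    fix S assume "S \<in> F"
    then obtain z where z: "z \<in> \<Omega>" "S = ball z (e z)" using F(1) by auto
    show "AE y in lborel. y \<in> S \<longrightarrow> g y = C" unfolding z(2) using c[OF z(1)] C[OF z(1)] by simp
  qed
  moreover have "\<exists>S\<in>F. y \<in> S" if "y \<in> \<Omega>" for y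
    using F(3) that e(1)[OF that] by (metis UN_I Union_iff centre_in_ball)
  ultimately have "AE y in lborel. y \<in> \<Omega> \<longrightarrow> g y = C"
    by (auto elim!: AE_mp)
  then show ?thesis by blast
qed

section \<open>Translations of \<phi> / w\<close>

context positive_solution
begin

text \<open>Along the segment from x to x + h, \<phi> / w has the derivative (h \<bullet> J) / w,
  where J is the vector of the \<open>jacobi i \<phi>\<close>. Cauchy-Schwarz bounds its square by
  (\<delta> / m)^2 |J|^2, and after integration over x every t contributes the same amount. The
  doubled radius keeps the segments where w \<ge> m.\<close>

lemma translation_estimate:
  assumes \<phi>: "\<phi> \<in> test_functions \<Omega>" and z: "cball z (2 * \<delta>) \<subseteq> \<Omega>"
    and m: "m > 0" "\<And>x. x \<in> cball z (2 * \<delta>) \<Longrightarrow> m \<le> w x" and h: "norm h < \<delta>"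
  shows "(\<integral>\<^sup>+x. ennreal ((\<phi> (h + x) / w (h + x) - \<phi> x / w x)\<^sup>2 * indicator (ball z \<delta>) x) \<partial>lborel)
    \<le> ennreal ((\<delta> / m)\<^sup>2 * (\<integral>x. (\<Sum>i\<in>UNIV. (jacobi i \<phi> x)\<^sup>2) \<partial>lebesgue_on \<Omega>))"
proof -
  \<comment> \<open>Extended by zero, so that its integral over the whole space is invariant under
    the shift by t h.\<close>
  define Q where "Q x = indicator \<Omega> x *\<^sub>R (\<Sum>i\<in>UNIV. (jacobi i \<phi> x)\<^sup>2)" for x
  define C where "C = (\<delta> / m)\<^sup>2"
  have C0: "C \<ge> 0" by (simp add: C_def)
  have Q0: "Q x \<ge> 0" for x by (simp add: Q_def sum_nonneg)
  have Qm[measurable]: "Q \<in> borel_measurable borel"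
    unfolding Q_def[abs_def] using \<Omega>
    by (intro borel_measurable_continuous_on_indicator continuous_intros jacobi_cont \<phi>) auto
  have q1: "integrable lborel Q" "integral\<^sup>L lborel Q = (\<integral>x. (\<Sum>i\<in>UNIV. (jacobi i \<phi> x)\<^sup>2) \<partial>lebesgue_on \<Omega>)"
  proof -
    have o: "\<Omega> \<in> sets borel" using \<Omega> by simp
    have z0: "Q x = 0" if "x \<notin> \<Omega>" for x using that by (simp add: Q_def)
    have e: "integrable (lebesgue_on \<Omega>) Q \<longleftrightarrow> integrable (lebesgue_on \<Omega>) (\<lambda>x. \<Sum>i\<in>UNIV. (jacobi i \<phi> x)\<^sup>2)"
      "integral\<^sup>L (lebesgue_on \<Omega>) Q = (\<integral>x. (\<Sum>i\<in>UNIV. (jacobi i \<phi> x)\<^sup>2) \<partial>lebesgue_on \<Omega>)"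
      by (intro Bochner_Integration.integrable_cong Bochner_Integration.integral_cong refl; simp add: Q_def)+
    show "integrable lborel Q" "integral\<^sup>L lborel Q = (\<integral>x. (\<Sum>i\<in>UNIV. (jacobi i \<phi> x)\<^sup>2) \<partial>lebesgue_on \<Omega>)"
      using integral_lebesgue_on_eq_lborel[OF o Qm z0] e jacobi_identity(1)[OF \<phi>] by auto
  qed
  have pointwise: "ennreal ((\<phi> (h + x) / w (h + x) - \<phi> x / w x)\<^sup>2 * indicator (ball z \<delta>) x)
      \<le> (\<integral>\<^sup>+t. ennreal (C * Q (t *\<^sub>R h + x)) * indicator {0..1} t \<partial>lborel)" for x
  proof (cases "x \<in> ball z \<delta>")
    case True
    have seg: "t *\<^sub>R h + x \<in> cball z (2 * \<delta>)" if "0 \<le> t" "t \<le> 1" for t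
    proof -
      have "norm (t *\<^sub>R h) \<le> norm h" using that by (simp add: mult_left_le_one_le)
      then have "norm (t *\<^sub>R h + x - z) \<le> 2 * \<delta>"
        using norm_triangle_ineq[of "t *\<^sub>R h" "x - z"] True h by (simp add: dist_norm norm_minus_commute algebra_simps)
      then show ?thesis by (simp add: dist_norm norm_minus_commute)
    qed
    define f where "f t = \<phi> (t *\<^sub>R h + x) / w (t *\<^sub>R h + x)" for t
    define f' where "f' t = (\<Sum>i\<in>UNIV. h $ i * jacobi i \<phi> (t *\<^sub>R h + x)) / w (t *\<^sub>R h + x)" for t
    have d: "(f has_real_derivative f' t) (at t)" if t: "0 \<le> t" "t \<le> 1" for t
    proof -
      let ?y = "t *\<^sub>R h + x"
      have y: "?y \<in> \<Omega>" using seg[OF t] z by blast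
      have "((\<lambda>y. \<phi> y / w y) has_derivative (\<lambda>k. ((\<Sum>i\<in>UNIV. k $ i * partial i \<phi> ?y) * w ?y - \<phi> ?y * (\<Sum>i\<in>UNIV. k $ i * W i ?y)) / (w ?y * w ?y))) (at ?y)"
        by (intro has_derivative_divide' has_derivative_partial test_functions_smooth(1)[OF \<phi>] w_deriv y w_ne)
      moreover have "((\<lambda>t. t *\<^sub>R h + x) has_derivative (\<lambda>k. k *\<^sub>R h)) (at t)"
        by (auto intro!: derivative_eq_intros)
      ultimately have "(f has_derivative (\<lambda>k. ((\<Sum>i\<in>UNIV. (k *\<^sub>R h) $ i * partial i \<phi> ?y) * w ?y - \<phi> ?y * (\<Sum>i\<in>UNIV. (k *\<^sub>R h) $ i * W i ?y)) / (w ?y * w ?y))) (at t)"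
        unfolding f_def by (rule has_derivative_compose[rotated])
      moreover have "((\<Sum>i\<in>UNIV. (k *\<^sub>R h) $ i * partial i \<phi> ?y) * w ?y - \<phi> ?y * (\<Sum>i\<in>UNIV. (k *\<^sub>R h) $ i * W i ?y)) / (w ?y * w ?y) = f' t * k" for k
      proof -
        have eq: "(\<Sum>i\<in>UNIV. h $ i * jacobi i \<phi> ?y) = (\<Sum>i\<in>UNIV. h $ i * partial i \<phi> ?y) - \<phi> ?y * (\<Sum>i\<in>UNIV. h $ i * W i ?y) / w ?y"
          by (simp add: jacobi_def right_diff_distrib sum_subtractf sum_distrib_left sum_divide_distrib mult_ac)
        show ?thesis unfolding f'_def eq using w_ne[OF y]
          by (simp add: sum_distrib_left[symmetric] mult.assoc field_simps)
      qed
      ultimately show ?thesis by (simp add: has_field_derivative_def)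
    qed
    have c: "isCont f' t" if t: "0 \<le> t" "t \<le> 1" for t
    proof -
      let ?y = "t *\<^sub>R h + x"
      have y: "?y \<in> \<Omega>" using seg[OF t] z by blast
      have "isCont (\<lambda>y. (\<Sum>i\<in>UNIV. h $ i * jacobi i \<phi> y) / w y) ?y"
        by (intro continuous_intros continuous_on_interior[OF jacobi_cont[OF \<phi>]] continuous_on_interior[OF w_cont] w_ne y)
          (use y \<Omega> in \<open>simp_all add: interior_open\<close>)
      moreover have "isCont (\<lambda>t. t *\<^sub>R h + x) t" by (intro continuous_intros)
      ultimately show ?thesis unfolding f'_def by (rule isCont_o2[rotated])
    qed
    have bd: "(f' t)\<^sup>2 * indicator {0..1} t \<le> C * Q (t *\<^sub>R h + x) * indicator {0..1} t" for t
    proof (cases "t \<in> {0..1}")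
      case True
      let ?y = "t *\<^sub>R h + x"
      have t: "0 \<le> t" "t \<le> 1" using True by auto
      have y: "?y \<in> \<Omega>" using seg[OF t] z by blast
      let ?v = "(\<chi> i. jacobi i \<phi> ?y)"
      have cs: "(h \<bullet> ?v)\<^sup>2 \<le> (h \<bullet> h) * (?v \<bullet> ?v)" by (rule Cauchy_Schwarz_ineq)
      have e1: "h \<bullet> ?v = (\<Sum>i\<in>UNIV. h $ i * jacobi i \<phi> ?y)" by (simp add: inner_vec_def)
      have e2: "?v \<bullet> ?v = Q ?y" using y by (simp add: inner_vec_def Q_def power2_eq_square)
      have le: "(h \<bullet> h) * Q ?y \<le> \<delta>\<^sup>2 * Q ?y"
      proof -
        have "h \<bullet> h \<le> \<delta>\<^sup>2" using h by (simp add: dot_square_norm power_mono)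
        then show ?thesis by (rule mult_right_mono) (rule Q0)
      qed
      have n: "(\<Sum>i\<in>UNIV. h $ i * jacobi i \<phi> ?y)\<^sup>2 \<le> \<delta>\<^sup>2 * Q ?y"
        by (rule order_trans[OF cs[unfolded e1 e2] le])
      have "(f' t)\<^sup>2 = (\<Sum>i\<in>UNIV. h $ i * jacobi i \<phi> ?y)\<^sup>2 / (w ?y)\<^sup>2"
        by (simp add: f'_def power_divide)
      also have "\<dots> \<le> (\<delta>\<^sup>2 * Q ?y) / m\<^sup>2"
        using m(1) m(2)[OF seg[OF t]] n Q0[of ?y] by (intro frac_le) (auto intro: power_mono)
      finally show ?thesis using True by (simp add: C_def power_divide)
    qed simp
    have "ennreal ((f 1 - f 0)\<^sup>2) \<le> (\<integral>\<^sup>+t. ennreal ((f' t)\<^sup>2 * indicator {0..1} t) \<partial>lborel)"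
      by (rule square_increment_le_nn_integral[OF d c])
    also have "\<dots> \<le> (\<integral>\<^sup>+t. ennreal (C * Q (t *\<^sub>R h + x) * indicator {0..1} t) \<partial>lborel)"
      by (intro nn_integral_mono ennreal_leI bd)
    also have "\<dots> = (\<integral>\<^sup>+t. ennreal (C * Q (t *\<^sub>R h + x)) * indicator {0..1} t \<partial>lborel)"
      by (intro nn_integral_cong) (auto simp: indicator_def)
    finally show ?thesis using True by (simp add: f_def)
  qed simp
  define K where "K = (\<integral>\<^sup>+x. ennreal (C * Q x) \<partial>lborel)"
  have K: "K = ennreal (C * (\<integral>x. (\<Sum>i\<in>UNIV. (jacobi i \<phi> x)\<^sup>2) \<partial>lebesgue_on \<Omega>))"
    unfolding K_def using q1 C0 Q0 by (subst nn_integral_eq_integral) auto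
  have shift: "(\<integral>\<^sup>+x. ennreal (C * Q (y + x)) \<partial>lborel) = K" for y
  proof -
    have "K = (\<integral>\<^sup>+x. ennreal (C * Q x) \<partial>distr lborel borel ((+) y))" by (simp add: K_def lborel_distr_plus)
    then show ?thesis by (simp add: nn_integral_distr)
  qed
  have "(\<integral>\<^sup>+x. ennreal ((\<phi> (h + x) / w (h + x) - \<phi> x / w x)\<^sup>2 * indicator (ball z \<delta>) x) \<partial>lborel)
     \<le> (\<integral>\<^sup>+x. (\<integral>\<^sup>+t. ennreal (C * Q (t *\<^sub>R h + x)) * indicator {0..1} t \<partial>lborel) \<partial>lborel)"
    by (intro nn_integral_mono pointwise)
  also have "\<dots> = (\<integral>\<^sup>+t. (\<integral>\<^sup>+x. ennreal (C * Q (t *\<^sub>R h + x)) * indicator {0..1} t \<partial>lborel) \<partial>lborel)"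
    by (rule lborel_pair.Fubini') measurable
  also have "\<dots> = (\<integral>\<^sup>+t. K * indicator {0..1::real} t \<partial>lborel)"
    by (intro nn_integral_cong) (simp add: nn_integral_multc shift)
  also have "\<dots> = K" by (simp add: nn_integral_cmult_indicator)
  finally show ?thesis unfolding K C_def .
qed

end


text \<open>Replaces v / w by \<phi> k / w at two points at once; the factor 3 is the number of
  summands.\<close>

lemma square_diff_le_3:
  "(p - q)\<^sup>2 \<le> 3 * (p - a)\<^sup>2 + 3 * (a - b)\<^sup>2 + 3 * (q - b)\<^sup>2" for p q a b :: real
proof -
  have sq: "(x + y + z)\<^sup>2 \<le> 3 * x\<^sup>2 + 3 * y\<^sup>2 + 3 * z\<^sup>2" for x y z :: real
  proof -
    have "3 * x\<^sup>2 + 3 * y\<^sup>2 + 3 * z\<^sup>2 - (x + y + z)\<^sup>2 = (x - y)\<^sup>2 + (y - z)\<^sup>2 + (x - z)\<^sup>2"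
      by (simp add: power2_eq_square algebra_simps)
    moreover have "0 \<le> (x - y)\<^sup>2 + (y - z)\<^sup>2 + (x - z)\<^sup>2" by simp
    ultimately show ?thesis by linarith
  qed
  show ?thesis
    using sq[of "p - a" "a - b" "b - q"] by (simp add: power2_commute[of b q])
qed

context positive_solution
begin

text \<open>A Borel function \<open>v\<close> stands for \<open>u\<close>, which is only Lebesgue
  measurable, so that shifts and product measures can be used. The increments of v / w are
  approximated by those of \<phi> k / w, which \<open>translation_estimate\<close> sends to
  zero.\<close>

lemma eigenfunction_quotient_locally_constant:
  assumes u: "eigenfunction \<Omega> \<Lambda> u" and v[measurable]: "v \<in> borel_measurable borel"
    and uv: "AE x in lebesgue. x \<in> \<Omega> \<longrightarrow> u x = v x" and z: "z \<in> \<Omega>"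
  shows "\<exists>e>0. \<exists>c. ball z e \<subseteq> \<Omega> \<and> (AE y in lborel. y \<in> ball z e \<longrightarrow> v y / (indicator \<Omega> y *\<^sub>R w y) = c)"
proof -
  \<comment> \<open>The indicator makes \<open>g\<close> Borel on the whole space; off \<Omega> it
    is a division by 0, with value 0.\<close>
  define g where "g y = v y / (indicator \<Omega> y *\<^sub>R w y)" for y
  have g[measurable]: "g \<in> borel_measurable borel"
    unfolding g_def[abs_def] using \<Omega>
    by (intro borel_measurable_divide borel_measurable_continuous_on_indicator w_cont v) auto
  have g_eq: "g y = v y / w y" if "y \<in> \<Omega>" for y using that by (simp add: g_def)
  obtain r where r: "r > 0" "cball z r \<subseteq> \<Omega>" using \<Omega> z open_contains_cball by blast
  define \<delta> where "\<delta> = r / 2"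
  have \<delta>: "\<delta> > 0" "cball z (2 * \<delta>) \<subseteq> \<Omega>" using r by (auto simp: \<delta>_def)
  have "\<exists>y\<in>cball z (2 * \<delta>). \<forall>x\<in>cball z (2 * \<delta>). w y \<le> w x"
    by (intro continuous_attains_inf continuous_on_subset[OF w_cont \<delta>(2)]) (use \<delta>(1) in auto)
  then obtain y where y: "y \<in> cball z (2 * \<delta>)" "\<And>x. x \<in> cball z (2 * \<delta>) \<Longrightarrow> w y \<le> w x" by blast
  define m where "m = w y"
  have m: "m > 0" "\<And>x. x \<in> cball z (2 * \<delta>) \<Longrightarrow> m \<le> w x"
    using w_pos[of y] y \<delta>(2) by (auto simp: m_def)
  from eigenfunction_approximation[OF \<Omega> u] obtain \<phi> :: "nat \<Rightarrow> real ^ 'n \<Rightarrow> real" where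
    "\<forall>k. \<phi> k \<in> test_functions \<Omega>"
    and l0: "(\<lambda>k. L2_inner \<Omega> (\<lambda>x. \<phi> k x - u x) (\<lambda>x. \<phi> k x - u x)) \<longlonglongrightarrow> 0"
    and l1: "(\<lambda>k. L2_inner \<Omega> (\<phi> k) (\<phi> k)) \<longlonglongrightarrow> L2_inner \<Omega> u u"
    and l2: "(\<lambda>k. dirichlet_form \<Omega> (\<phi> k) (\<phi> k)) \<longlonglongrightarrow> \<Lambda> * L2_inner \<Omega> u u"
    by (elim exE conjE)
  then have \<phi>: "\<phi> k \<in> test_functions \<Omega>" for k by simp
  have uL: "u \<in> L2 \<Omega>"
    using u by (auto simp: eigenfunction_def dirichlet_laplacian_def friedrichs_extension_def energy_space_def)
  define a where "a k = L2_inner \<Omega> (\<lambda>x. \<phi> k x - u x) (\<lambda>x. \<phi> k x - u x)" for k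
  define b where "b k = (\<integral>x. (\<Sum>i\<in>UNIV. (jacobi i (\<phi> k) x)\<^sup>2) \<partial>lebesgue_on \<Omega>)" for k
  \<comment> \<open>The eigenvalue of u is \<Lambda> itself, so the two limits in Jacobi's identity
    cancel.\<close>
  have b_lim: "b \<longlonglongrightarrow> 0"
  proof -
    have "(\<lambda>k. dirichlet_form \<Omega> (\<phi> k) (\<phi> k) - \<Lambda> * L2_inner \<Omega> (\<phi> k) (\<phi> k)) \<longlonglongrightarrow> \<Lambda> * L2_inner \<Omega> u u - \<Lambda> * L2_inner \<Omega> u u"
      by (intro tendsto_intros l1 l2)
    then show ?thesis unfolding jacobi_identity(2)[OF \<phi>] b_def[symmetric] by simp
  qed
  have b0: "b k \<ge> 0" for k unfolding b_def by (intro Bochner_Integration.integral_nonneg sum_nonneg) simp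
  have a0: "a k \<ge> 0" for k unfolding a_def by (rule L2_inner_ge_0)
  define R where "R k x = indicator \<Omega> x *\<^sub>R (v x - \<phi> k x)\<^sup>2" for k x
  have Rm[measurable]: "R k \<in> borel_measurable borel" for k
  proof -
    have [measurable]: "\<phi> k \<in> borel_measurable borel"
      by (rule borel_measurable_continuous_onI[OF test_functions_smooth(3)[OF \<phi>]])
    have [measurable]: "\<Omega> \<in> sets borel" using \<Omega> by simp
    show ?thesis unfolding R_def[abs_def] by measurable
  qed
  have R_int: "(\<integral>\<^sup>+x. ennreal (R k x) \<partial>lborel) = ennreal (a k)" for k
  proof -
    have s: "\<Omega> \<inter> space lebesgue \<in> sets lebesgue" using \<Omega> by simp
    have dL: "(\<lambda>x. \<phi> k x - u x) \<in> L2 \<Omega>"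
      using L2_combination[OF test_functions_L2(1)[OF \<Omega> \<phi>] uL, of k "-1"] by simp
    have "(\<integral>\<^sup>+x. ennreal (R k x) \<partial>lborel) = (\<integral>\<^sup>+x. ennreal (R k x) \<partial>lebesgue)"
      by (simp add: nn_integral_completion)
    also have "\<dots> = (\<integral>\<^sup>+x. ennreal ((\<phi> k x - u x) * (\<phi> k x - u x)) * indicator \<Omega> x \<partial>lebesgue)"
      by (rule nn_integral_cong_AE, rule AE_mp[OF uv], rule AE_I2)
        (auto simp: R_def indicator_def power2_eq_square algebra_simps)
    also have "\<dots> = (\<integral>\<^sup>+x. ennreal ((\<phi> k x - u x) * (\<phi> k x - u x)) \<partial>lebesgue_on \<Omega>)"
      by (rule nn_integral_restrict_space[OF s, symmetric])
    also have "\<dots> = ennreal (a k)"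
      unfolding a_def L2_inner_def by (intro nn_integral_eq_integral L2_mult_integrable dL) simp
    finally show ?thesis .
  qed
  have tr: "AE x in lborel. x \<in> ball z \<delta> \<longrightarrow> g (h + x) = g x" if h: "h \<in> ball 0 \<delta>" for h
  proof -
    define f where "f x = ennreal ((g (h + x) - g x)\<^sup>2 * indicator (ball z \<delta>) x)" for x
    have fm: "f \<in> borel_measurable lborel"
    proof -
      have s: "(\<lambda>x. h + x) \<in> borel_measurable borel" by simp
      have "f \<in> borel_measurable borel" unfolding f_def[abs_def]
        by (intro measurable_compose[OF _ measurable_ennreal] borel_measurable_times borel_measurable_power
          borel_measurable_diff g measurable_compose[OF s g] borel_measurable_indicator) simp
      then show ?thesis by simp
    qed
    have hn: "norm h < \<delta>" using h by simp
    \<comment> \<open>The outer terms compare v with \<phi> k at x + h and at x, each costing a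
      multiple of \<open>a k\<close> because w \<ge> m; the middle one is
      \<open>translation_estimate\<close>.\<close>
    have fk: "(\<integral>\<^sup>+x. f x \<partial>lborel) \<le> ennreal (3 / m\<^sup>2 * a k + 3 * ((\<delta> / m)\<^sup>2 * b k) + 3 / m\<^sup>2 * a k)" for k
    proof -
      define T where "T x = ennreal ((\<phi> k (h + x) / w (h + x) - \<phi> k x / w x)\<^sup>2 * indicator (ball z \<delta>) x)" for x
      \<comment> \<open>This is \<open>T\<close> with the zero extension of w, from which Borel
        measurability can be seen.\<close>
      define T' where "T' x = ennreal ((\<phi> k (h + x) / (indicator \<Omega> (h + x) *\<^sub>R w (h + x)) - \<phi> k x / (indicator \<Omega> x *\<^sub>R w x))\<^sup>2 * indicator (ball z \<delta>) x)" for x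
      have in\<Omega>: "x \<in> cball z (2 * \<delta>)" "h + x \<in> cball z (2 * \<delta>)" if "x \<in> ball z \<delta>" for x
      proof -
        show "x \<in> cball z (2 * \<delta>)" using that \<delta>(1) by simp
        have "norm (h + (x - z)) \<le> norm h + norm (x - z)" by (rule norm_triangle_ineq)
        then have "norm (h + x - z) \<le> 2 * \<delta>" using that hn by (simp add: dist_norm norm_minus_commute algebra_simps)
        then show "h + x \<in> cball z (2 * \<delta>)" by (simp add: dist_norm norm_minus_commute)
      qed
      have TT': "T = T'"
      proof
        fix x show "T x = T' x"
          using in\<Omega>[of x] \<delta>(2) by (cases "x \<in> ball z \<delta>") (auto simp: T_def T'_def subset_iff)
      qed
      have T'm: "T' \<in> borel_measurable borel"
      proof -
        have p[measurable]: "\<phi> k \<in> borel_measurable borel"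
          by (rule borel_measurable_continuous_onI[OF test_functions_smooth(3)[OF \<phi>]])
        have i[measurable]: "(\<lambda>x. indicator \<Omega> x *\<^sub>R w x) \<in> borel_measurable borel"
          using \<Omega> by (intro borel_measurable_continuous_on_indicator w_cont) auto
        have q: "(\<lambda>x. \<phi> k x / (indicator \<Omega> x *\<^sub>R w x)) \<in> borel_measurable borel"
          by (intro borel_measurable_divide p i)
        have s: "(\<lambda>x. h + x) \<in> borel_measurable borel" by simp
        note q' = measurable_compose[OF s q]
        show ?thesis unfolding T'_def[abs_def]
          by (intro measurable_compose[OF _ measurable_ennreal] borel_measurable_times borel_measurable_power borel_measurable_diff q q' borel_measurable_indicator) simp
      qed
      have le: "f x \<le> ennreal (3 / m\<^sup>2 * R k (h + x)) + 3 * T x + ennreal (3 / m\<^sup>2 * R k x)" for x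
      proof (cases "x \<in> ball z \<delta>")
        case True
        have x: "x \<in> \<Omega>" "h + x \<in> \<Omega>" "m \<le> w x" "m \<le> w (h + x)"
          using in\<Omega>[OF True] \<delta>(2) m(2) by auto
        have q: "(v y / w y - \<phi> k y / w y)\<^sup>2 \<le> R k y / m\<^sup>2" if "y \<in> \<Omega>" "m \<le> w y" for y
        proof -
          have "(v y / w y - \<phi> k y / w y)\<^sup>2 = R k y / (w y)\<^sup>2"
            using that by (simp add: R_def diff_divide_distrib[symmetric] power_divide)
          also have "\<dots> \<le> R k y / m\<^sup>2"
            using that m(1) by (intro divide_left_mono power_mono) (auto simp: R_def intro!: mult_pos_pos zero_less_power w_pos)
          finally show ?thesis .
        qed
        have "(g (h + x) - g x)\<^sup>2 \<le> 3 / m\<^sup>2 * R k (h + x) + 3 * (\<phi> k (h + x) / w (h + x) - \<phi> k x / w x)\<^sup>2 + 3 / m\<^sup>2 * R k x"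
          using square_diff_le_3[of "g (h + x)" "g x" "\<phi> k (h + x) / w (h + x)" "\<phi> k x / w x"]
            q[OF x(2,4)] q[OF x(1,3)] by (simp add: g_eq x)
        then have "f x \<le> ennreal (3 / m\<^sup>2 * R k (h + x) + 3 * (\<phi> k (h + x) / w (h + x) - \<phi> k x / w x)\<^sup>2 + 3 / m\<^sup>2 * R k x)"
          using True by (simp add: f_def ennreal_leI)
        also have "\<dots> = ennreal (3 / m\<^sup>2 * R k (h + x)) + 3 * T x + ennreal (3 / m\<^sup>2 * R k x)"
          using True by (simp add: T_def R_def ennreal_plus ennreal_mult)
        finally show ?thesis .
      qed (simp add: f_def)
      have sh: "(\<integral>\<^sup>+x. ennreal (3 / m\<^sup>2 * R k (h + x)) \<partial>lborel) = (\<integral>\<^sup>+x. ennreal (3 / m\<^sup>2 * R k x) \<partial>lborel)"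
      proof -
        have "(\<integral>\<^sup>+x. ennreal (3 / m\<^sup>2 * R k x) \<partial>lborel) = (\<integral>\<^sup>+x. ennreal (3 / m\<^sup>2 * R k x) \<partial>distr lborel borel ((+) h))"
          by (simp add: lborel_distr_plus)
        then show ?thesis by (simp add: nn_integral_distr)
      qed
      have R3: "(\<integral>\<^sup>+x. ennreal (3 / m\<^sup>2 * R k x) \<partial>lborel) = ennreal (3 / m\<^sup>2 * a k)"
      proof -
        have "(\<integral>\<^sup>+x. ennreal (3 / m\<^sup>2 * R k x) \<partial>lborel) = (\<integral>\<^sup>+x. ennreal (3 / m\<^sup>2) * ennreal (R k x) \<partial>lborel)"
          by (intro nn_integral_cong ennreal_mult) (auto simp: R_def)
        also have "\<dots> = ennreal (3 / m\<^sup>2) * ennreal (a k)"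
          by (subst nn_integral_cmult) (simp_all add: R_int)
        also have "\<dots> = ennreal (3 / m\<^sup>2 * a k)"
          by (rule ennreal_mult[symmetric]) (use a0 in auto)
        finally show ?thesis .
      qed
      have Tb: "(\<integral>\<^sup>+x. 3 * T x \<partial>lborel) \<le> ennreal (3 * ((\<delta> / m)\<^sup>2 * b k))"
      proof -
        have "(\<integral>\<^sup>+x. 3 * T x \<partial>lborel) = 3 * (\<integral>\<^sup>+x. T x \<partial>lborel)"
          by (rule nn_integral_cmult) (use T'm TT' in simp)
        also have "\<dots> \<le> 3 * ennreal ((\<delta> / m)\<^sup>2 * b k)"
          unfolding T_def b_def by (intro mult_left_mono translation_estimate \<phi> \<delta>(2) m hn) auto
        also have "\<dots> = ennreal (3 * ((\<delta> / m)\<^sup>2 * b k))" by (simp add: ennreal_mult')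
        finally show ?thesis .
      qed
      have "(\<integral>\<^sup>+x. f x \<partial>lborel) \<le> (\<integral>\<^sup>+x. ennreal (3 / m\<^sup>2 * R k (h + x)) + 3 * T x + ennreal (3 / m\<^sup>2 * R k x) \<partial>lborel)"
        by (intro nn_integral_mono le)
      also have "\<dots> = (\<integral>\<^sup>+x. ennreal (3 / m\<^sup>2 * R k (h + x)) \<partial>lborel) + (\<integral>\<^sup>+x. 3 * T x \<partial>lborel) + (\<integral>\<^sup>+x. ennreal (3 / m\<^sup>2 * R k x) \<partial>lborel)"
        using T'm by (simp add: nn_integral_add TT')
      also have "\<dots> \<le> ennreal (3 / m\<^sup>2 * a k) + ennreal (3 * ((\<delta> / m)\<^sup>2 * b k)) + ennreal (3 / m\<^sup>2 * a k)"
        unfolding sh R3 by (intro add_mono Tb order_refl)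
      also have "\<dots> = ennreal (3 / m\<^sup>2 * a k + 3 * ((\<delta> / m)\<^sup>2 * b k) + 3 / m\<^sup>2 * a k)"
      proof -
        have n: "0 \<le> 3 / m\<^sup>2 * a k" "0 \<le> 3 * ((\<delta> / m)\<^sup>2 * b k)" using a0[of k] b0[of k] by simp_all
        show ?thesis
          by (simp only: ennreal_plus[OF add_nonneg_nonneg[OF n] n(1)] ennreal_plus[OF n])
      qed
      finally show ?thesis .
    qed
    have "(\<lambda>k. 3 / m\<^sup>2 * a k + 3 * ((\<delta> / m)\<^sup>2 * b k) + 3 / m\<^sup>2 * a k) \<longlonglongrightarrow> 3 / m\<^sup>2 * 0 + 3 * ((\<delta> / m)\<^sup>2 * 0) + 3 / m\<^sup>2 * 0"
      by (intro tendsto_add tendsto_mult tendsto_const l0[folded a_def] b_lim)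
    then have "(\<lambda>k. ennreal (3 / m\<^sup>2 * a k + 3 * ((\<delta> / m)\<^sup>2 * b k) + 3 / m\<^sup>2 * a k)) \<longlonglongrightarrow> ennreal 0"
      by (intro tendsto_ennrealI) simp
    then have "(\<integral>\<^sup>+x. f x \<partial>lborel) \<le> ennreal 0"
      by (rule LIMSEQ_le_const) (use fk in blast)
    then have "(\<integral>\<^sup>+x. f x \<partial>lborel) = 0" by simp
    then have "AE x in lborel. f x = 0" by (subst (asm) nn_integral_0_iff_AE[OF fm])
    then show ?thesis by (rule AE_mp) (intro AE_I2, auto simp: f_def)
  qed
  obtain c where c: "AE y in lborel. y \<in> ball z (\<delta> / 2) \<longrightarrow> g y = c"
    using AE_constant_of_translations[OF g \<delta>(1) tr] by blast
  have "ball z (\<delta> / 2) \<subseteq> \<Omega>" using \<delta> by (auto simp: subset_iff)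
  then show ?thesis using c \<delta>(1) unfolding g_def by (intro exI[of _ "\<delta> / 2"]) auto
qed

lemma eigenfunction_unique:
  assumes "connected \<Omega>" and u: "eigenfunction \<Omega> \<Lambda> u"
  shows "\<exists>c. AE x in lebesgue_on \<Omega>. u x = c * w x"
proof -
  have uL: "u \<in> L2 \<Omega>"
    using u by (auto simp: eigenfunction_def dirichlet_laplacian_def friedrichs_extension_def energy_space_def)
  have s: "\<Omega> \<inter> space lebesgue \<in> sets lebesgue" using \<Omega> by simp
  have "(\<lambda>x. if x \<in> \<Omega> then u x else 0) \<in> borel_measurable lebesgue"
    using uL \<Omega> by (intro borel_measurable_if_I) (auto simp: L2_def)
  \<comment> \<open>A Borel representative of u extended by zero.\<close>
  then obtain v where v: "v \<in> borel_measurable lborel" "AE x in lborel. (if x \<in> \<Omega> then u x else 0) = v x"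
    using completion_ex_borel_measurable_real by blast
  have uv: "AE x in lebesgue. x \<in> \<Omega> \<longrightarrow> u x = v x"
    by (rule AE_mp[OF AE_completion[OF v(2)]]) (intro AE_I2, auto)
  obtain c where c: "AE y in lborel. y \<in> \<Omega> \<longrightarrow> v y / (indicator \<Omega> y *\<^sub>R w y) = c"
    using AE_constant_on_connected[OF assms(1) eigenfunction_quotient_locally_constant[OF u _ uv]] v(1)
    by auto
  have "AE x in lebesgue. x \<in> \<Omega> \<longrightarrow> u x = c * w x"
    using uv AE_completion[OF c]
  proof eventually_elim
    case (elim x)
    then show ?case using w_ne[of x] by (auto simp: field_simps)
  qed
  then show ?thesis by (subst AE_restrict_space_iff[OF s]) blast
qed

end


section \<open>Radial eigenfunctions\<close>

lemma flat_le:
  "0 \<le> flat m t" "flat m t \<le> fact m"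
proof -
  show "0 \<le> flat m t" by (simp add: flat_def)
  show "flat m t \<le> fact m"
  proof (cases "t > 0")
    case True
    have "inverse t ^ m \<le> fact m * exp (inverse t)"
      using True by (intro power_le_fact_exp) auto
    then have "inverse t ^ m / exp (inverse t) \<le> fact m"
      by (simp only: divide_le_eq) simp
    then show ?thesis using True by (simp add: flat_def exp_minus divide_inverse)
  qed (simp add: flat_def)
qed

text \<open>With t = (k + 1) h s - 1, \<open>truncation\<close> is h times flat 0 t, and
  \<open>truncation'\<close> is h1 times flat 0 t + (t + 1) flat 2 t. Both factors tend to 1 as k
  grows.\<close>

lemma flat_limits:
  "((\<lambda>t. flat 0 t) \<longlongrightarrow> 1) at_top" "((\<lambda>t. (t + 1) * flat 2 t) \<longlongrightarrow> 0) at_top"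
proof -
  have ev: "\<forall>\<^sub>F t in at_top. exp (- inverse t) = flat 0 t" "\<forall>\<^sub>F t in at_top. (t + 1) * (inverse t ^ 2 * exp (- inverse t)) = (t + 1) * flat 2 t"
    using eventually_gt_at_top[of 0] by (eventually_elim; simp add: flat_def)+
  have "((\<lambda>t::real. exp (- inverse t)) \<longlongrightarrow> 1) at_top" by real_asymp
  then show "((\<lambda>t. flat 0 t) \<longlongrightarrow> 1) at_top" by (rule Lim_transform_eventually[OF _ ev(1)])
  have "((\<lambda>t::real. (t + 1) * (inverse t ^ 2 * exp (- inverse t))) \<longlongrightarrow> 0) at_top" by real_asymp
  then show "((\<lambda>t. (t + 1) * flat 2 t) \<longlongrightarrow> 0) at_top" by (rule Lim_transform_eventually[OF _ ev(2)])
qed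

text \<open>Domination for the gradients. Since t * flat 2 t = flat 1 t for t > 0, the factor is a
  sum of three terms below 0!, 1! and 2!, whose sum is 4.\<close>

lemma flat_factor_bound: "\<bar>flat 0 t + (t + 1) * flat 2 t - 1\<bar> \<le> 4"
proof (cases "t > 0")
  case True
  then have "t * flat 2 t = flat 1 t" by (simp add: flat_def power2_eq_square)
  then have "(t + 1) * flat 2 t = flat 1 t + flat 2 t" by (simp add: algebra_simps)
  moreover have "flat 0 t \<le> 1" "flat 1 t \<le> 1" "flat 2 t \<le> 2"
    using flat_le(2)[of 0 t] flat_le(2)[of 1 t] flat_le(2)[of 2 t] by simp_all
  ultimately show ?thesis using flat_le(1)[of 0 t] flat_le(1)[of 1 t] flat_le(1)[of 2 t] by linarith
qed (simp add: flat_def)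

text \<open>Bootstrapping: for s > 0 the equation can be solved for h2, so h and h1 gain one
  derivative together.\<close>

lemma radial_ode_D_k:
  assumes "radial_ode \<nu> q h h1 h2"
  shows "D_k k {0<..} h"
proof -
  note d = radial_odeD[OF assms]
  have "D_k k {0<..} h \<and> D_k k {0<..} h1"
  proof (induction k)
    case 0
    have "continuous_on {0<..} h" "continuous_on {0<..} h1"
      by (rule DERIV_continuous_on[OF has_field_derivative_at_within[OF d(1)]]
        DERIV_continuous_on[OF has_field_derivative_at_within[OF d(2)]]; simp)+
    then show ?case by simp
  next
    case (Suc k)
    have "D_k (Suc k) {0<..} h" by (rule D_k_SucI[of _ _ h1]) (use d(1) Suc in auto)
    moreover have "D_k (Suc k) {0<..} h1"
    proof (rule D_k_SucI[of _ _ "\<lambda>s. inverse s * ((- (\<nu> + 1)) * h1 s + (- q / 4) * h s)"])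
      show "(h1 has_real_derivative inverse s * (- (\<nu> + 1) * h1 s + - q / 4 * h s)) (at s)" if "s \<in> {0<..}" for s
      proof -
        have "h2 s = inverse s * (- (\<nu> + 1) * h1 s + - q / 4 * h s)"
          using d(3)[of s] that by (simp add: field_simps)
        then show ?thesis using d(2)[of s] that by simp
      qed
      show "D_k k {0<..} (\<lambda>s. inverse s * ((- (\<nu> + 1)) * h1 s + (- q / 4) * h s))"
        by (intro D_k_mult D_k_add D_k_const D_k_inverse) (use Suc in auto)
    qed
    ultimately show ?case ..
  qed
  then show ?thesis ..
qed

lemma D_k_subset: "D_k k S f \<Longrightarrow> T \<subseteq> S \<Longrightarrow> D_k k T f"
proof (induction k arbitrary: f)
  case (Suc k)
  then obtain f' where "\<And>x. x \<in> S \<Longrightarrow> (f has_real_derivative f' x) (at x)" "D_k k S f'" by auto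
  then show ?case using Suc.IH Suc.prems(2) by (intro D_k_SucI[of _ _ f']) auto
qed (auto intro: continuous_on_subset)

text \<open>The parameters are squared radii, to match profiles in s = x \<bullet> x.\<close>

definition shell :: "real \<Rightarrow> real \<Rightarrow> (real ^ 'n::finite) set" where
  "shell \<alpha> \<beta> = {x. \<alpha> < x \<bullet> x \<and> x \<bullet> x < \<beta>}"

lemma shell_pos: "x \<in> shell \<alpha> \<beta> \<Longrightarrow> 0 < \<alpha> \<Longrightarrow> 0 < x \<bullet> x"
  unfolding shell_def using less_trans[of 0 \<alpha> "x \<bullet> x"] by blast

lemma open_shell: "open (shell \<alpha> \<beta>)"
  unfolding shell_def by (intro open_Collect_conj open_Collect_less continuous_intros)

lemma bounded_shell: "bounded (shell \<alpha> \<beta> :: (real ^ 'n::finite) set)"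
proof -
  have "norm x \<le> max 1 \<beta>" if "x \<in> shell \<alpha> \<beta>" for x :: "real ^ 'n"
  proof (rule ccontr)
    assume n: "\<not> norm x \<le> max 1 \<beta>"
    then have "norm x * 1 \<le> norm x * norm x" by (intro mult_left_mono) auto
    then show False using that n by (auto simp: shell_def dot_square_norm power2_eq_square)
  qed
  then show ?thesis unfolding bounded_iff by blast
qed

lemma lmeasurable_shell: "shell \<alpha> \<beta> \<in> lmeasurable"
  by (rule lmeasurable_open[OF bounded_shell open_shell])

text \<open>The Laplacian of h (x \<bullet> x) is 4 (s h'' + (n / 2) h'), so \<nu> + 1 has to be n /
  2. The parameter \<open>dim\<close> ties the locale to the type \<open>'n\<close>, which the
  profile functions do not mention. As the equation holds for all s > 0, h and h1 stay bounded up to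
  the boundary.\<close>

locale radial_eigenfunction =
  fixes dim :: "'n::finite itself" and \<nu> q \<alpha> \<beta> :: real and h h1 h2 :: "real \<Rightarrow> real"
  assumes ode: "radial_ode \<nu> q h h1 h2" and nu: "real CARD('n) = 2 * (\<nu> + 1)"
    and \<alpha>: "0 < \<alpha>" "\<alpha> < \<beta>" and h_bd: "h \<alpha> = 0" "h \<beta> = 0"
    and h_pos: "\<And>s. \<alpha> < s \<Longrightarrow> s < \<beta> \<Longrightarrow> h s > 0"
begin

abbreviation "\<Omega> \<equiv> shell \<alpha> \<beta> :: (real ^ 'n) set"

definition w :: "real ^ 'n \<Rightarrow> real" where "w x = h (x \<bullet> x)"

lemma w_has_derivative:
  assumes "x \<in> \<Omega>"
  shows "(w has_derivative (\<lambda>k. \<Sum>i\<in>UNIV. k $ i * (2 * x $ i * h1 (x \<bullet> x)))) (at x)"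
proof -
  have "x \<bullet> x > 0" by (rule shell_pos[OF assms \<alpha>(1)])
  from has_derivative_radial[OF radial_odeD(1)[OF ode this]]
  have "(w has_derivative (\<lambda>k. 2 * (x \<bullet> k) * h1 (x \<bullet> x))) (at x)" by (simp add: w_def[abs_def])
  moreover have "2 * (x \<bullet> k) * h1 (x \<bullet> x) = (\<Sum>i\<in>UNIV. k $ i * (2 * x $ i * h1 (x \<bullet> x)))" for k
    by (simp add: inner_vec_def sum_distrib_left sum_distrib_right mult_ac)
  ultimately show ?thesis by simp
qed

sublocale positive_solution \<Omega> w "\<lambda>i x. 2 * x $ i * h1 (x \<bullet> x)"
  "\<lambda>i x k. 2 * x $ i * (2 * (x \<bullet> k) * h2 (x \<bullet> x)) + 2 * k $ i * h1 (x \<bullet> x)" q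
proof
  show "open \<Omega>" by (rule open_shell)
  show "w x > 0" if "x \<in> \<Omega>" for x using that h_pos by (simp add: shell_def w_def)
  show "(w has_derivative (\<lambda>k. \<Sum>i\<in>UNIV. k $ i * (2 * x $ i * h1 (x \<bullet> x)))) (at x)" if "x \<in> \<Omega>" for x
    by (rule w_has_derivative[OF that])
  show "((\<lambda>x. 2 * x $ i * h1 (x \<bullet> x)) has_derivative
      (\<lambda>k. 2 * x $ i * (2 * (x \<bullet> k) * h2 (x \<bullet> x)) + 2 * k $ i * h1 (x \<bullet> x))) (at x)" if "x \<in> \<Omega>" for i x
  proof -
    have "x \<bullet> x > 0" by (rule shell_pos[OF that \<alpha>(1)])
    note d = has_derivative_radial[OF radial_odeD(2)[OF ode this]]
    have "((\<lambda>x. x $ i) has_derivative (\<lambda>k. k $ i)) (at x)"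
      by (rule bounded_linear_imp_has_derivative) (rule bounded_linear_vec_nth)
    then show ?thesis by (intro has_derivative_mult[OF has_derivative_mult_right d])
  qed
  show "continuous_on \<Omega> (\<lambda>x. 2 * x $ i * (2 * (x \<bullet> axis i 1) * h2 (x \<bullet> x)) + 2 * axis i 1 $ i * h1 (x \<bullet> x))" for i
  proof -
    have h2: "h2 s = - ((\<nu> + 1) * h1 s + q * h s / 4) / s" if "s > 0" for s
      using radial_odeD(3)[OF ode that] that by (simp add: field_simps)
    have c1: "continuous_on {0<..} h1" and c0: "continuous_on {0<..} h"
      by (rule DERIV_continuous_on[OF has_field_derivative_at_within[OF radial_odeD(2)[OF ode]]]
        DERIV_continuous_on[OF has_field_derivative_at_within[OF radial_odeD(1)[OF ode]]]; simp)+
    have "continuous_on {0<..} (\<lambda>s. - ((\<nu> + 1) * h1 s + q * h s / 4) / s)"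
      by (intro continuous_intros c0 c1) auto
    then have c2: "continuous_on {0<..} h2"
      using h2 continuous_on_cong[of "{0<..}" "{0<..}" h2] by simp
    have sub: "(\<lambda>x. x \<bullet> x) ` \<Omega> \<subseteq> {0<..}"
      by (rule image_subsetI, unfold greaterThan_iff, rule shell_pos[OF _ \<alpha>(1)])
    have cc: "continuous_on \<Omega> (\<lambda>x. f (x \<bullet> x))" if "continuous_on {0<..} f" for f :: "real \<Rightarrow> real"
      by (rule continuous_on_compose2[OF that _ sub]) (intro continuous_intros)
    show ?thesis by (intro continuous_intros cc c1 c2)
  qed
  show "(\<Sum>i\<in>UNIV. 2 * x $ i * (2 * (x \<bullet> axis i 1) * h2 (x \<bullet> x)) + 2 * axis i 1 $ i * h1 (x \<bullet> x)) = - q * w x"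
    if "x \<in> \<Omega>" for x
  proof -
    have s: "x \<bullet> x > 0" by (rule shell_pos[OF that \<alpha>(1)])
    have "(\<Sum>i\<in>UNIV. 2 * x $ i * (2 * (x \<bullet> axis i 1) * h2 (x \<bullet> x)) + 2 * axis i 1 $ i * h1 (x \<bullet> x))
        = (\<Sum>i\<in>UNIV. 4 * h2 (x \<bullet> x) * (x $ i * x $ i)) + (\<Sum>i\<in>(UNIV :: 'n set). 2 * h1 (x \<bullet> x))"
      by (simp add: inner_axis sum.distrib mult_ac)
    also have "\<dots> = 4 * h2 (x \<bullet> x) * (x \<bullet> x) + real CARD('n) * (2 * h1 (x \<bullet> x))"
      by (simp add: inner_vec_def sum_distrib_left)
    also have "\<dots> = 4 * ((x \<bullet> x) * h2 (x \<bullet> x) + (\<nu> + 1) * h1 (x \<bullet> x))"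
      unfolding nu by (simp add: algebra_simps)
    also have "\<dots> = - q * w x"
      using radial_odeD(3)[OF ode s] by (simp add: w_def)
    finally show ?thesis .
  qed
qed

text \<open>Since \<open>flat 0\<close> vanishes to infinite order at zero, \<open>truncation k\<close> is smooth with support in
  \<open>{s. h s \<ge> 1 / (k + 1)}\<close>.\<close>

definition truncation :: "nat \<Rightarrow> real \<Rightarrow> real" where
  "truncation k s = (if s \<in> {\<alpha><..<\<beta>} then h s * flat 0 (real (Suc k) * h s - 1) else 0)"

text \<open>With t = (k + 1) h - 1, the factor (k + 1) h from the chain rule is t + 1; it is left as
  \<open>- 1 + 1\<close> to match \<open>flat_limits\<close> and \<open>flat_factor_bound\<close>.
  The derivative of \<open>flat 0\<close> is \<open>flat 2\<close>.\<close>

definition truncation' :: "nat \<Rightarrow> real \<Rightarrow> real" where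
  "truncation' k s = (if s \<in> {\<alpha><..<\<beta>} then
     h1 s * (flat 0 (real (Suc k) * h s - 1) + (real (Suc k) * h s - 1 + 1) * flat 2 (real (Suc k) * h s - 1)) else 0)"

definition core :: "nat \<Rightarrow> real set" where
  "core k = {s \<in> {\<alpha>..\<beta>}. 1 / real (Suc k) \<le> h s}"

lemma h_cont: "continuous_on {\<alpha>..\<beta>} h" and h1_cont: "continuous_on {\<alpha>..\<beta>} h1"
  by (rule DERIV_continuous_on[OF has_field_derivative_at_within[OF radial_odeD(1)[OF ode]]]
    DERIV_continuous_on[OF has_field_derivative_at_within[OF radial_odeD(2)[OF ode]]]; use \<alpha> in auto)+

lemma core: "closed (core k)" "core k \<subseteq> {\<alpha><..<\<beta>}"
proof -
  show "closed (core k)" unfolding core_def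
    by (intro continuous_on_closed_Collect_le continuous_on_const h_cont closed_atLeastAtMost)
  show "core k \<subseteq> {\<alpha><..<\<beta>}"
  proof
    fix s assume s: "s \<in> core k"
    then have "h s > 0" unfolding core_def using less_le_trans[of 0 "1 / real (Suc k)" "h s"] by simp
    then have "s \<noteq> \<alpha>" "s \<noteq> \<beta>" using h_bd by auto
    then show "s \<in> {\<alpha><..<\<beta>}" using s by (auto simp: core_def)
  qed
qed

lemma truncation_eq_0: "s \<notin> core k \<Longrightarrow> truncation k s = 0"
  by (auto simp: truncation_def core_def flat_def field_simps)

lemma truncation_D_k: "D_k j UNIV (truncation k)"
proof (rule D_k_extend_by_zero[OF _ core(1) core(2) _ truncation_eq_0])
  show "open {\<alpha><..<\<beta>}" by simp
  have "{\<alpha><..<\<beta>} \<subseteq> {0<..}" using \<alpha> by auto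
  then have h: "D_k j {\<alpha><..<\<beta>} h" using D_k_subset[OF radial_ode_D_k[OF ode]] by blast
  have "D_k j {\<alpha><..<\<beta>} (\<lambda>s. h s * flat 0 (real (Suc k) * h s + (- 1)))"
    by (intro D_k_mult h D_k_compose[OF _ D_k_flat] D_k_add D_k_const)
  then show "D_k j {\<alpha><..<\<beta>} (truncation k)"
    by (rule D_k_cong[rotated 2]) (auto simp: truncation_def)
qed

lemma truncation_deriv: "(truncation k has_real_derivative truncation' k s) (at s)"
proof (cases "s \<in> {\<alpha><..<\<beta>}")
  case True
  then have s: "s > 0" using \<alpha> by auto
  note d = radial_odeD(1)[OF ode s]
  have "((\<lambda>s. flat 0 (real (Suc k) * h s - 1)) has_real_derivative
      (flat (0 + 2) (real (Suc k) * h s - 1) - real 0 * flat (0 + 1) (real (Suc k) * h s - 1)) * (real (Suc k) * h1 s)) (at s)"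
    by (rule DERIV_chain2[OF DERIV_flat]) (auto intro!: derivative_eq_intros d)
  from DERIV_mult[OF d this]
  have "((\<lambda>s. h s * flat 0 (real (Suc k) * h s - 1)) has_real_derivative truncation' k s) (at s)"
    by (rule DERIV_cong) (use True in \<open>simp add: truncation'_def algebra_simps numeral_2_eq_2\<close>)
  then show ?thesis
    by (rule has_field_derivative_transform_within_open[of _ _ _ "{\<alpha><..<\<beta>}"]) (use True in \<open>auto simp: truncation_def\<close>)
next
  case False
  then have out: "s \<in> - core k" using core(2)[of k] by blast
  have "(truncation k has_real_derivative 0) (at s)"
    by (intro has_field_derivative_transform_within_open[OF DERIV_const open_Compl[OF core(1)[of k]] out])
      (simp add: truncation_eq_0)
  moreover have "truncation' k s = 0"
    unfolding truncation'_def by (rule if_not_P[OF False])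
  ultimately show ?thesis by (simp only:)
qed

definition approx :: "nat \<Rightarrow> real ^ 'n \<Rightarrow> real" where
  "approx k x = truncation k (x \<bullet> x)"

lemma approx_test: "approx k \<in> test_functions \<Omega>"
proof (rule test_functionsI)
  show "C_k j (approx k)" for j
    unfolding approx_def[abs_def] by (rule C_k_radial[OF truncation_D_k])
  let ?K = "{x :: real ^ 'n. x \<bullet> x \<in> core k}"
  have "closed ?K"
    using continuous_closed_vimage[OF core(1)[of k], of "\<lambda>x :: real ^ 'n. x \<bullet> x"]
    by (auto simp: vimage_def intro!: continuous_intros)
  moreover have sub: "?K \<subseteq> \<Omega>" using core(2)[of k] by (auto simp: shell_def)
  moreover have "bounded \<Omega>" by (rule bounded_shell)
  ultimately show "compact ?K" using bounded_subset compact_eq_bounded_closed by blast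
  show "?K \<subseteq> \<Omega>" by (rule sub)
  show "approx k x = 0" if "x \<notin> ?K" for x using truncation_eq_0 that by (simp add: approx_def)
qed

lemma partial_approx: "partial i (approx k) x = 2 * x $ i * truncation' k (x \<bullet> x)"
  using partial_eq[OF has_derivative_radial[OF truncation_deriv], of i]
  by (simp add: approx_def[abs_def] inner_axis)

end


section \<open>The radial solution as an element of the energy space\<close>

context radial_eigenfunction
begin

lemma finite_measure_shell: "finite_measure (lebesgue_on \<Omega>)"
  using lmeasurable_shell by (rule finite_measure_lebesgue_on)

lemma measurable_radial:
  fixes f :: "real \<Rightarrow> real"
  assumes "continuous_on {\<alpha><..<\<beta>} f"
  shows "(\<lambda>x. f (x \<bullet> x)) \<in> borel_measurable (lebesgue_on \<Omega>)"
proof -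
  have "continuous_on \<Omega> (\<lambda>x. f (x \<bullet> x))"
    by (rule continuous_on_compose2[OF assms]) (auto intro!: continuous_intros simp: shell_def)
  then show ?thesis
    by (rule continuous_imp_measurable_on_sets_lebesgue) (simp add: open_shell)
qed

text \<open>A constant is an integrable majorant because the shell has finite measure.\<close>

lemma dominated_radial:
  fixes f :: "nat \<Rightarrow> real \<Rightarrow> real"
  assumes cont: "\<And>k. continuous_on {\<alpha><..<\<beta>} (f k)"
    and bound: "\<And>k s. \<alpha> < s \<Longrightarrow> s < \<beta> \<Longrightarrow> \<bar>f k s\<bar> \<le> B"
    and lim: "\<And>s. \<alpha> < s \<Longrightarrow> s < \<beta> \<Longrightarrow> (\<lambda>k. f k s) \<longlonglongrightarrow> 0"
  shows "integrable (lebesgue_on \<Omega>) (\<lambda>x. f k (x \<bullet> x))"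
    "(\<lambda>k. \<integral>x. f k (x \<bullet> x) \<partial>lebesgue_on \<Omega>) \<longlonglongrightarrow> 0"
proof -
  interpret finite_measure "lebesgue_on \<Omega>" by (rule finite_measure_shell)
  show int: "integrable (lebesgue_on \<Omega>) (\<lambda>x. f k (x \<bullet> x))" for k
    by (rule integrable_const_bound[where B = B])
      (use bound measurable_radial[OF cont] in \<open>auto intro!: AE_I2 simp: shell_def\<close>)
  have "(\<lambda>k. \<integral>x. f k (x \<bullet> x) \<partial>lebesgue_on \<Omega>) \<longlonglongrightarrow> (\<integral>x. 0 \<partial>lebesgue_on \<Omega>)"
  proof (rule integral_dominated_convergence[where w = "\<lambda>x. B"])
    show "(\<lambda>x. f k (x \<bullet> x)) \<in> borel_measurable (lebesgue_on \<Omega>)" for k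
      by (rule measurable_radial[OF cont])
    show "AE x in lebesgue_on \<Omega>. (\<lambda>k. f k (x \<bullet> x)) \<longlonglongrightarrow> 0"
      by (rule AE_I2) (use lim in \<open>auto simp: shell_def\<close>)
    show "AE x in lebesgue_on \<Omega>. norm (f k (x \<bullet> x)) \<le> B" for k
      by (rule AE_I2) (use bound in \<open>auto simp: shell_def\<close>)
  qed auto
  then show "(\<lambda>k. \<integral>x. f k (x \<bullet> x) \<partial>lebesgue_on \<Omega>) \<longlonglongrightarrow> 0" by simp
qed

lemma h_bound: "\<exists>B. \<forall>s\<in>{\<alpha>..\<beta>}. \<bar>h s\<bar> \<le> B" and h1_bound: "\<exists>B. \<forall>s\<in>{\<alpha>..\<beta>}. \<bar>h1 s\<bar> \<le> B"
  using compact_imp_bounded[OF compact_continuous_image[OF h_cont compact_Icc]]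
    compact_imp_bounded[OF compact_continuous_image[OF h1_cont compact_Icc]]
  by (auto simp: bounded_iff)

lemma scaled_at_top:
  assumes "\<alpha> < s" "s < \<beta>"
  shows "filterlim (\<lambda>k. real (Suc k) * h s - 1) at_top sequentially"
proof -
  have "filterlim (\<lambda>k. real (Suc k)) at_top sequentially"
    by (rule filterlim_compose[OF filterlim_real_sequentially filterlim_Suc])
  then have "filterlim (\<lambda>k. h s * real (Suc k)) at_top sequentially"
    by (rule filterlim_tendsto_pos_mult_at_top[OF tendsto_const h_pos[OF assms]])
  then have "filterlim (\<lambda>k. - 1 + h s * real (Suc k)) at_top sequentially"
    by (rule filterlim_tendsto_add_at_top[OF tendsto_const])
  then show ?thesis by (simp add: mult.commute)
qed

lemma truncation_cont: "continuous_on S (truncation k)" and truncation'_cont: "continuous_on S (truncation' k)"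
proof -
  have "D_k (Suc 0) UNIV (truncation k)" by (rule truncation_D_k)
  then obtain f' where f': "\<And>x. (truncation k has_real_derivative f' x) (at x)" "continuous_on UNIV f'" by auto
  have "f' = truncation' k" using DERIV_unique[OF f'(1) truncation_deriv] by blast
  then show "continuous_on S (truncation' k)" using f'(2) continuous_on_subset by blast
  have "continuous_on UNIV (truncation k)" using truncation_D_k[of 0 k] by simp
  then show "continuous_on S (truncation k)" using continuous_on_subset by blast
qed

lemma w_L2: "w \<in> L2 \<Omega>"
proof -
  interpret finite_measure "lebesgue_on \<Omega>" by (rule finite_measure_shell)
  obtain B where B: "\<forall>s\<in>{\<alpha>..\<beta>}. \<bar>h s\<bar> \<le> B" using h_bound by blast
  have c: "continuous_on {\<alpha><..<\<beta>} h" by (rule continuous_on_subset[OF h_cont]) auto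
  have wm: "w \<in> borel_measurable (lebesgue_on \<Omega>)"
    unfolding w_def[abs_def] by (rule measurable_radial[OF c])
  have "integrable (lebesgue_on \<Omega>) (\<lambda>x. (w x)\<^sup>2)"
  proof (rule integrable_const_bound[where B = "B\<^sup>2"])
    show "AE x in lebesgue_on \<Omega>. norm ((w x)\<^sup>2) \<le> B\<^sup>2"
    proof (rule AE_I2)
      fix x assume "x \<in> space (lebesgue_on \<Omega>)"
      then have "\<bar>w x\<bar> \<le> B" using B by (auto simp: shell_def w_def)
      then have "\<bar>w x\<bar>\<^sup>2 \<le> B\<^sup>2" by (intro power_mono) auto
      then show "norm ((w x)\<^sup>2) \<le> B\<^sup>2" by simp
    qed
    show "(\<lambda>x. (w x)\<^sup>2) \<in> borel_measurable (lebesgue_on \<Omega>)" using wm by simp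
  qed
  then show ?thesis using wm by (simp add: L2_def)
qed

lemma approx_L2_limit: "(\<lambda>k. L2_norm \<Omega> (\<lambda>x. approx k x - w x)) \<longlonglongrightarrow> 0"
proof -
  obtain B where B: "\<forall>s\<in>{\<alpha>..\<beta>}. \<bar>h s\<bar> \<le> B" using h_bound by blast
  define f where "f k s = (truncation k s - h s) * (truncation k s - h s)" for k s
  have c: "continuous_on {\<alpha><..<\<beta>} h" by (rule continuous_on_subset[OF h_cont]) auto
  have eq: "truncation k s - h s = h s * (flat 0 (real (Suc k) * h s - 1) - 1)" if "\<alpha> < s" "s < \<beta>" for k s
    using that by (simp add: truncation_def algebra_simps)
  have "(\<lambda>k. \<integral>x. f k (x \<bullet> x) \<partial>lebesgue_on \<Omega>) \<longlonglongrightarrow> 0"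
  proof (rule dominated_radial(2))
    show "continuous_on {\<alpha><..<\<beta>} (f k)" for k
      unfolding f_def by (intro continuous_intros c truncation_cont)
    show "\<bar>f k s\<bar> \<le> B * B" if s: "\<alpha> < s" "s < \<beta>" for k s
    proof -
      have "\<bar>flat 0 (real (Suc k) * h s - 1) - 1\<bar> \<le> 1"
        using flat_le[of 0 "real (Suc k) * h s - 1"] by simp
      moreover have "\<bar>h s\<bar> \<le> B" using B s by simp
      ultimately have "\<bar>truncation k s - h s\<bar> \<le> B * 1"
        unfolding eq[OF s] abs_mult by (intro mult_mono) auto
      then show ?thesis unfolding f_def abs_mult by (intro mult_mono) auto
    qed
    show "(\<lambda>k. f k s) \<longlonglongrightarrow> 0" if s: "\<alpha> < s" "s < \<beta>" for s
    proof -
      have "(\<lambda>k. flat 0 (real (Suc k) * h s - 1)) \<longlonglongrightarrow> 1"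
        by (rule filterlim_compose[OF flat_limits(1) scaled_at_top[OF s]])
      then have "(\<lambda>k. h s * (flat 0 (real (Suc k) * h s - 1) - 1) * (h s * (flat 0 (real (Suc k) * h s - 1) - 1)))
          \<longlonglongrightarrow> h s * (1 - 1) * (h s * (1 - 1))"
        by (intro tendsto_intros)
      then show ?thesis unfolding f_def eq[OF s] by simp
    qed
  qed
  then have "(\<lambda>k. sqrt (\<integral>x. f k (x \<bullet> x) \<partial>lebesgue_on \<Omega>)) \<longlonglongrightarrow> sqrt 0" by (intro tendsto_intros)
  then show ?thesis by (simp add: L2_norm_def L2_inner_def f_def approx_def w_def)
qed

text \<open>Integration by parts turns the quantity into the energy of a difference. Both gradients
  are compared with that of w, to which they converge in L2.\<close>

lemma approx_energy_Cauchy: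
  assumes "e > 0"
  shows "\<exists>N. \<forall>j\<ge>N. \<forall>k\<ge>N. L2_inner \<Omega> (\<lambda>x. - laplacian (\<lambda>x. approx j x - approx k x) x) (\<lambda>x. approx j x - approx k x) < e"
proof -
  obtain B where B: "\<forall>s\<in>{\<alpha>..\<beta>}. \<bar>h1 s\<bar> \<le> B" using h1_bound by blast
  \<comment> \<open>The constant 8 is 4, from |2 x|^2 = 4 s, times 2, from (p - r)^2 \<le> 2 p^2 + 2
    r^2.\<close>
  define f where "f k s = 8 * s * ((truncation' k s - h1 s) * (truncation' k s - h1 s))" for k s
  define \<theta> where "\<theta> k s = flat 0 (real (Suc k) * h s - 1) + (real (Suc k) * h s - 1 + 1) * flat 2 (real (Suc k) * h s - 1) - 1" for k s
  have c: "continuous_on {\<alpha><..<\<beta>} h1" by (rule continuous_on_subset[OF h1_cont]) auto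
  have eq: "truncation' k s - h1 s = h1 s * \<theta> k s" if "\<alpha> < s" "s < \<beta>" for k s
    using that by (simp add: truncation'_def \<theta>_def right_diff_distrib distrib_left)
  note dom = dominated_radial[of f "8 * \<beta> * ((B * 4) * (B * 4))"]
  have cont: "continuous_on {\<alpha><..<\<beta>} (f k)" for k
    unfolding f_def by (intro continuous_intros c truncation'_cont)
  have bound: "\<bar>f k s\<bar> \<le> 8 * \<beta> * ((B * 4) * (B * 4))" if s: "\<alpha> < s" "s < \<beta>" for k s
  proof -
    have "\<bar>\<theta> k s\<bar> \<le> 4" unfolding \<theta>_def by (rule flat_factor_bound)
    moreover have "\<bar>h1 s\<bar> \<le> B" using B s by simp
    ultimately have t: "\<bar>truncation' k s - h1 s\<bar> \<le> B * 4"
      unfolding eq[OF s] abs_mult by (intro mult_mono) auto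
    have "\<bar>8 * s\<bar> \<le> 8 * \<beta>" using s \<alpha> by simp
    then show ?thesis unfolding f_def abs_mult[of "8 * s"] abs_mult[of "truncation' k s - h1 s"]
      using t by (intro mult_mono) auto
  qed
  have lim: "(\<lambda>k. f k s) \<longlonglongrightarrow> 0" if s: "\<alpha> < s" "s < \<beta>" for s
  proof -
    have "(\<lambda>k. \<theta> k s) \<longlonglongrightarrow> 1 + 0 - 1"
      unfolding \<theta>_def by (intro tendsto_diff tendsto_add tendsto_const
        filterlim_compose[OF flat_limits(1) scaled_at_top[OF s]]
        filterlim_compose[OF flat_limits(2) scaled_at_top[OF s]])
    then have "(\<lambda>k. 8 * s * (h1 s * \<theta> k s * (h1 s * \<theta> k s))) \<longlonglongrightarrow> 8 * s * (h1 s * (1 + 0 - 1) * (h1 s * (1 + 0 - 1)))"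
      by (intro tendsto_intros)
    then show ?thesis unfolding f_def eq[OF s] by simp
  qed
  note int = dom(1)[OF cont bound lim] and conv = dom(2)[OF cont bound lim]
  have "e / 2 > 0" using assms by simp
  from LIMSEQ_D[OF conv this] obtain N where N: "\<And>k. k \<ge> N \<Longrightarrow> \<bar>\<integral>x. f k (x \<bullet> x) \<partial>lebesgue_on \<Omega>\<bar> < e / 2"
    by auto
  have "L2_inner \<Omega> (\<lambda>x. - laplacian (\<lambda>x. approx j x - approx k x) x) (\<lambda>x. approx j x - approx k x) < e"
    if jk: "j \<ge> N" "k \<ge> N" for j k
  proof -
    define d where "d x = approx j x + (- 1) * approx k x" for x
    have dT: "d \<in> test_functions \<Omega>"
      unfolding d_def[abs_def] by (rule test_functions_combination(1)[OF approx_test approx_test])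
    have pd: "partial i d x = 2 * x $ i * (truncation' j (x \<bullet> x) - truncation' k (x \<bullet> x))" for i x
      unfolding d_def[abs_def] test_functions_combination(2)[OF approx_test approx_test] partial_approx
      by (simp add: algebra_simps)
    have "L2_inner \<Omega> (\<lambda>x. - laplacian d x) d = (\<integral>x. (\<Sum>i\<in>UNIV. partial i d x * partial i d x) \<partial>lebesgue_on \<Omega>)"
      by (rule integral_laplacian[OF open_shell dT dT])
    also have "\<dots> \<le> (\<integral>x. f j (x \<bullet> x) + f k (x \<bullet> x) \<partial>lebesgue_on \<Omega>)"
    proof (rule integral_mono)
      show "integrable (lebesgue_on \<Omega>) (\<lambda>x. \<Sum>i\<in>UNIV. partial i d x * partial i d x)"
        by (rule dirichlet_form_integrable[OF open_shell dT dT])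
      show "integrable (lebesgue_on \<Omega>) (\<lambda>x. f j (x \<bullet> x) + f k (x \<bullet> x))"
        by (intro Bochner_Integration.integrable_add int)
      fix x :: "real ^ 'n"
      assume "x \<in> space (lebesgue_on \<Omega>)"
      define p r where "p = truncation' j (x \<bullet> x) - h1 (x \<bullet> x)" and "r = truncation' k (x \<bullet> x) - h1 (x \<bullet> x)"
      have pdx: "partial i d x = 2 * x $ i * (p - r)" for i by (simp add: pd p_def r_def)
      have "(\<Sum>i\<in>UNIV. partial i d x * partial i d x) = (\<Sum>i\<in>UNIV. (x $ i * x $ i) * (4 * ((p - r) * (p - r))))"
        unfolding pdx by (intro sum.cong refl) (simp add: algebra_simps)
      also have "\<dots> = 4 * (x \<bullet> x) * ((p - r) * (p - r))"
        unfolding sum_distrib_right[symmetric] by (simp add: inner_vec_def)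
      also have "\<dots> \<le> 4 * (x \<bullet> x) * (2 * (p * p) + 2 * (r * r))"
      proof (rule mult_left_mono)
        have "0 \<le> (p + r) * (p + r)" by simp
        then show "(p - r) * (p - r) \<le> 2 * (p * p) + 2 * (r * r)" by (simp add: algebra_simps)
      qed simp
      also have "\<dots> = f j (x \<bullet> x) + f k (x \<bullet> x)" by (simp add: f_def p_def r_def algebra_simps)
      finally show "(\<Sum>i\<in>UNIV. partial i d x * partial i d x) \<le> f j (x \<bullet> x) + f k (x \<bullet> x)" .
    qed
    also have "\<dots> = (\<integral>x. f j (x \<bullet> x) \<partial>lebesgue_on \<Omega>) + (\<integral>x. f k (x \<bullet> x) \<partial>lebesgue_on \<Omega>)"
      by (rule Bochner_Integration.integral_add[OF int int])
    also have "\<dots> < e" using N[OF jk(1)] N[OF jk(2)] by linarith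
    finally show ?thesis by (simp add: d_def[abs_def])
  qed
  then show ?thesis by blast
qed

lemma w_energy_space: "w \<in> energy_space \<Omega> (test_functions \<Omega>) (\<lambda>v x. - laplacian v x)"
  unfolding energy_space_def
  using w_L2 approx_test approx_L2_limit approx_energy_Cauchy
  by (intro CollectI conjI exI[of _ approx]) blast+

lemma shell_contains_ball: "\<exists>z r. r > 0 \<and> ball z r \<subseteq> \<Omega>"
proof -
  define s where "s = (\<alpha> + \<beta>) / 2"
  have s: "\<alpha> < s" "s < \<beta>" "0 < s" using \<alpha> by (auto simp: s_def)
  define z :: "real ^ 'n" where "z = sqrt s *\<^sub>R axis undefined 1"
  have "z \<bullet> z = s" using s by (simp add: z_def inner_axis_axis)
  then have "z \<in> \<Omega>" using s by (simp add: shell_def)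
  then show ?thesis using open_shell open_contains_ball by blast
qed

lemma not_AE_w_zero: "\<not> (AE x in lebesgue_on \<Omega>. w x = 0)"
proof
  have s: "\<Omega> \<inter> space lebesgue \<in> sets lebesgue" by (simp add: fmeasurableD[OF lmeasurable_shell])
  assume "AE x in lebesgue_on \<Omega>. w x = 0"
  then have "AE x in lebesgue. x \<in> \<Omega> \<longrightarrow> w x = 0" by (subst (asm) AE_restrict_space_iff[OF s])
  then have "AE x in lborel. x \<in> \<Omega> \<longrightarrow> w x = 0" by (simp add: AE_completion_iff)
  moreover obtain z r where r: "r > 0" "ball z r \<subseteq> \<Omega>" using shell_contains_ball by blast
  ultimately obtain x where "x \<in> ball z r" "x \<in> \<Omega> \<longrightarrow> w x = 0"
    using AE_lborel_obtain_in_ball by blast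
  then show False using r(2) w_pos by fastforce
qed

text \<open>The weak equation puts \<open>w\<close> into the domain of the adjoint, and the
  approximation by \<open>approx\<close> puts it into the energy space.\<close>

lemma eigenfunction_w: "eigenfunction \<Omega> q w"
proof -
  have "(\<lambda>x. q * w x) \<in> L2 \<Omega>"
    using L2_combination[OF w_L2 w_L2, of "q - 1"] by (simp add: algebra_simps)
  then show ?thesis
    unfolding eigenfunction_def dirichlet_laplacian_def friedrichs_extension_def
    using w_energy_space weak_equation not_AE_w_zero by blast
qed

lemma L2_norm_w_pos: "L2_norm \<Omega> w > 0"
proof -
  have "L2_inner \<Omega> w w = 0 \<longleftrightarrow> (AE x in lebesgue_on \<Omega>. w x * w x = 0)"
    unfolding L2_inner_def by (intro integral_nonneg_eq_0_iff_AE L2_mult_integrable w_L2) auto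
  then have "L2_inner \<Omega> w w \<noteq> 0" using not_AE_w_zero by simp
  then show ?thesis unfolding L2_norm_def using L2_inner_ge_0[of \<Omega> w] by simp
qed

end


section \<open>The first eigenvalue of the annulus\<close>

text \<open>\<open>G\<close> is the partner of J in either parity, so one argument serves both
  equations.\<close>

lemma transcendental_eq:
  fixes n :: nat
  defines "\<nu> \<equiv> real n / 2 - 1"
  defines "G \<equiv> if even n then bessel_Y \<nu> else bessel_J (- real n / 2 + 1)"
  shows "transcendental n A \<kappa> = bessel_J \<nu> (\<kappa> * (1 + A / 2)) * G (\<kappa> * (A / 2)) - bessel_J \<nu> (\<kappa> * (A / 2)) * G (\<kappa> * (1 + A / 2))"
    "radial_profile n A \<kappa> r = vanishing_combination (bessel_J \<nu>) G (\<kappa> * (A / 2)) (\<kappa> * r)"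
  by (simp_all add: transcendental_def radial_profile_def \<nu>_def G_def)

lemma annulus_eq_shell:
  assumes "A > 0"
  shows "annulus A = shell ((A / 2)\<^sup>2) ((1 + A / 2)\<^sup>2)"
proof -
  have "A / 2 < r \<longleftrightarrow> (A / 2)\<^sup>2 < r\<^sup>2" "r < 1 + A / 2 \<longleftrightarrow> r\<^sup>2 < (1 + A / 2)\<^sup>2" if "r \<ge> 0" for r
    using assms that power_mono_iff[of r "A / 2" 2] power_mono_iff[of "1 + A / 2" r 2]
    unfolding not_le[symmetric] by simp_all
  then show ?thesis unfolding annulus_def shell_def dot_square_norm by auto
qed

text \<open>The prefactor is positive, so zeros in \<kappa> of the Bessel expression are zeros in q
  = \<kappa>^2 of the combination of y and z.\<close>

lemma bessel_product_scale:
  fixes F G y z :: "real \<Rightarrow> real" and \<kappa> r a \<nu> :: real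
  assumes F: "\<And>x. x > 0 \<Longrightarrow> F x = x powr \<nu> * y (x\<^sup>2)" and G: "\<And>x. x > 0 \<Longrightarrow> G x = x powr \<nu> * z (x\<^sup>2)"
    and pos: "\<kappa> > 0" "r > 0" "a > 0"
  shows "F (\<kappa> * r) * G (\<kappa> * a) - F (\<kappa> * a) * G (\<kappa> * r) =
    (\<kappa> * r) powr \<nu> * (\<kappa> * a) powr \<nu> * (y (\<kappa>\<^sup>2 * r\<^sup>2) * z (\<kappa>\<^sup>2 * a\<^sup>2) - y (\<kappa>\<^sup>2 * a\<^sup>2) * z (\<kappa>\<^sup>2 * r\<^sup>2))"
proof -
  have p: "\<kappa> * r > 0" "\<kappa> * a > 0" using pos by simp_all
  show ?thesis
    unfolding F[OF p(1)] F[OF p(2)] G[OF p(1)] G[OF p(2)] power_mult_distrib by (simp add: algebra_simps)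
qed

theorem theorem10:
  fixes A :: real
  assumes "CARD('n::finite) > 3" and "A > 0"
  shows "\<exists>\<kappa>. smallest_positive_root (transcendental CARD('n) A) \<kappa> \<and>
             first_eigenvalue (annulus A :: (real ^ 'n) set) (\<kappa>\<^sup>2) \<and>
             simple_eigenvalue (annulus A :: (real ^ 'n) set) (\<kappa>\<^sup>2) \<and>
             (\<exists>c w. eigenfunction (annulus A :: (real ^ 'n) set) (\<kappa>\<^sup>2) w \<and>
                    L2_norm (annulus A) w = 1 \<and>
                    (\<forall>x\<in>annulus A. w x =
                       c / norm x powr (real CARD('n) / 2 - 1) * radial_profile CARD('n) A \<kappa> (norm x)))"
proof -
  define n where "n = CARD('n)"
  define \<nu> where "\<nu> = real n / 2 - 1"
  define G where "G = (if even n then bessel_Y \<nu> else bessel_J (- real n / 2 + 1))"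
  define a b where "a = A / 2" and "b = 1 + A / 2"
  have a1: "1 + a = b" by (simp add: a_def b_def)
  have ab: "0 < a" "a < b" "0 < b" "0 < a\<^sup>2" "a\<^sup>2 < b\<^sup>2" using assms(2) by (auto simp: a_def b_def power_strict_mono)
  have n: "n > 2" and nu: "\<nu> > 0" "real CARD('n) = 2 * (\<nu> + 1)" using assms(1) by (auto simp: n_def \<nu>_def)
  obtain y y1 y2 z z1 z2 where y: "bessel_ode \<nu> (\<lambda>s. 0) y y1 y2" and z: "bessel_ode \<nu> (\<lambda>s. 0) z z1 z2"
    and wr: "\<forall>s>0. y s * z1 s - y1 s * z s \<noteq> 0"
    and FG: "\<forall>x>0. bessel_J \<nu> x = x powr \<nu> * y (x\<^sup>2) \<and> G x = x powr \<nu> * z (x\<^sup>2)"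
    using bessel_pair[OF n] unfolding \<nu>_def[symmetric] G_def[symmetric] by (elim exE conjE)
  define D where "D = (\<lambda>q s. y (q * s) * z (q * a\<^sup>2) - y (q * a\<^sup>2) * z (q * s))"
  obtain q where q: "q > 0" "D q (b\<^sup>2) = 0" "\<forall>p. 0 < p \<and> p < q \<longrightarrow> D p (b\<^sup>2) \<noteq> 0"
    and "\<exists>\<sigma>. \<sigma> \<noteq> 0 \<and> (\<forall>s. a\<^sup>2 < s \<and> s < b\<^sup>2 \<longrightarrow> \<sigma> * D q s > 0)"
    using bessel_ground_state[OF y z _ nu(1) ab(4,5)] wr unfolding D_def by blast
  then obtain \<sigma> where \<sigma>: "\<forall>s. a\<^sup>2 < s \<and> s < b\<^sup>2 \<longrightarrow> \<sigma> * D q s > 0" by blast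
  define \<kappa> where "\<kappa> = sqrt q"
  have \<kappa>: "\<kappa> > 0" "\<kappa>\<^sup>2 = q" using q(1) by (auto simp: \<kappa>_def)
  have F: "bessel_J \<nu> x = x powr \<nu> * y (x\<^sup>2)" and G: "G x = x powr \<nu> * z (x\<^sup>2)" if "x > 0" for x
    using FG that by auto
  have scale: "bessel_J \<nu> (k * r) * G (k * a) - bessel_J \<nu> (k * a) * G (k * r) =
      (k * r) powr \<nu> * (k * a) powr \<nu> * D (k\<^sup>2) (r\<^sup>2)" if "k > 0" "r > 0" for k r
    unfolding D_def by (rule bessel_product_scale[OF F G that ab(1)])
  have tr: "transcendental n A k = (k * b) powr \<nu> * (k * a) powr \<nu> * D (k\<^sup>2) (b\<^sup>2)" if "k > 0" for k
    unfolding transcendental_eq(1) \<nu>_def[symmetric] G_def[symmetric] a_def[symmetric] a1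
    by (rule scale[OF that ab(3)])
  have tr0: "transcendental n A k = 0 \<longleftrightarrow> D (k\<^sup>2) (b\<^sup>2) = 0" if "k > 0" for k
    using tr[OF that] that ab by simp
  have root: "smallest_positive_root (transcendental n A) \<kappa>"
    unfolding smallest_positive_root_def
  proof (intro conjI allI impI)
    show "\<kappa> > 0" by (rule \<kappa>(1))
    show "transcendental n A \<kappa> = 0" using tr0[OF \<kappa>(1)] q(2) \<kappa>(2) by simp
    fix k assume k: "0 < k \<and> transcendental n A k = 0"
    then have k0: "0 \<le> k" and D0: "D (k\<^sup>2) (b\<^sup>2) = 0" and k2: "0 < k\<^sup>2" using tr0[of k] by auto
    have "\<not> k\<^sup>2 < q" using q(3) D0 k2 by blast
    then have "\<kappa>\<^sup>2 \<le> k\<^sup>2" unfolding \<kappa>(2) by simp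
    then show "\<kappa> \<le> k" using k0 by (rule power2_le_imp_le)
  qed
  have ode: "radial_ode \<nu> q (D q) (\<lambda>s. q * (y1 (q * s) * z (q * a\<^sup>2) - y (q * a\<^sup>2) * z1 (q * s)))
      (\<lambda>s. q * (q * (y2 (q * s) * z (q * a\<^sup>2) - y (q * a\<^sup>2) * z2 (q * s))))"
    unfolding D_def by (rule radial_ode_combination[OF y z q(1)])
  \<comment> \<open>Stated for any factor c that makes the profile positive: it is applied with
    \<sigma> first and then with \<tau>, which depends on the norm of the first function.\<close>
  have loc: "radial_eigenfunction TYPE('n) \<nu> q (a\<^sup>2) (b\<^sup>2) (\<lambda>s. c * D q s)
      (\<lambda>s. c * (q * (y1 (q * s) * z (q * a\<^sup>2) - y (q * a\<^sup>2) * z1 (q * s))))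
      (\<lambda>s. c * (q * (q * (y2 (q * s) * z (q * a\<^sup>2) - y (q * a\<^sup>2) * z2 (q * s)))))"
    if "\<And>s. a\<^sup>2 < s \<Longrightarrow> s < b\<^sup>2 \<Longrightarrow> c * D q s > 0" for c
  proof
    show "c * D q (a\<^sup>2) = 0" by (simp add: D_def)
    show "c * D q (b\<^sup>2) = 0" using q(2) by simp
  qed (use radial_ode_cmult[OF ode] nu ab that in auto)
  have \<Omega>: "annulus A = (shell (a\<^sup>2) (b\<^sup>2) :: (real ^ 'n) set)"
    using annulus_eq_shell[OF assms(2)] by (simp add: a_def b_def)
  interpret E0: radial_eigenfunction "TYPE('n)" \<nu> q "a\<^sup>2" "b\<^sup>2" "\<lambda>s. \<sigma> * D q s"
    "\<lambda>s. \<sigma> * (q * (y1 (q * s) * z (q * a\<^sup>2) - y (q * a\<^sup>2) * z1 (q * s)))"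
    "\<lambda>s. \<sigma> * (q * (q * (y2 (q * s) * z (q * a\<^sup>2) - y (q * a\<^sup>2) * z2 (q * s))))"
    by (rule loc) (use \<sigma> in auto)
  define N where "N = L2_norm (annulus A) E0.w"
  have N: "N > 0" unfolding N_def \<Omega> by (rule E0.L2_norm_w_pos)
  define \<tau> where "\<tau> = \<sigma> / N"
  have \<tau>: "\<tau> * D q s > 0" if "a\<^sup>2 < s" "s < b\<^sup>2" for s
    using \<sigma> that N by (simp add: \<tau>_def)
  interpret E: radial_eigenfunction "TYPE('n)" \<nu> q "a\<^sup>2" "b\<^sup>2" "\<lambda>s. \<tau> * D q s"
    "\<lambda>s. \<tau> * (q * (y1 (q * s) * z (q * a\<^sup>2) - y (q * a\<^sup>2) * z1 (q * s)))"
    "\<lambda>s. \<tau> * (q * (q * (y2 (q * s) * z (q * a\<^sup>2) - y (q * a\<^sup>2) * z2 (q * s))))"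
    by (rule loc) (rule \<tau>)
  have norm1: "L2_norm (annulus A) E.w = 1"
  proof -
    have "E.w x * E.w x = (1 / N\<^sup>2) * (E0.w x * E0.w x)" for x
      unfolding E.w_def E0.w_def by (simp add: \<tau>_def power2_eq_square)
    then have "L2_inner (annulus A) E.w E.w = (1 / N\<^sup>2) * L2_inner (annulus A) E0.w E0.w"
      unfolding L2_inner_def by simp
    then have "L2_norm (annulus A) E.w = (1 / N) * L2_norm (annulus A) E0.w"
      unfolding L2_norm_def using N by (simp add: real_sqrt_mult real_sqrt_divide)
    then show ?thesis using N by (simp add: N_def[symmetric])
  qed
  have eig: "eigenfunction (annulus A :: (real ^ 'n) set) (\<kappa>\<^sup>2) E.w"
    unfolding \<Omega> \<kappa>(2) by (rule E.eigenfunction_w)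
  have first: "first_eigenvalue (annulus A :: (real ^ 'n) set) (\<kappa>\<^sup>2)"
  proof -
    have "eigenvalue (annulus A :: (real ^ 'n) set) (\<kappa>\<^sup>2)" using eig unfolding eigenvalue_def by blast
    then show ?thesis unfolding first_eigenvalue_def \<Omega> \<kappa>(2) using E.eigenvalue_ge by blast
  qed
  have conn: "connected (shell (a\<^sup>2) (b\<^sup>2) :: (real ^ 'n) set)"
  proof -
    have eq: "annulus A = {x :: real ^ 'n. A / 2 < norm (x - 0) \<and> norm (x - 0) < 1 + A / 2}"
      by (simp add: annulus_def)
    have "connected (annulus A :: (real ^ 'n) set)"
      unfolding eq by (rule connected_annulus(1)) (use assms(1) in simp)
    then show ?thesis unfolding \<Omega> .
  qed
  have simple: "simple_eigenvalue (annulus A :: (real ^ 'n) set) (\<kappa>\<^sup>2)"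
    unfolding simple_eigenvalue_def
    using eig E.eigenfunction_unique[OF conn] unfolding \<Omega> \<kappa>(2) by blast
  have formula: "\<exists>c. \<forall>x\<in>annulus A. E.w x = c / norm x powr \<nu> * radial_profile n A \<kappa> (norm x)"
  proof (cases "G (\<kappa> * a) = 0")
    \<comment> \<open>The exceptional case: D q s reduces to - y (q a^2) z (q s), a multiple of the
      profile \<open>G\<close> that \<open>vanishing_combination\<close> returns. The power of
      \<kappa> in the constant undoes the one in G (\<kappa> r).\<close>
    case True
    have ka: "\<kappa> * a > 0" using \<kappa>(1) ab(1) by simp
    have z0: "z (q * a\<^sup>2) = 0"
      using True G[OF ka] \<kappa>(1) ab(1) by (simp add: power_mult_distrib \<kappa>(2))
    have "E.w x = (- \<tau> * y (q * a\<^sup>2) / \<kappa> powr \<nu>) / norm x powr \<nu> * radial_profile n A \<kappa> (norm x)" if "x \<in> annulus A" for x :: "real ^ 'n"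
    proof -
      have r: "norm x > 0" using that assms(2) by (auto simp: annulus_def)
      have kr: "\<kappa> * norm x > 0" using r \<kappa>(1) by simp
      have "radial_profile n A \<kappa> (norm x) = G (\<kappa> * norm x)"
        unfolding transcendental_eq(2) \<nu>_def[symmetric] G_def[symmetric] a_def[symmetric] vanishing_combination_def
        using True by simp
      also have "\<dots> = \<kappa> powr \<nu> * norm x powr \<nu> * z (q * (x \<bullet> x))"
        unfolding G[OF kr] using r \<kappa> by (simp add: powr_mult power_mult_distrib dot_square_norm)
      finally show ?thesis
        using r \<kappa>(1) unfolding E.w_def by (simp add: D_def z0)
    qed
    then show ?thesis by blast
  next
    case False
    have ka: "\<kappa> * a > 0" using \<kappa>(1) ab(1) by simp
    \<comment> \<open>The constant undoes the division by G (\<kappa> a) in the profile and the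
      powers of \<kappa> and \<kappa> a that come from \<open>scale\<close>.\<close>
    have "E.w x = (\<tau> * G (\<kappa> * a) / (\<kappa> powr \<nu> * (\<kappa> * a) powr \<nu>)) / norm x powr \<nu> * radial_profile n A \<kappa> (norm x)" if "x \<in> annulus A" for x :: "real ^ 'n"
    proof -
      have r: "norm x > 0" using that assms(2) by (auto simp: annulus_def)
      have "G (\<kappa> * a) * radial_profile n A \<kappa> (norm x) =
          bessel_J \<nu> (\<kappa> * norm x) * G (\<kappa> * a) - bessel_J \<nu> (\<kappa> * a) * G (\<kappa> * norm x)"
        unfolding transcendental_eq(2) \<nu>_def[symmetric] G_def[symmetric] a_def[symmetric] vanishing_combination_def
        using False by (simp add: field_simps)
      also have "\<dots> = \<kappa> powr \<nu> * (\<kappa> * a) powr \<nu> * norm x powr \<nu> * D q (x \<bullet> x)"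
        unfolding scale[OF \<kappa>(1) r] using r \<kappa> by (simp add: powr_mult dot_square_norm)
      finally have p: "G (\<kappa> * a) * radial_profile n A \<kappa> (norm x) =
          \<kappa> powr \<nu> * (\<kappa> * a) powr \<nu> * norm x powr \<nu> * D q (x \<bullet> x)" .
      have "(\<tau> * G (\<kappa> * a) / (\<kappa> powr \<nu> * (\<kappa> * a) powr \<nu>)) / norm x powr \<nu> * radial_profile n A \<kappa> (norm x) =
          \<tau> * (G (\<kappa> * a) * radial_profile n A \<kappa> (norm x)) / (\<kappa> powr \<nu> * (\<kappa> * a) powr \<nu> * norm x powr \<nu>)"
        by simp
      also have "\<dots> = \<tau> * D q (x \<bullet> x)"
      proof -
        have "\<kappa> powr \<nu> \<noteq> 0" "(\<kappa> * a) powr \<nu> \<noteq> 0" "norm x powr \<nu> \<noteq> 0" using r \<kappa>(1) ab(1) by simp_all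
        then show ?thesis unfolding p by (simp add: field_simps)
      qed
      finally show ?thesis unfolding E.w_def by (rule sym)
    qed
    then show ?thesis by blast
  qed
  show ?thesis
    using root first simple eig norm1 formula unfolding n_def \<nu>_def by blast
qed

end
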